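(* Let $0<\rho<1$, $0\le\delta<\rho$, $m,s,\kappa\in\mathbb R$, $0<p\le\infty$, $0<q,t\le\infty$, and $\sigma_p(\rho):=d(1-\rho)\left|\frac1p-\frac12\right|$. (i) If, for every $a\in S^m_{\rho,\delta,\triangle}(\mathbb T^d\times\mathbb Z^d)$, one has either boundedness of $$A_a:B^{s+m+\kappa}_{p,q,+}(\mathbb T^d)\to B^s_{p,t,+}(\mathbb T^d)$$ or, when $p<\infty$, boundedness of $$A_a:F^{s+m+\kappa}_{p,q,+}(\mathbb T^d)\to F^s_{p,t,+}(\mathbb T^d),$$ then $\kappa\ge\sigma_p(\rho)$. (ii) If $$A_a:B^{s+m+\sigma_p(\rho)}_{p,q,+}(\mathbb T^d)\to B^s_{p,t,+}(\mathbb T^d)$$ is bounded for every $a\in S^m_{\rho,\delta,\triangle}(\mathbb T^d\times\mathbb Z^d)$, then $q\le t$. Both conclusions hold, through boundary values, on the corresponding holomorphic spaces, i.e. with $B^u_{p,r,+}(\mathbb T^d)$ and $F^u_{p,r,+}(\mathbb T^d)$ replaced throughout by $\mathcal B^u_{p,r}(\mathbb D^d)$ and $\mathcal F^u_{p,r}(\mathbb D^d)$.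
   Context: Fix $d\in\mathbb N$; $\mathbb T^d=\mathbb R^d/(2\pi\mathbb Z)^d$, $\mathbb D^d=\{z\in\mathbb C^d:|z_j|<1\text{ for all }j\}$; $1/\infty=0$. $\widehat f(n)=(2\pi)^{-d}\int_{[0,2\pi]^d}f(x)e^{-in\cdot x}\,dx$, extended by duality to periodic distributions $\mathcal D'(\mathbb T^d)$. $\mathcal D'_+(\mathbb T^d)=\{f\in\mathcal D'(\mathbb T^d):\widehat f(n)=0\text{ for }n\notin\mathbb N_0^d\}$. Symbols: $\Delta_{n_j}g(n)=g(n+e_j)-g(n)$, $\Delta_n^\alpha=\Delta_{n_1}^{\alpha_1}\cdots\Delta_{n_d}^{\alpha_d}$, $\langle n\rangle=(1+|n|^2)^{1/2}$. $S^m_{\rho,\delta}(\mathbb T^d\times\mathbb Z^d)$ consists of the $a:\mathbb T^d\times\mathbb Z^d\to\mathbb C$, smooth in $x$, with $|\Delta_n^\alpha\partial_x^\beta a(x,n)|\le C_{\alpha,\beta}\langle n\rangle^{m-\rho|\alpha|+\delta|\beta|}$ for all $\alpha,\beta\in\mathbb N_0^d$. Put $a_\nu(n)=(2\pi)^{-d}\int_{[0,2\pi]^d}a(x,n)e^{-i\nu\cdot x}dx$. $S^m_{\rho,\delta,\triangle}$ is the set of $a\in S^m_{\rho,\delta}$ with $a_\nu(n)=0$ whenever $n\in\mathbb N_0^d$ and $n+\nu\notin\mathbb N_0^d$. Quantization: $A_af(x)=\sum_{n\in\mathbb Z^d}a(x,n)\widehat f(n)e^{in\cdot x}$ (in the sense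 of distributions). Spaces: choose $\varphi_0,\varphi\in C_c^\infty(\mathbb R^d)$ with $\operatorname{supp}\varphi_0\subset\{|\xi|\le2\}$, $\operatorname{supp}\varphi\subset\{1/2\le|\xi|\le2\}$, $\varphi_0(\xi)+\sum_{j\ge1}\varphi(2^{-j}\xi)=1$; $\varphi_j=\varphi(2^{-j}\cdot)$ for $j\ge1$; $\Delta_jf=\sum_n\varphi_j(n)\widehat f(n)e^{in\cdot x}$. Then $\|f\|_{B^s_{p,q}(\mathbb T^d)}=\|\{2^{js}\|\Delta_jf\|_{L^p(\mathbb T^d)}\}_{j\ge0}\|_{\ell^q}$ ($0<p,q\le\infty$), and $\|f\|_{F^s_{p,q}(\mathbb T^d)}=\big\|\,\|\{2^{js}\Delta_jf(x)\}_{j\ge0}\|_{\ell^q}\big\|_{L^p_x(\mathbb T^d)}$ ($0<p<\infty$, $0<q\le\infty$). The spaces consist of the $f\in\mathcal D'(\mathbb T^d)$ with finite quasi-norm. $B^s_{p,q,+}=B^s_{p,q}\cap\mathcal D'_+$, $F^s_{p,q,+}=F^s_{p,q}\cap\mathcal D'_+$, with the restricted quasi-norms. Holomorphic spaces: $\mathcal B^s_{p,q}(\mathbb D^d)$ (resp. $\mathcal F^s_{p,q}(\mathbb D^d)$) is the set of holomorphic functions $f(z)=\sum_{n\in\mathbb N_0^d}c_nz^n$ on $\mathbb D^d$ whose distributional boundary value $\sum_{n\in\mathbb N_0^d}c_ne^{in\cdot x}$ belongs to $B^s_{p,q,+}(\mathbb T^d)$ (resp. $F^s_{p,q,+}(\mathbb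 T^d)$), with the quasi-norm of the boundary value. Every element of $\mathcal D'_+(\mathbb T^d)$ is the boundary value of a unique holomorphic function on $\mathbb D^d$; $A_a$ acts on holomorphic functions through this identification. *)

theory Defs
  imports "HOL-Analysis.Analysis" "HOL-Probability.Essential_Supremum"
begin

text \<open>
  The dimension is \<open>d = CARD('d)\<close>. Functions on the torus are the functions on
  \<open>real ^ 'd\<close> that are invariant under translations by \<open>2 * pi\<close> times an integer vector.
\<close>

section \<open>Lattice, characters, multi-indices\<close>

definition lat :: "int ^ 'd \<Rightarrow> real ^ 'd" where
  "lat n = (\<chi> j. real_of_int (n $ j))"

definition nonneg_lat :: "(int ^ 'd) set" where
  "nonneg_lat = {n. \<forall>j. 0 \<le> n $ j}"

definition jbr :: "int ^ 'd \<Rightarrow> real" where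
  "jbr n = sqrt (1 + (norm (lat n))\<^sup>2)"

definition chr :: "int ^ 'd \<Rightarrow> real ^ 'd \<Rightarrow> complex" where
  "chr n x = exp (\<i> * of_real (lat n \<bullet> x))"

definition msize :: "nat ^ 'd \<Rightarrow> nat" where
  "msize \<alpha> = (\<Sum>j\<in>UNIV. \<alpha> $ j)"

text \<open>The index type carries no order, so an enumeration of it is chosen in order to compose the
  coordinate operators. These commute (the derivatives do so on smooth functions), hence the
  choice is immaterial.\<close>

definition coords :: "'d::finite list" where
  "coords = (SOME js. distinct js \<and> set js = UNIV)"

definition partial :: "'d \<Rightarrow> (real ^ 'd \<Rightarrow> complex) \<Rightarrow> (real ^ 'd \<Rightarrow> complex)" where
  "partial j f = (\<lambda>x. vector_derivative (\<lambda>t. f (x + t *\<^sub>R axis j 1)) (at 0))"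

definition mpartial :: "nat ^ 'd \<Rightarrow> (real ^ 'd \<Rightarrow> complex) \<Rightarrow> (real ^ 'd \<Rightarrow> complex)" where
  "mpartial \<beta> = foldr (\<lambda>j. partial j ^^ (\<beta> $ j)) coords"

definition diff_op :: "'d \<Rightarrow> (int ^ 'd \<Rightarrow> complex) \<Rightarrow> (int ^ 'd \<Rightarrow> complex)" where
  "diff_op j g = (\<lambda>n. g (n + axis j 1) - g n)"

definition mdiff :: "nat ^ 'd \<Rightarrow> (int ^ 'd \<Rightarrow> complex) \<Rightarrow> (int ^ 'd \<Rightarrow> complex)" where
  "mdiff \<alpha> = foldr (\<lambda>j. diff_op j ^^ (\<alpha> $ j)) coords"

text \<open>All iterated partial derivatives, in any order, are (Frechet) differentiable, and so in
  particular continuous.\<close>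

definition smooth :: "(real ^ 'd \<Rightarrow> complex) \<Rightarrow> bool" where
  "smooth f \<longleftrightarrow> (\<forall>js. foldr partial js f differentiable_on UNIV)"


section \<open>The torus and periodic distributions\<close>

definition torus :: "(real ^ 'd) measure" where
  "torus = restrict_space lborel (cbox 0 (\<chi> j. 2 * pi))"

definition torus_smooth :: "(real ^ 'd \<Rightarrow> complex) set" where
  "torus_smooth = {f. smooth f \<and> (\<forall>x k. f (x + (2 * pi) *\<^sub>R lat k) = f x)}"

text \<open>Continuous linear functionals on the Frechet space \<^term>\<open>torus_smooth\<close>. They are
  normalized to vanish off the test functions, so that two distributions are equal as HOL
  functions as soon as they agree on test functions.\<close>

definition torus_distr :: "((real ^ 'd \<Rightarrow> complex) \<Rightarrow> complex) set" where
  "torus_distr = {u.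
     (\<forall>\<psi>. \<psi> \<notin> torus_smooth \<longrightarrow> u \<psi> = 0) \<and>
     (\<forall>\<psi>\<in>torus_smooth. \<forall>\<eta>\<in>torus_smooth. u (\<lambda>x. \<psi> x + \<eta> x) = u \<psi> + u \<eta>) \<and>
     (\<forall>c. \<forall>\<psi>\<in>torus_smooth. u (\<lambda>x. c * \<psi> x) = c * u \<psi>) \<and>
     (\<exists>C N. \<forall>\<psi>\<in>torus_smooth.
        norm (u \<psi>) \<le> C * (\<Sum>\<beta> | msize \<beta> \<le> N. (SUP x. norm (mpartial \<beta> \<psi> x))))}"

text \<open>A function \<open>f\<close> is identified with the functional sending \<open>\<psi>\<close> to the integral of
  \<open>f * \<psi>\<close> over the torus (no conjugation, no normalization).\<close>

definition fourier :: "((real ^ 'd \<Rightarrow> complex) \<Rightarrow> complex) \<Rightarrow> int ^ 'd \<Rightarrow> complex" where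
  "fourier u n = u (chr (- n)) / of_real ((2 * pi) ^ CARD('d))"

definition torus_distr_plus :: "((real ^ 'd \<Rightarrow> complex) \<Rightarrow> complex) set" where
  "torus_distr_plus = {u \<in> torus_distr. \<forall>n. n \<notin> nonneg_lat \<longrightarrow> fourier u n = 0}"


section \<open>Symbols and quantization\<close>

definition symbols :: "real \<Rightarrow> real \<Rightarrow> real \<Rightarrow> (real ^ 'd \<Rightarrow> int ^ 'd \<Rightarrow> complex) set" where
  "symbols m \<rho> \<delta> = {a.
     (\<forall>n. (\<lambda>x. a x n) \<in> torus_smooth) \<and>
     (\<forall>\<alpha> \<beta>. \<exists>C. \<forall>x n.
        norm (mdiff \<alpha> (\<lambda>k. mpartial \<beta> (\<lambda>y. a y k) x) n)
          \<le> C * jbr n powr (m - \<rho> * real (msize \<alpha>) + \<delta> * real (msize \<beta>)))}"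

definition symbol_coeff ::
    "(real ^ 'd \<Rightarrow> int ^ 'd \<Rightarrow> complex) \<Rightarrow> int ^ 'd \<Rightarrow> int ^ 'd \<Rightarrow> complex" where
  "symbol_coeff a \<nu> n =
     (LINT x|torus. a x n * chr (- \<nu>) x) / of_real ((2 * pi) ^ CARD('d))"

definition tri_symbols :: "real \<Rightarrow> real \<Rightarrow> real \<Rightarrow> (real ^ 'd \<Rightarrow> int ^ 'd \<Rightarrow> complex) set" where
  "tri_symbols m \<rho> \<delta> = {a \<in> symbols m \<rho> \<delta>.
     \<forall>n \<nu>. n \<in> nonneg_lat \<and> n + \<nu> \<notin> nonneg_lat \<longrightarrow> symbol_coeff a \<nu> n = 0}"

text \<open>The defining series is summed in the sense of distributions: each smooth function
  \<open>\<lambda>x. a x n * chr n x\<close> is tested against \<open>\<psi>\<close>. For symbols with \<open>\<delta> < 1\<close> the resulting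
  numerical series converges absolutely.\<close>

definition quant :: "(real ^ 'd \<Rightarrow> int ^ 'd \<Rightarrow> complex) \<Rightarrow>
    ((real ^ 'd \<Rightarrow> complex) \<Rightarrow> complex) \<Rightarrow> ((real ^ 'd \<Rightarrow> complex) \<Rightarrow> complex)" where
  "quant a u = (\<lambda>\<psi>. if \<psi> \<in> torus_smooth
     then (\<Sum>\<^sub>\<infinity>n. fourier u n * (LINT x|torus. a x n * chr n x * \<psi> x)) else 0)"


section \<open>Besov and Triebel--Lizorkin spaces\<close>

definition epow :: "ennreal \<Rightarrow> real \<Rightarrow> ennreal" where
  "epow x r = (if x = \<infinity> then \<infinity> else ennreal (enn2real x powr r))"

text \<open>The \<open>L\<^sup>p\<close> quasi-norm of a nonnegative function, for \<open>0 < p \<le> \<infinity>\<close>. With respect to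
  \<^term>\<open>count_space UNIV :: nat measure\<close> it is the \<open>\<ell>\<^sup>p\<close> quasi-norm of a sequence.\<close>

definition Lp_qnorm :: "'a measure \<Rightarrow> ennreal \<Rightarrow> ('a \<Rightarrow> ennreal) \<Rightarrow> ennreal" where
  "Lp_qnorm M p f =
     (if p = \<infinity> then esssup M f
      else epow (\<integral>\<^sup>+x. epow (f x) (enn2real p) \<partial>M) (1 / enn2real p))"

definition lp_resolution :: "(real ^ 'd \<Rightarrow> complex) \<Rightarrow> (real ^ 'd \<Rightarrow> complex) \<Rightarrow> bool" where
  "lp_resolution \<phi>\<^sub>0 \<phi> \<longleftrightarrow>
     smooth \<phi>\<^sub>0 \<and> smooth \<phi> \<and>
     closure {\<xi>. \<phi>\<^sub>0 \<xi> \<noteq> 0} \<subseteq> {\<xi>. norm \<xi> \<le> 2} \<and>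
     closure {\<xi>. \<phi> \<xi> \<noteq> 0} \<subseteq> {\<xi>. 1 / 2 \<le> norm \<xi> \<and> norm \<xi> \<le> 2} \<and>
     (\<forall>\<xi>. (\<lambda>j. \<phi> ((1 / 2 ^ Suc j) *\<^sub>R \<xi>)) sums (1 - \<phi>\<^sub>0 \<xi>))"

definition lp_cutoff ::
    "(real ^ 'd \<Rightarrow> complex) \<Rightarrow> (real ^ 'd \<Rightarrow> complex) \<Rightarrow> nat \<Rightarrow> real ^ 'd \<Rightarrow> complex" where
  "lp_cutoff \<phi>\<^sub>0 \<phi> j \<xi> = (if j = 0 then \<phi>\<^sub>0 \<xi> else \<phi> ((1 / 2 ^ j) *\<^sub>R \<xi>))"

definition lp_block ::
    "(real ^ 'd \<Rightarrow> complex) \<Rightarrow> (real ^ 'd \<Rightarrow> complex) \<Rightarrow> nat \<Rightarrow>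
     ((real ^ 'd \<Rightarrow> complex) \<Rightarrow> complex) \<Rightarrow> real ^ 'd \<Rightarrow> complex" where
  "lp_block \<phi>\<^sub>0 \<phi> j u x = (\<Sum>\<^sub>\<infinity>n. lp_cutoff \<phi>\<^sub>0 \<phi> j (lat n) * fourier u n * chr n x)"

definition besov_qnorm ::
    "(real ^ 'd \<Rightarrow> complex) \<Rightarrow> (real ^ 'd \<Rightarrow> complex) \<Rightarrow> real \<Rightarrow> ennreal \<Rightarrow> ennreal \<Rightarrow>
     ((real ^ 'd \<Rightarrow> complex) \<Rightarrow> complex) \<Rightarrow> ennreal" where
  "besov_qnorm \<phi>\<^sub>0 \<phi> s p q u =
     Lp_qnorm (count_space UNIV) q
       (\<lambda>j. ennreal (2 powr (real j * s)) *
            Lp_qnorm torus p (\<lambda>x. ennreal (norm (lp_block \<phi>\<^sub>0 \<phi> j u x))))"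

definition tl_qnorm ::
    "(real ^ 'd \<Rightarrow> complex) \<Rightarrow> (real ^ 'd \<Rightarrow> complex) \<Rightarrow> real \<Rightarrow> ennreal \<Rightarrow> ennreal \<Rightarrow>
     ((real ^ 'd \<Rightarrow> complex) \<Rightarrow> complex) \<Rightarrow> ennreal" where
  "tl_qnorm \<phi>\<^sub>0 \<phi> s p q u =
     Lp_qnorm torus p
       (\<lambda>x. Lp_qnorm (count_space UNIV) q
          (\<lambda>j. ennreal (2 powr (real j * s)) * ennreal (norm (lp_block \<phi>\<^sub>0 \<phi> j u x))))"

definition besov_plus ::
    "(real ^ 'd \<Rightarrow> complex) \<Rightarrow> (real ^ 'd \<Rightarrow> complex) \<Rightarrow> real \<Rightarrow> ennreal \<Rightarrow> ennreal \<Rightarrow>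
     ((real ^ 'd \<Rightarrow> complex) \<Rightarrow> complex) set" where
  "besov_plus \<phi>\<^sub>0 \<phi> s p q = {u \<in> torus_distr_plus. besov_qnorm \<phi>\<^sub>0 \<phi> s p q u < \<infinity>}"

definition tl_plus ::
    "(real ^ 'd \<Rightarrow> complex) \<Rightarrow> (real ^ 'd \<Rightarrow> complex) \<Rightarrow> real \<Rightarrow> ennreal \<Rightarrow> ennreal \<Rightarrow>
     ((real ^ 'd \<Rightarrow> complex) \<Rightarrow> complex) set" where
  "tl_plus \<phi>\<^sub>0 \<phi> s p q = {u \<in> torus_distr_plus. tl_qnorm \<phi>\<^sub>0 \<phi> s p q u < \<infinity>}"


section \<open>Holomorphic functions on the polydisc\<close>

definition polydisc :: "(complex ^ 'd) set" where
  "polydisc = {z. \<forall>j. norm (z $ j) < 1}"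

definition mpow :: "complex ^ 'd \<Rightarrow> int ^ 'd \<Rightarrow> complex" where
  "mpow z n = (\<Prod>j\<in>UNIV. (z $ j) ^ nat (n $ j))"

text \<open>Functions on the polydisc are normalized to vanish outside it.\<close>

definition hol_polydisc :: "(complex ^ 'd \<Rightarrow> complex) set" where
  "hol_polydisc = {f.
     (\<forall>z. z \<notin> polydisc \<longrightarrow> f z = 0) \<and>
     (\<forall>z\<in>polydisc. \<exists>f'. (f has_derivative f') (at z) \<and> (\<forall>c v. f' (c *s v) = c * f' v))}"

definition has_boundary_value ::
    "(complex ^ 'd \<Rightarrow> complex) \<Rightarrow> ((real ^ 'd \<Rightarrow> complex) \<Rightarrow> complex) \<Rightarrow> bool" where
  "has_boundary_value f u \<longleftrightarrow> f \<in> hol_polydisc \<and> u \<in> torus_distr \<and>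
     (\<exists>c. (\<forall>z\<in>polydisc. ((\<lambda>n. c n * mpow z n) has_sum f z) nonneg_lat) \<and>
          (\<forall>\<psi>\<in>torus_smooth. ((\<lambda>n. c n * (LINT x|torus. chr n x * \<psi> x)) has_sum u \<psi>) nonneg_lat))"

definition boundary_value ::
    "(complex ^ 'd \<Rightarrow> complex) \<Rightarrow> ((real ^ 'd \<Rightarrow> complex) \<Rightarrow> complex)" where
  "boundary_value f = (THE u. has_boundary_value f u)"

definition hol_extension ::
    "((real ^ 'd \<Rightarrow> complex) \<Rightarrow> complex) \<Rightarrow> (complex ^ 'd \<Rightarrow> complex)" where
  "hol_extension u = (THE f. has_boundary_value f u)"

definition hol_quant :: "(real ^ 'd \<Rightarrow> int ^ 'd \<Rightarrow> complex) \<Rightarrow>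
    (complex ^ 'd \<Rightarrow> complex) \<Rightarrow> (complex ^ 'd \<Rightarrow> complex)" where
  "hol_quant a f = hol_extension (quant a (boundary_value f))"

definition hol_besov ::
    "(real ^ 'd \<Rightarrow> complex) \<Rightarrow> (real ^ 'd \<Rightarrow> complex) \<Rightarrow> real \<Rightarrow> ennreal \<Rightarrow> ennreal \<Rightarrow>
     (complex ^ 'd \<Rightarrow> complex) set" where
  "hol_besov \<phi>\<^sub>0 \<phi> s p q = {f. \<exists>u\<in>besov_plus \<phi>\<^sub>0 \<phi> s p q. has_boundary_value f u}"

definition hol_tl ::
    "(real ^ 'd \<Rightarrow> complex) \<Rightarrow> (real ^ 'd \<Rightarrow> complex) \<Rightarrow> real \<Rightarrow> ennreal \<Rightarrow> ennreal \<Rightarrow>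
     (complex ^ 'd \<Rightarrow> complex) set" where
  "hol_tl \<phi>\<^sub>0 \<phi> s p q = {f. \<exists>u\<in>tl_plus \<phi>\<^sub>0 \<phi> s p q. has_boundary_value f u}"

definition hol_besov_qnorm ::
    "(real ^ 'd \<Rightarrow> complex) \<Rightarrow> (real ^ 'd \<Rightarrow> complex) \<Rightarrow> real \<Rightarrow> ennreal \<Rightarrow> ennreal \<Rightarrow>
     (complex ^ 'd \<Rightarrow> complex) \<Rightarrow> ennreal" where
  "hol_besov_qnorm \<phi>\<^sub>0 \<phi> s p q f = besov_qnorm \<phi>\<^sub>0 \<phi> s p q (boundary_value f)"

definition hol_tl_qnorm ::
    "(real ^ 'd \<Rightarrow> complex) \<Rightarrow> (real ^ 'd \<Rightarrow> complex) \<Rightarrow> real \<Rightarrow> ennreal \<Rightarrow> ennreal \<Rightarrow>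
     (complex ^ 'd \<Rightarrow> complex) \<Rightarrow> ennreal" where
  "hol_tl_qnorm \<phi>\<^sub>0 \<phi> s p q f = tl_qnorm \<phi>\<^sub>0 \<phi> s p q (boundary_value f)"


section \<open>Boundedness\<close>

definition bounded_map ::
    "('a \<Rightarrow> 'b) \<Rightarrow> 'a set \<Rightarrow> ('a \<Rightarrow> ennreal) \<Rightarrow> 'b set \<Rightarrow> ('b \<Rightarrow> ennreal) \<Rightarrow> bool" where
  "bounded_map T X NX Y NY \<longleftrightarrow>
     (\<exists>C::real. \<forall>f\<in>X. T f \<in> Y \<and> NY (T f) \<le> ennreal C * NX f)"

definition bounded_besov where
  "bounded_besov \<phi>\<^sub>0 \<phi> a s' s p q t \<longleftrightarrow>
     bounded_map (quant a)
       (besov_plus \<phi>\<^sub>0 \<phi> s' p q) (besov_qnorm \<phi>\<^sub>0 \<phi> s' p q)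
       (besov_plus \<phi>\<^sub>0 \<phi> s p t) (besov_qnorm \<phi>\<^sub>0 \<phi> s p t)"

definition bounded_tl where
  "bounded_tl \<phi>\<^sub>0 \<phi> a s' s p q t \<longleftrightarrow>
     bounded_map (quant a)
       (tl_plus \<phi>\<^sub>0 \<phi> s' p q) (tl_qnorm \<phi>\<^sub>0 \<phi> s' p q)
       (tl_plus \<phi>\<^sub>0 \<phi> s p t) (tl_qnorm \<phi>\<^sub>0 \<phi> s p t)"

definition bounded_hol_besov where
  "bounded_hol_besov \<phi>\<^sub>0 \<phi> a s' s p q t \<longleftrightarrow>
     bounded_map (hol_quant a)
       (hol_besov \<phi>\<^sub>0 \<phi> s' p q) (hol_besov_qnorm \<phi>\<^sub>0 \<phi> s' p q)
       (hol_besov \<phi>\<^sub>0 \<phi> s p t) (hol_besov_qnorm \<phi>\<^sub>0 \<phi> s p t)"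

definition bounded_hol_tl where
  "bounded_hol_tl \<phi>\<^sub>0 \<phi> a s' s p q t \<longleftrightarrow>
     bounded_map (hol_quant a)
       (hol_tl \<phi>\<^sub>0 \<phi> s' p q) (hol_tl_qnorm \<phi>\<^sub>0 \<phi> s' p q)
       (hol_tl \<phi>\<^sub>0 \<phi> s p t) (hol_tl_qnorm \<phi>\<^sub>0 \<phi> s p t)"

text \<open>\<open>inverse \<infinity> = 0\<close> in \<^typ>\<open>ennreal\<close>.\<close>

definition sigma_loss :: "nat \<Rightarrow> ennreal \<Rightarrow> real \<Rightarrow> real" where
  "sigma_loss d p \<rho> = real d * (1 - \<rho>) * \<bar>enn2real (inverse p) - 1 / 2\<bar>"

end

theory Submission
  imports Defs
begin

text \<open>
  The hypothesis concerns all symbols, so one well chosen symbol suffices, and it may be taken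
  independent of \<open>x\<close>: such a symbol is a Fourier multiplier and preserves the positive orthant of
  frequencies. Write \<open>d\<close> for the dimension.

  At frequencies near \<open>R = 2\<^sup>j\<close> the multiplier lives in a cube whose side is a fixed fraction of \<open>R\<close>.
  The cube is divided into cells of side \<open>L\<close>, about \<open>R\<^sup>\<rho>\<close>, and each cell carries a smooth bump with a
  sign in front (\<open>block\<close>, \<open>osc\<close>). Every difference gains a factor \<open>1 / L\<close>, so this is a symbol of
  type \<open>\<rho>\<close> (\<open>osc_differences\<close>). The signs are products of Rudin--Shapiro signs. Therefore the
  kernel is as flat as it can be: up to constants, which are suppressed here, it is bounded by
  \<open>(R * L) powr (d / 2)\<close>, the trivial bound \<open>R ^ d\<close> divided by the square root of the number of
  cells (\<open>blk_kernel\<close>).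

  For \<open>p < 2\<close> the multiplier acts on the kernel of a smooth window on the scale \<open>R\<close>, whose
  \<open>L\<^sup>p\<close> size is \<open>R powr (d - d / p)\<close>, by summation by parts (\<open>kernel_pointwise\<close>, \<open>decay_Lr\<close>). The image
  has an \<open>L\<^sup>2\<close> norm of the order \<open>R powr (d / 2)\<close> by Parseval's identity and is bounded by
  \<open>(R * L) powr (d / 2)\<close>. Hoelder's inequality then makes its \<open>L\<^sup>p\<close> size exceed that of the input by a
  factor \<open>(R / L) powr (d * (1 / p - 1 / 2))\<close>, that is \<open>2 powr (j * \<sigma>)\<close> (\<open>extremal_small\<close>). For
  \<open>p \<ge> 2\<close> the conjugate multiplier is put into the input, which is then flat, while the output has
  almost positive coefficients and peaks at the origin (\<open>extremal_large\<close>).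

  A function with frequencies near \<open>R\<close> meets at most three Littlewood--Paley blocks. Its Besov and
  its Triebel--Lizorkin quasi-norm are thus comparable with a power of \<open>R\<close> times an \<open>L\<^sup>p\<close> size, and
  letting \<open>j\<close> tend to infinity gives \<open>\<kappa> \<ge> \<sigma>\<close> (\<open>besov_loss\<close>, \<open>tl_loss\<close>). When \<open>\<kappa> = \<sigma>\<close>, the sum of
  \<open>N\<close> normalized inputs at separated scales gives \<open>N powr (1 / t) \<le> C * N powr (1 / q)\<close> for all
  \<open>N\<close>, hence \<open>q \<le> t\<close> (\<open>besov_fine_index\<close>). The cutoff number \<open>j\<close> of a general resolution of unity
  is known to equal one only on the sphere of radius \<open>2\<^sup>j\<close>. This is why the cube is kept in a small
  neighbourhood of one point of that sphere, the one on the diagonal.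

  All test functions are trigonometric polynomials with frequencies in the positive orthant. Their
  holomorphic extensions are polynomials, so the statements on the polydisc reduce to the very
  same inequality (\<open>hol_bounded_imp_tpoly_bounded\<close>).
\<close>

section \<open>Characters and integration over the torus\<close>

lemma lat_add [simp]: "lat (m + n) = lat m + lat n"
  and lat_minus [simp]: "lat (- n) = - lat n"
  and lat_diff [simp]: "lat (m - n) = lat m - lat n"
  and lat_zero [simp]: "lat 0 = 0"
  and lat_axis [simp]: "lat (axis j 1) = axis j 1"
  by (auto simp: lat_def vec_eq_iff axis_def)

lemma lat_nth [simp]: "lat n $ j = real_of_int (n $ j)"
  by (simp add: lat_def)

lemma chr_add: "chr (m + n) x = chr m x * chr n x"
  by (simp add: chr_def inner_add_left distrib_left flip: exp_add)

lemma chr_shift: "chr n (x + y) = chr n x * chr n y"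
  by (simp add: chr_def inner_add_right distrib_left flip: exp_add)

lemma chr_uminus: "chr (- n) x = cnj (chr n x)" "chr n (- x) = cnj (chr n x)"
  by (simp_all add: chr_def exp_cnj)

lemma norm_chr [simp]: "norm (chr n x) = 1"
  by (simp add: chr_def)

lemma chr_zero [simp]: "chr 0 x = 1" "chr n 0 = 1"
  by (simp_all add: chr_def)

lemma continuous_on_chr [continuous_intros]:
  "continuous_on S f \<Longrightarrow> continuous_on S (\<lambda>x. chr n (f x))"
  unfolding chr_def by (intro continuous_intros)

lemma chr_prod: "chr n x = (\<Prod>k\<in>UNIV. exp (\<i> * of_real (real_of_int (n $ k) * x $ k)))"
  by (simp add: chr_def inner_vec_def sum_distrib_left flip: exp_sum)

lemma lborel_vec_integral_prod:
  fixes h :: "'d::finite \<Rightarrow> real \<Rightarrow> complex"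
  assumes h: "\<And>k. integrable lborel (h k)"
  shows "(LINT x|(lborel :: (real ^ 'd) measure). (\<Prod>k\<in>UNIV. h k (x $ k)))
           = (\<Prod>k\<in>UNIV. LINT t|lborel. h k t)"
proof -
  have [measurable]: "\<And>k. h k \<in> borel_measurable borel"
    using h borel_measurable_integrable by fastforce
  \<comment> \<open>The measure is a product over the standard basis; \<open>ix\<close> names the coordinate of a basis vector.\<close>
  define ix where "ix = (\<lambda>b :: real ^ 'd. THE k. b = axis k 1)"
  have ix: "ix (axis k 1) = k" for k
    unfolding ix_def by (rule the_equality) (auto simp: axis_eq_axis)
  have B: "(Basis :: (real ^ 'd) set) = range (\<lambda>k. axis k 1)"
    by (auto simp: Basis_vec_def)
  have inj: "inj (\<lambda>k :: 'd. axis k (1::real))"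
    by (auto simp: inj_def axis_eq_axis)
  interpret product_sigma_finite "\<lambda>b :: real ^ 'd. lborel :: real measure"
    by standard
  have nth: "(\<Sum>b\<in>Basis. f b *\<^sub>R b) $ k = f (axis k 1)" for f :: "real ^ 'd \<Rightarrow> real" and k
  proof -
    have "(\<Sum>b\<in>Basis. f b *\<^sub>R b) $ k = (\<Sum>i\<in>UNIV. f (axis i 1) * axis i 1 $ k)"
      unfolding B by (subst sum.reindex[OF inj]) (simp)
    also have "\<dots> = (\<Sum>i\<in>UNIV. if i = k then f (axis k 1) else 0)"
      by (intro sum.cong) (auto simp: axis_def)
    finally show ?thesis by simp
  qed
  have "(LINT x|(lborel :: (real ^ 'd) measure). (\<Prod>k\<in>UNIV. h k (x $ k)))
      = (LINT f|(\<Pi>\<^sub>M b\<in>(Basis :: (real ^ 'd) set). lborel). (\<Prod>k\<in>UNIV. h k ((\<Sum>b\<in>Basis. f b *\<^sub>R b) $ k)))"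
    by (subst lborel_eq, subst integral_distr) (auto intro!: borel_measurable_prod)
  also have "\<dots> = (LINT f|(\<Pi>\<^sub>M b\<in>(Basis :: (real ^ 'd) set). lborel). (\<Prod>b\<in>Basis. h (ix b) (f b)))"
    unfolding nth unfolding B by (subst prod.reindex[OF inj]) (simp add: ix)
  also have "\<dots> = (\<Prod>b\<in>Basis. LINT t|lborel. h (ix b) t)"
    by (rule product_integral_prod) (auto intro: h)
  also have "\<dots> = (\<Prod>k\<in>UNIV. LINT t|lborel. h k t)"
    unfolding B by (subst prod.reindex[OF inj]) (simp add: ix)
  finally show ?thesis .
qed

lemma lborel_vec_nn_integral_prod:
  fixes h :: "'d::finite \<Rightarrow> real \<Rightarrow> ennreal"
  assumes [measurable]: "\<And>k. h k \<in> borel_measurable borel"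
  shows "(\<integral>\<^sup>+x. (\<Prod>k\<in>UNIV. h k (x $ k)) \<partial>(lborel :: (real ^ 'd) measure))
           = (\<Prod>k\<in>UNIV. \<integral>\<^sup>+t. h k t \<partial>lborel)"
proof -
  \<comment> \<open>The measure is a product over the standard basis; \<open>ix\<close> names the coordinate of a basis vector.\<close>
  define ix where "ix = (\<lambda>b :: real ^ 'd. THE k. b = axis k 1)"
  have ix: "ix (axis k 1) = k" for k
    unfolding ix_def by (rule the_equality) (auto simp: axis_eq_axis)
  have B: "(Basis :: (real ^ 'd) set) = range (\<lambda>k. axis k 1)"
    by (auto simp: Basis_vec_def)
  have inj: "inj (\<lambda>k :: 'd. axis k (1::real))"
    by (auto simp: inj_def axis_eq_axis)
  have 1: "(\<Prod>b\<in>Basis. h (ix b) (x \<bullet> b)) = (\<Prod>k\<in>UNIV. h k (x $ k))" for x :: "real ^ 'd"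
    unfolding B by (subst prod.reindex[OF inj]) (simp add: ix inner_axis)
  have 2: "(\<Prod>b\<in>(Basis :: (real ^ 'd) set). \<integral>\<^sup>+t. h (ix b) t \<partial>lborel) = (\<Prod>k\<in>UNIV. \<integral>\<^sup>+t. h k t \<partial>lborel)"
    unfolding B by (subst prod.reindex[OF inj]) (simp add: ix)
  show ?thesis
    using nn_integral_lborel_prod[of "\<lambda>b. h (ix b)"] unfolding 1 2 by simp
qed

lemma indicator_torus_box:
  "indicator (cbox 0 (\<chi> j. 2 * pi)) x = (\<Prod>k\<in>UNIV. indicator {0..2*pi} (x $ k) :: 'b::comm_semiring_1)"
  for x :: "real ^ 'd::finite"
proof (cases "x \<in> cbox 0 (\<chi> j. 2 * pi)")
  case False
  then obtain k where "x $ k \<notin> {0..2*pi}" by (auto simp: mem_box_cart)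
  then have "\<exists>k\<in>UNIV. (indicator {0..2*pi} (x $ k) :: 'b) = 0" by (auto intro!: exI[of _ k])
  then show ?thesis using False by (simp add: prod_zero)
qed (auto simp: mem_box_cart)

lemma torus_nn_integral_prod:
  fixes h :: "real \<Rightarrow> ennreal"
  assumes [measurable]: "h \<in> borel_measurable borel"
  shows "(\<integral>\<^sup>+x. (\<Prod>k\<in>UNIV. h (x $ k)) \<partial>(torus :: (real ^ 'd::finite) measure))
           = (\<integral>\<^sup>+t. h t * indicator {0..2*pi} t \<partial>lborel) ^ CARD('d)"
proof -
  have "(\<integral>\<^sup>+x. (\<Prod>k\<in>UNIV. h (x $ k)) \<partial>(torus :: (real ^ 'd) measure))
      = (\<integral>\<^sup>+x. (\<Prod>k\<in>UNIV. h (x $ k) * indicator {0..2*pi} (x $ k)) \<partial>(lborel :: (real ^ 'd) measure))"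
    unfolding torus_def
    by (subst nn_integral_restrict_space) (auto simp: indicator_torus_box prod.distrib)
  also have "\<dots> = (\<integral>\<^sup>+t. h t * indicator {0..2*pi} t \<partial>lborel) ^ CARD('d)"
    by (subst lborel_vec_nn_integral_prod) auto
  finally show ?thesis .
qed

lemma space_torus: "space torus = cbox 0 (\<chi> j. 2 * pi)"
  by (simp add: torus_def space_restrict_space)

lemma emeasure_torus: "emeasure (torus :: (real ^ 'd::finite) measure) (space torus) = ennreal ((2 * pi) ^ CARD('d))"
proof -
  have "emeasure (torus :: (real ^ 'd) measure) (space torus) = (\<integral>\<^sup>+x. (\<Prod>k\<in>(UNIV :: 'd set). 1) \<partial>(torus :: (real ^ 'd) measure))"
    by simp
  also have "\<dots> = (\<integral>\<^sup>+t. (1::ennreal) * indicator {0..2*pi} t \<partial>lborel) ^ CARD('d)"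
    using torus_nn_integral_prod[where h = "\<lambda>_. 1" and 'd = 'd] by simp
  finally show ?thesis by (simp add: ennreal_power)
qed

lemma measure_torus: "measure (torus :: (real ^ 'd::finite) measure) (space torus) = (2 * pi) ^ CARD('d)"
  by (simp add: measure_def emeasure_torus)

lemma finite_measure_torus: "finite_measure torus"
  by standard (simp add: emeasure_torus)

lemma borel_measurable_torus [measurable_dest]:
  assumes "continuous_on UNIV f"
  shows "f \<in> borel_measurable torus"
  using borel_measurable_continuous_onI[OF assms] unfolding torus_def
  by (intro measurable_restrict_space1) simp

lemma integrable_torus [intro]:
  fixes f :: "real ^ 'd::finite \<Rightarrow> complex"
  assumes "continuous_on UNIV f"
  shows "integrable torus f"
proof -
  have "compact (f ` cbox 0 (\<chi> j. 2 * pi))"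
    by (intro compact_continuous_image continuous_on_subset[OF assms]) auto
  then obtain B where "\<forall>x\<in>cbox 0 (\<chi> j. 2 * pi). norm (f x) \<le> B"
    by (auto dest!: compact_imp_bounded simp: bounded_iff)
  interpret finite_measure "torus :: (real ^ 'd) measure" by (rule finite_measure_torus)
  show ?thesis
    using \<open>\<forall>x\<in>_. norm (f x) \<le> B\<close>
    by (intro integrable_const_bound[of _ B]) (auto simp: space_torus borel_measurable_torus[OF assms])
qed

lemma integral_exp_period:
  fixes k :: int
  shows "integrable lborel (\<lambda>t. indicator {0..2*pi} t *\<^sub>R exp (\<i> * of_real (real_of_int k * t)))"
    and "(LINT t|lborel. indicator {0..2*pi} t *\<^sub>R exp (\<i> * of_real (real_of_int k * t)))
           = (if k = 0 then 2 * pi else 0)"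
proof -
  let ?f = "\<lambda>t. exp (\<i> * of_real (real_of_int k * t))"
  have "has_bochner_integral lborel (\<lambda>t. indicator {0..2*pi} t *\<^sub>R ?f t) (if k = 0 then 2 * pi else 0)"
  proof (cases "k = 0")
    case True
    have "has_bochner_integral lborel (\<lambda>t. indicator {0..2*pi} t *\<^sub>R ?f t) (of_real (2*pi) - of_real 0)"
      by (rule has_bochner_integral_FTC_Icc[where F = "\<lambda>t. of_real t"])
         (auto simp: True intro!: derivative_eq_intros has_vector_derivative_of_real)
    then show ?thesis using True by simp
  next
    case False
    let ?F = "\<lambda>t. ?f t / (\<i> * of_int k)"
    have "has_bochner_integral lborel (\<lambda>t. indicator {0..2*pi} t *\<^sub>R ?f t) (?F (2*pi) - ?F 0)"
    proof (rule has_bochner_integral_FTC_Icc)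
      show "(?F has_vector_derivative ?f x) (at x within {0..2*pi})" for x
      proof -
        have "((\<lambda>z. exp (\<i> * (of_int k * z)) / (\<i> * of_int k)) has_field_derivative exp (\<i> * (of_int k * of_real x)))
                 (at (complex_of_real x))"
          using False by (auto intro!: derivative_eq_intros simp: field_simps)
        from has_vector_derivative_real_field[OF this] show ?thesis
          by (auto intro: has_vector_derivative_at_within)
      qed
    qed (auto intro!: continuous_intros)
    moreover have "?F (2*pi) - ?F 0 = 0"
    proof -
      have "exp (\<i> * of_real (real_of_int k * (2 * pi))) = 1"
        by (simp add: exp_eq_1)
      then show ?thesis by simp
    qed
    ultimately show ?thesis using False by simp
  qed
  then show "integrable lborel (\<lambda>t. indicator {0..2*pi} t *\<^sub>R ?f t)"
    "(LINT t|lborel. indicator {0..2*pi} t *\<^sub>R ?f t) = (if k = 0 then 2 * pi else 0)"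
    by (auto simp: has_bochner_integral_iff)
qed

lemma integral_chr:
  "(LINT x|torus. chr n x) = (if n = (0 :: int ^ 'd::finite) then of_real ((2 * pi) ^ CARD('d)) else 0)"
proof -
  have "(LINT x|torus. chr n x) = (LINT x|lborel. indicator (cbox 0 (\<chi> j. 2 * pi)) x *\<^sub>R chr n x)"
    unfolding torus_def by (subst integral_restrict_space) auto
  also have "\<dots> = (LINT x|lborel. (\<Prod>k\<in>UNIV. indicator {0..2*pi} (x $ k) *\<^sub>R exp (\<i> * of_real (real_of_int (n $ k) * x $ k))))"
    by (simp add: indicator_torus_box chr_prod prod.distrib scaleR_conv_of_real)
  also have "\<dots> = (\<Prod>k\<in>UNIV. LINT t|lborel. indicator {0..2*pi} t *\<^sub>R exp (\<i> * of_real (real_of_int (n $ k) * t)))"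
    by (rule lborel_vec_integral_prod) (rule integral_exp_period)
  also have "\<dots> = (\<Prod>k\<in>UNIV. if n $ k = 0 then 2 * pi else 0)"
    unfolding integral_exp_period by simp
  also have "\<dots> = (if n = 0 then of_real ((2 * pi) ^ CARD('d)) else 0)"
    by (cases "n = 0") (auto simp: vec_eq_iff)
  finally show ?thesis .
qed

section \<open>Trigonometric polynomials\<close>

definition tpoly :: "(int ^ 'd \<Rightarrow> complex) \<Rightarrow> real ^ 'd \<Rightarrow> complex" where
  "tpoly c x = (\<Sum>n | c n \<noteq> 0. c n * chr n x)"

lemma tpoly_eq_sum:
  assumes "finite S" "\<And>n. c n \<noteq> 0 \<Longrightarrow> n \<in> S"
  shows "tpoly c x = (\<Sum>n\<in>S. c n * chr n x)"
  unfolding tpoly_def by (rule sum.mono_neutral_left) (use assms in auto)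

lemma continuous_on_tpoly [continuous_intros]: "continuous_on S (tpoly c)"
  unfolding tpoly_def by (intro continuous_intros)

lemma integral_tpoly_chr:
  fixes c :: "int ^ 'd::finite \<Rightarrow> complex"
  assumes "finite {n. c n \<noteq> 0}"
  shows "(LINT x|torus. tpoly c x * chr (- m) x) = c m * of_real ((2 * pi) ^ CARD('d))"
proof -
  have "(LINT x|torus. tpoly c x * chr (- m) x) = (LINT x|torus. (\<Sum>n | c n \<noteq> 0. c n * chr (n - m) x))"
    by (simp add: tpoly_def sum_distrib_right mult.assoc flip: chr_add)
  also have "\<dots> = (\<Sum>n | c n \<noteq> 0. c n * (LINT x|torus. chr (n - m) x))"
    by (subst Bochner_Integration.integral_sum) (auto intro!: integrable_torus continuous_intros)
  also have "\<dots> = (\<Sum>n | c n \<noteq> 0. if n = m then c n * of_real ((2 * pi) ^ CARD('d)) else 0)"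
    by (intro sum.cong) (auto simp: integral_chr)
  also have "\<dots> = c m * of_real ((2 * pi) ^ CARD('d))"
    using assms by (subst sum.delta) auto
  finally show ?thesis .
qed

lemma parseval:
  fixes c :: "int ^ 'd::finite \<Rightarrow> complex"
  assumes fin: "finite {n. c n \<noteq> 0}"
  shows "(\<integral>\<^sup>+x. ennreal ((norm (tpoly c x))\<^sup>2) \<partial>torus) = ennreal ((2 * pi) ^ CARD('d) * (\<Sum>n | c n \<noteq> 0. (norm (c n))\<^sup>2))"
proof -
  have int: "integrable torus (\<lambda>x. of_real ((norm (tpoly c x))\<^sup>2) :: complex)"
    by (intro integrable_torus continuous_intros)
  have "complex_of_real (LINT x|torus. (norm (tpoly c x))\<^sup>2) = (LINT x|torus. of_real ((norm (tpoly c x))\<^sup>2))"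
    by (rule integral_complex_of_real[symmetric])
  also have "\<dots> = (LINT x|torus. (\<Sum>n | c n \<noteq> 0. cnj (c n) * (tpoly c x * chr (- n) x)))"
  proof (intro Bochner_Integration.integral_cong refl)
    fix x
    have "complex_of_real ((norm (tpoly c x))\<^sup>2) = tpoly c x * cnj (tpoly c x)"
      by (simp only: complex_norm_square flip: of_real_power)
    also have "cnj (tpoly c x) = (\<Sum>n | c n \<noteq> 0. cnj (c n) * chr (- n) x)"
      by (simp add: tpoly_def chr_uminus)
    finally show "complex_of_real ((norm (tpoly c x))\<^sup>2) = (\<Sum>n | c n \<noteq> 0. cnj (c n) * (tpoly c x * chr (- n) x))"
      by (simp add: sum_distrib_left mult_ac)
  qed
  also have "\<dots> = (\<Sum>n | c n \<noteq> 0. cnj (c n) * (LINT x|torus. tpoly c x * chr (- n) x))"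
    by (subst Bochner_Integration.integral_sum) (auto intro!: integrable_torus continuous_intros)
  also have "\<dots> = of_real ((2 * pi) ^ CARD('d) * (\<Sum>n | c n \<noteq> 0. (norm (c n))\<^sup>2))"
  proof -
    have eq: "cnj z * (z * w) = of_real ((norm z)\<^sup>2) * w" for z w
      by (simp only: complex_norm_square mult_ac)
    show ?thesis
      unfolding integral_tpoly_chr[OF fin] eq by (simp add: sum_distrib_left mult_ac)
  qed
  finally have eq: "(LINT x|torus. (norm (tpoly c x))\<^sup>2) = (2 * pi) ^ CARD('d) * (\<Sum>n | c n \<noteq> 0. (norm (c n))\<^sup>2)"
    unfolding of_real_eq_iff .
  have "integrable torus (\<lambda>x. (norm (tpoly c x))\<^sup>2)"
    using int unfolding complex_of_real_integrable_eq .
  from nn_integral_eq_integral[OF this] show ?thesis by (simp add: eq)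
qed

text \<open>The product of two coefficient families belongs to the convolution of the two polynomials, so
  an \<open>L\<^sup>1\<close> bound for one of them and a uniform bound for the other suffice. The average over
  the torus carries a factor below one, which is dropped.\<close>

lemma tpoly_mult_bound:
  fixes b g :: "int ^ 'd::finite \<Rightarrow> complex"
  assumes fb: "finite {n. b n \<noteq> 0}" and fg: "finite {n. g n \<noteq> 0}"
    and Bb: "\<And>x. norm (tpoly b x) \<le> B"
    and G: "(\<integral>\<^sup>+x. ennreal (norm (tpoly g x)) \<partial>torus) \<le> ennreal G" and "0 \<le> G"
  shows "norm (tpoly (\<lambda>n. g n * b n) x) \<le> B * G"
proof -
  have "of_real ((2 * pi) ^ CARD('d)) * tpoly (\<lambda>n. g n * b n) x
      = (\<Sum>n | b n \<noteq> 0. b n * chr n x * (LINT y|torus. tpoly g y * chr (- n) y))"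
    unfolding integral_tpoly_chr[OF fg]
    by (subst tpoly_eq_sum[OF fb]) (auto simp: sum_distrib_left algebra_simps)
  also have "\<dots> = (LINT y|torus. (\<Sum>n | b n \<noteq> 0. b n * chr n x * (tpoly g y * chr (- n) y)))"
    by (subst Bochner_Integration.integral_sum) (auto intro!: integrable_torus continuous_intros)
  also have "\<dots> = (LINT y|torus. tpoly g y * tpoly b (x - y))"
    by (intro Bochner_Integration.integral_cong refl)
       (simp add: tpoly_def[of b] sum_distrib_left algebra_simps diff_conv_add_uminus chr_shift chr_uminus
             del: add_uminus_conv_diff)
  finally have eq: "of_real ((2 * pi) ^ CARD('d)) * tpoly (\<lambda>n. g n * b n) x = (LINT y|torus. tpoly g y * tpoly b (x - y))" .
  have B0: "0 \<le> B" using Bb[of 0] norm_ge_zero order_trans by blast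
  have int: "integrable torus (\<lambda>x. of_real (norm (tpoly g x)) :: complex)"
    by (intro integrable_torus continuous_intros)
  then have int: "integrable torus (\<lambda>x. norm (tpoly g x))"
    unfolding complex_of_real_integrable_eq .
  have L1: "(LINT y|torus. norm (tpoly g y)) \<le> G"
    using G nn_integral_eq_integral[OF int] \<open>0 \<le> G\<close> by simp
  have "(2 * pi) ^ CARD('d) * norm (tpoly (\<lambda>n. g n * b n) x) = norm (LINT y|torus. tpoly g y * tpoly b (x - y))"
    unfolding eq[symmetric] by (simp add: norm_mult norm_power)
  also have "\<dots> \<le> (LINT y|torus. norm (tpoly g y * tpoly b (x - y)))"
    by (rule integral_norm_bound)
  also have "\<dots> \<le> (LINT y|torus. norm (tpoly g y) * B)"
  proof (rule integral_mono)
    have "continuous_on UNIV (\<lambda>y. tpoly b (x - y))"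
      unfolding tpoly_def by (intro continuous_intros)
    then show "integrable torus (\<lambda>y. norm (tpoly g y * tpoly b (x - y)))"
      by (intro integrable_norm integrable_torus continuous_intros)
  qed (use int Bb in \<open>auto simp: norm_mult intro!: mult_left_mono\<close>)
  also have "\<dots> = (LINT y|torus. norm (tpoly g y)) * B" by simp
  also have "\<dots> \<le> G * B" by (intro mult_right_mono L1 B0)
  finally have le: "(2 * pi) ^ CARD('d) * norm (tpoly (\<lambda>n. g n * b n) x) \<le> G * B" .
  have "1 * norm (tpoly (\<lambda>n. g n * b n) x) \<le> (2 * pi) ^ CARD('d) * norm (tpoly (\<lambda>n. g n * b n) x)"
    by (intro mult_right_mono one_le_power) (use pi_ge_two in auto)
  then show ?thesis using le by (simp add: mult.commute)
qed

section \<open>Smooth functions\<close>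

lemma has_derivative_imp_partial:
  assumes "(f has_derivative f') (at x)"
  shows "((\<lambda>t. f (x + t *\<^sub>R axis j 1)) has_vector_derivative f' (axis j 1)) (at 0)"
    and "partial j f x = f' (axis j 1)"
proof -
  have "((\<lambda>t. f (x + t *\<^sub>R axis j 1)) has_derivative (\<lambda>t. f' (t *\<^sub>R axis j 1))) (at 0)"
    by (rule has_derivative_compose[where f = "\<lambda>t. x + t *\<^sub>R axis j 1" and g = f, simplified])
       (use assms in \<open>auto intro!: derivative_eq_intros\<close>)
  moreover have "f' (t *\<^sub>R axis j 1) = t *\<^sub>R f' (axis j 1)" for t
    using assms by (intro linear_scale has_derivative_linear)
  ultimately show *: "((\<lambda>t. f (x + t *\<^sub>R axis j 1)) has_vector_derivative f' (axis j 1)) (at 0)"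
    by (simp add: has_vector_derivative_def)
  show "partial j f x = f' (axis j 1)"
    unfolding partial_def by (rule vector_derivative_at[OF *])
qed

lemma frechet_partial:
  assumes "f differentiable_on UNIV"
  shows "(f has_derivative frechet_derivative f (at x)) (at x)"
    and "partial j f x = frechet_derivative f (at x) (axis j 1)"
proof -
  show *: "(f has_derivative frechet_derivative f (at x)) (at x)"
    using assms by (auto simp: differentiable_on_def frechet_derivative_works)
  show "partial j f x = frechet_derivative f (at x) (axis j 1)"
    by (rule has_derivative_imp_partial(2)[OF *])
qed

text \<open>A finite order of differentiability is what induction can handle: sums and products of
  functions of order \<open>n + 1\<close> have partial derivatives that are sums and products of functions of
  order \<open>n\<close>.\<close>

definition smooth_upto :: "nat \<Rightarrow> (real ^ 'd \<Rightarrow> complex) \<Rightarrow> bool" where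
  "smooth_upto n f \<longleftrightarrow> (\<forall>js. length js \<le> n \<longrightarrow> foldr partial js f differentiable_on UNIV)"

lemma smooth_iff_upto: "smooth f \<longleftrightarrow> (\<forall>n. smooth_upto n f)"
  by (auto simp: smooth_def smooth_upto_def)

lemma smooth_upto_0 [simp]: "smooth_upto 0 f \<longleftrightarrow> f differentiable_on UNIV"
  by (simp add: smooth_upto_def)

lemma smooth_upto_Suc:
  "smooth_upto (Suc n) f \<longleftrightarrow> f differentiable_on UNIV \<and> (\<forall>j. smooth_upto n (partial j f))"
proof
  assume *: "smooth_upto (Suc n) f"
  have "foldr partial js (partial j f) differentiable_on UNIV" if "length js \<le> n" for js j
    using *[unfolded smooth_upto_def, rule_format, of "js @ [j]"] that by simp
  moreover have "f differentiable_on UNIV"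
    using *[unfolded smooth_upto_def, rule_format, of "[]"] by simp
  ultimately show "f differentiable_on UNIV \<and> (\<forall>j. smooth_upto n (partial j f))"
    by (auto simp: smooth_upto_def)
next
  assume *: "f differentiable_on UNIV \<and> (\<forall>j. smooth_upto n (partial j f))"
  show "smooth_upto (Suc n) f"
    unfolding smooth_upto_def
  proof safe
    fix js :: "'a list" assume "length js \<le> Suc n"
    then show "foldr partial js f differentiable_on UNIV"
      using * by (cases js rule: rev_cases) (auto simp: smooth_upto_def)
  qed
qed

lemma smooth_upto_D: "smooth_upto (Suc n) f \<Longrightarrow> smooth_upto n f"
  by (auto simp: smooth_upto_def)

lemma partial_add:
  assumes "f differentiable_on UNIV" "g differentiable_on UNIV"
  shows "partial j (\<lambda>x. f x + g x) = (\<lambda>x. partial j f x + partial j g x)"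
  using has_derivative_imp_partial(2)[OF has_derivative_add[OF frechet_partial(1)[OF assms(1)] frechet_partial(1)[OF assms(2)]]]
  by (auto simp: frechet_partial(2)[OF assms(1)] frechet_partial(2)[OF assms(2)])

lemma partial_mult:
  assumes "f differentiable_on UNIV" "g differentiable_on UNIV"
  shows "partial j (\<lambda>x. f x * g x) = (\<lambda>x. f x * partial j g x + partial j f x * g x)"
  using has_derivative_imp_partial(2)[OF has_derivative_mult[OF frechet_partial(1)[OF assms(1)] frechet_partial(1)[OF assms(2)]]]
  by (auto simp: frechet_partial(2)[OF assms(1)] frechet_partial(2)[OF assms(2)])

lemma partial_affine:
  assumes "f differentiable_on UNIV"
  shows "(\<lambda>x. f (h *\<^sub>R x + b)) differentiable_on UNIV"
    and "partial j (\<lambda>x. f (h *\<^sub>R x + b)) = (\<lambda>x. of_real h * partial j f (h *\<^sub>R x + b))"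
proof -
  have *: "((\<lambda>x. f (h *\<^sub>R x + b)) has_derivative (\<lambda>v. frechet_derivative f (at (h *\<^sub>R x + b)) (h *\<^sub>R v))) (at x)" for x
    by (rule has_derivative_compose[where f = "\<lambda>x. h *\<^sub>R x + b" and g = f])
       (auto intro!: derivative_eq_intros frechet_partial(1)[OF assms])
  then show "(\<lambda>x. f (h *\<^sub>R x + b)) differentiable_on UNIV"
    by (auto simp: differentiable_on_def intro: differentiableI)
  have "frechet_derivative f (at y) (h *\<^sub>R v) = of_real h * frechet_derivative f (at y) v" for y v
    using linear_scale[OF has_derivative_linear[OF frechet_partial(1)[OF assms]]]
    by (simp add: scaleR_conv_of_real)
  then show "partial j (\<lambda>x. f (h *\<^sub>R x + b)) = (\<lambda>x. of_real h * partial j f (h *\<^sub>R x + b))"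
    using has_derivative_imp_partial(2)[OF *] by (auto simp: frechet_partial(2)[OF assms])
qed

lemma partial_const [simp]: "partial j (\<lambda>x. c) = (\<lambda>x. 0)"
  by (simp add: partial_def)

lemma smooth_upto_const: "smooth_upto n (\<lambda>x. c)"
  by (induction n arbitrary: c) (auto simp: smooth_upto_Suc)

lemma smooth_upto_add:
  "smooth_upto n f \<Longrightarrow> smooth_upto n g \<Longrightarrow> smooth_upto n (\<lambda>x. f x + g x)"
  by (induction n arbitrary: f g)
     (auto simp: smooth_upto_Suc partial_add intro: differentiable_on_add)

lemma smooth_upto_mult:
  "smooth_upto n f \<Longrightarrow> smooth_upto n g \<Longrightarrow> smooth_upto n (\<lambda>x. f x * g x)"
proof (induction n arbitrary: f g)
  case (Suc n)
  note D = smooth_upto_D[OF Suc.prems(1)] smooth_upto_D[OF Suc.prems(2)]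
  show ?case
    using Suc.prems D unfolding smooth_upto_Suc
    by (auto simp: partial_mult intro!: smooth_upto_add Suc.IH differentiable_on_mult)
qed (auto intro: differentiable_on_mult)

lemma smooth_upto_affine:
  "smooth_upto n f \<Longrightarrow> smooth_upto n (\<lambda>x. f (h *\<^sub>R x + b))"
  by (induction n arbitrary: f)
     (auto simp: smooth_upto_Suc partial_affine intro!: smooth_upto_mult smooth_upto_const)

lemma smooth_const [simp]: "smooth (\<lambda>x. c)"
  unfolding smooth_iff_upto using smooth_upto_const by fast

lemma smooth_add:
  assumes "smooth f" "smooth g"
  shows "smooth (\<lambda>x. f x + g x)"
  unfolding smooth_iff_upto
proof
  fix n show "smooth_upto n (\<lambda>x. f x + g x)"
    by (rule smooth_upto_add) (use assms in \<open>simp_all add: smooth_iff_upto\<close>)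
qed

lemma smooth_mult:
  assumes "smooth f" "smooth g"
  shows "smooth (\<lambda>x. f x * g x)"
  unfolding smooth_iff_upto
proof
  fix n show "smooth_upto n (\<lambda>x. f x * g x)"
    by (rule smooth_upto_mult) (use assms in \<open>simp_all add: smooth_iff_upto\<close>)
qed

lemma smooth_affine:
  assumes "smooth f"
  shows "smooth (\<lambda>x. f (h *\<^sub>R x + b))"
  unfolding smooth_iff_upto
proof
  fix n show "smooth_upto n (\<lambda>x. f (h *\<^sub>R x + b))"
    using assms by (simp add: smooth_iff_upto smooth_upto_affine)
qed

lemma smooth_differentiable: "smooth f \<Longrightarrow> foldr partial js f differentiable_on UNIV"
  by (simp add: smooth_def)

lemma smooth_imp_continuous: "smooth f \<Longrightarrow> continuous_on S f"
  using smooth_differentiable[of f "[]"]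
  by (auto intro: continuous_on_subset[OF differentiable_imp_continuous_on])

lemma foldr_partial_add:
  "smooth f \<Longrightarrow> smooth g \<Longrightarrow> foldr partial js (\<lambda>x. f x + g x) = (\<lambda>x. foldr partial js f x + foldr partial js g x)"
proof (induction js)
  case (Cons j js)
  then show ?case using partial_add[OF smooth_differentiable smooth_differentiable] by simp
qed simp

lemma foldr_partial_cmult:
  "smooth f \<Longrightarrow> foldr partial js (\<lambda>x. c * f x) = (\<lambda>x. c * foldr partial js f x)"
proof (induction js)
  case (Cons j js)
  then show ?case using partial_mult[of "\<lambda>_. c", OF _ smooth_differentiable] by simp
qed simp

lemma foldr_partial_shift:
  "smooth f \<Longrightarrow> foldr partial js (\<lambda>x. f (x + b)) = (\<lambda>x. foldr partial js f (x + b))"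
proof (induction js)
  case (Cons j js)
  then show ?case using partial_affine(2)[of _ j 1 b, OF smooth_differentiable] by simp
qed simp

lemma partial_chr: "partial j (chr n) = (\<lambda>x. (\<i> * of_int (n $ j)) * chr n x)"
  and differentiable_chr: "chr n differentiable_on UNIV"
proof -
  have *: "(chr n has_derivative (\<lambda>v. \<i> * of_real (lat n \<bullet> v) * chr n x)) (at x)" for x
  proof -
    have "((\<lambda>y. exp (\<i> * of_real (lat n \<bullet> y))) has_derivative (\<lambda>v. exp (\<i> * of_real (lat n \<bullet> x)) * (\<i> * of_real (lat n \<bullet> v)))) (at x)"
      by (rule has_derivative_compose[where g = exp])
         (auto intro!: derivative_eq_intros has_derivative_mult_right DERIV_exp[THEN has_field_derivative_imp_has_derivative])
    then show ?thesis unfolding chr_def by (simp add: mult.commute)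
  qed
  show "chr n differentiable_on UNIV"
    using * by (auto simp: differentiable_on_def intro: differentiableI)
  show "partial j (chr n) = (\<lambda>x. (\<i> * of_int (n $ j)) * chr n x)"
    using has_derivative_imp_partial(2)[OF *] by (auto simp: inner_axis)
qed

lemma smooth_chr [simp]: "smooth (chr n)"
proof -
  have "smooth_upto k (chr n)" for k
    by (induction k) (auto simp: smooth_upto_Suc differentiable_chr partial_chr intro!: smooth_upto_mult smooth_upto_const)
  then show ?thesis by (simp add: smooth_iff_upto)
qed

lemma chr_periodic: "chr n (x + (2 * pi) *\<^sub>R lat k) = chr n x"
proof -
  have "lat n \<bullet> ((2 * pi) *\<^sub>R lat k) = 2 * pi * real_of_int (\<Sum>j\<in>UNIV. n $ j * k $ j)"
    by (simp add: inner_vec_def sum_distrib_left mult_ac)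
  then have "chr n ((2 * pi) *\<^sub>R lat k) = 1"
    unfolding chr_def exp_eq_1
    by (auto simp: mult_ac intro!: exI[of _ "\<Sum>j\<in>UNIV. n $ j * k $ j"])
  then show ?thesis by (simp add: chr_shift)
qed

lemma chr_in_torus_smooth [simp]: "chr n \<in> torus_smooth"
  by (simp add: torus_smooth_def chr_periodic)

text \<open>All derivatives vanish off the same ball, on which they are continuous, and there are only
  finitely many of them of each order.\<close>

lemma smooth_compact_bounded:
  fixes f :: "real ^ 'd::finite \<Rightarrow> complex"
  assumes f: "smooth f" and van: "\<And>x. norm x > r \<Longrightarrow> f x = 0"
  shows "\<exists>C>0. \<forall>js. length js = M \<longrightarrow> (\<forall>x. norm (foldr partial js f x) \<le> C)"
proof -
  have van': "foldr partial js f x = 0" if "norm x > r" for js x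
    using that
  proof (induction js arbitrary: x)
    case (Cons j js)
    have "open {y :: real ^ 'd. r < norm y}"
      by (intro open_Collect_less continuous_intros)
    moreover have "((\<lambda>y. 0) has_derivative (\<lambda>v. 0)) (at x)" by simp
    ultimately have "(foldr partial js f has_derivative (\<lambda>v. 0)) (at x)"
      by (elim has_derivative_transform_within_open[rotated]) (use Cons in auto)
    from has_derivative_imp_partial(2)[OF this] show ?case by simp
  qed (use van in simp)
  have "\<exists>C. \<forall>x. norm (foldr partial js f x) \<le> C" for js
  proof -
    have "continuous_on (cball 0 r) (foldr partial js f)"
      using smooth_differentiable[OF f, of js] differentiable_imp_continuous_on continuous_on_subset by blast
    then have "bounded (foldr partial js f ` cball 0 r)"
      by (intro compact_imp_bounded compact_continuous_image) auto
    then obtain C where "\<forall>x\<in>cball 0 r. norm (foldr partial js f x) \<le> C"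
      by (auto simp: bounded_iff)
    then have "norm (foldr partial js f x) \<le> max C 0" for x
      using van'[of x js] by (cases "norm x \<le> r") (auto simp: le_max_iff_disj)
    then show ?thesis by blast
  qed
  then obtain C where C: "\<And>js x. norm (foldr partial js f x) \<le> C js" by metis
  let ?L = "{js :: 'd list. length js = M}"
  have fin: "finite ?L" using finite_lists_length_eq[of "UNIV :: 'd set" M] by simp
  have C0: "0 \<le> C js" for js using C[of js 0] norm_ge_zero order_trans by blast
  have "norm (foldr partial js f x) \<le> (\<Sum>js\<in>?L. C js) + 1" if "length js = M" for js x
  proof -
    have "C js \<le> (\<Sum>js\<in>?L. C js)"
      by (rule member_le_sum) (use that C0 fin in auto)
    then show ?thesis using C[of js x] by linarith
  qed
  moreover have "(\<Sum>js\<in>?L. C js) + 1 > 0"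
    using C0 by (intro add_nonneg_pos sum_nonneg) auto
  ultimately show ?thesis by blast
qed

section \<open>Finite differences\<close>

lemma smooth_increment_bound:
  assumes F: "F differentiable_on UNIV" and B: "\<And>x. norm (partial j F x) \<le> C" and "0 \<le> h"
  shows "norm (F (x + h *\<^sub>R axis j 1) - F x) \<le> h * C"
proof -
  let ?g = "\<lambda>t. F (x + t *\<^sub>R axis j 1)"
  have der: "(?g has_derivative (\<lambda>s. s *\<^sub>R partial j F (x + t *\<^sub>R axis j 1))) (at t within {0..h})" for t
  proof -
    have "(?g has_derivative (\<lambda>s. frechet_derivative F (at (x + t *\<^sub>R axis j 1)) (s *\<^sub>R axis j 1))) (at t)"
      by (rule has_derivative_compose[where f = "\<lambda>t. x + t *\<^sub>R axis j 1" and g = F])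
         (auto intro!: derivative_eq_intros frechet_partial(1)[OF F])
    moreover have "frechet_derivative F (at y) (s *\<^sub>R axis j 1) = s *\<^sub>R partial j F y" for s y
      using linear_scale[OF has_derivative_linear[OF frechet_partial(1)[OF F]]]
      by (simp add: frechet_partial(2)[OF F])
    ultimately show ?thesis by (simp add: has_derivative_at_withinI)
  qed
  have "norm (?g h - ?g 0) \<le> C * norm (h - 0)"
  proof (rule differentiable_bound[OF _ der])
    show "onorm (\<lambda>s. s *\<^sub>R partial j F (x + t *\<^sub>R axis j 1)) \<le> C" for t
      using B[of "x + t *\<^sub>R axis j 1"]
      by (intro onorm_le) (simp add: mult.commute[of C] mult_left_mono)
  qed (use \<open>0 \<le> h\<close> in auto)
  then show ?thesis using \<open>0 \<le> h\<close> by (simp add: mult.commute)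
qed

text \<open>Every difference of samples taken at spacing \<open>h\<close> costs one application of the mean value
  inequality and hence gains one factor \<open>h\<close>. The operator that acts first is the last one in the
  list, which is why the induction removes directions from the end.\<close>

lemma diff_sample_bound:
  fixes f :: "real ^ 'd::finite \<Rightarrow> complex"
  assumes "0 \<le> h" "smooth f"
    and "\<And>js x. length js = M \<Longrightarrow> norm (foldr partial js f x) \<le> C"
    and "length js = M"
  shows "norm (foldr diff_op js (\<lambda>n. f (h *\<^sub>R lat n + b)) n) \<le> h ^ M * C"
  using assms
proof (induction M arbitrary: f C js)
  case 0
  then show ?case using "0.prems"(3)[of "[]"] by simp
next
  case (Suc M)
  obtain js' j where js: "js = js' @ [j]" and len: "length js' = M"
    using Suc.prems(4) by (cases js rule: rev_cases) auto
  define f1 where "f1 = (\<lambda>x. f (x + h *\<^sub>R axis j 1) + (-1) * f x)"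
  have sm: "smooth (\<lambda>x. f (x + h *\<^sub>R axis j 1))" "smooth (\<lambda>x. (-1) * f x)"
    using smooth_affine[OF Suc.prems(2), of 1] smooth_mult[OF smooth_const[of "-1"] Suc.prems(2)] by auto
  have "diff_op j (\<lambda>n. f (h *\<^sub>R lat n + b)) = (\<lambda>n. f1 (h *\<^sub>R lat n + b))"
    by (auto simp: diff_op_def f1_def algebra_simps)
  then have "foldr diff_op js (\<lambda>n. f (h *\<^sub>R lat n + b)) n = foldr diff_op js' (\<lambda>n. f1 (h *\<^sub>R lat n + b)) n"
    by (simp add: js)
  also have "norm \<dots> \<le> h ^ M * (h * C)"
  proof (rule Suc.IH[OF \<open>0 \<le> h\<close> _ _ len])
    show "smooth f1" unfolding f1_def by (intro smooth_add sm)
    fix js :: "'d list" and x assume len: "length js = M"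
    have "foldr partial js f1 x = foldr partial js f (x + h *\<^sub>R axis j 1) - foldr partial js f x"
      unfolding f1_def foldr_partial_add[OF sm] foldr_partial_shift[OF Suc.prems(2)]
        foldr_partial_cmult[OF Suc.prems(2)] by simp
    also have "norm \<dots> \<le> h * C"
      using Suc.prems(3)[of "j # js"] len
      by (intro smooth_increment_bound smooth_differentiable Suc.prems) auto
    finally show "norm (foldr partial js f1 x) \<le> h * C" .
  qed
  finally show ?case by (simp add: mult_ac)
qed

text \<open>This allows a symbol to be replaced, near a given lattice point, by the only piece of it that
  is visible from there.\<close>

lemma foldr_diff_op_local:
  assumes "\<And>n'. norm (lat (n' - n)) \<le> real (length js) \<Longrightarrow> g n' = g' n'"
  shows "foldr diff_op js g n = foldr diff_op js g' n"
  using assms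
proof (induction js arbitrary: n)
  case (Cons j js)
  have "foldr diff_op js g (n + axis j 1) = foldr diff_op js g' (n + axis j 1)"
  proof (rule Cons.IH)
    fix n' assume *: "norm (lat (n' - (n + axis j 1))) \<le> real (length js)"
    have "lat (n' - n) = lat (n' - (n + axis j 1)) + axis j 1" by (simp)
    then have "norm (lat (n' - n)) \<le> norm (lat (n' - (n + axis j 1))) + 1"
      by (metis norm_triangle_ineq norm_axis_1)
    then show "g n' = g' n'" using * by (intro Cons.prems) simp
  qed
  moreover have "foldr diff_op js g n = foldr diff_op js g' n"
    by (rule Cons.IH, rule Cons.prems) simp
  ultimately show ?case by (simp only: foldr.simps comp_apply diff_op_def[of j])
qed simp

lemma foldr_diff_op_zero: "foldr diff_op js (\<lambda>n. 0) n = 0"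
  by (induction js arbitrary: n) (auto simp: diff_op_def)

lemma foldr_diff_op_cmult: "foldr diff_op js (\<lambda>n. c * g n) n = c * foldr diff_op js g n"
  by (induction js arbitrary: n) (auto simp: diff_op_def algebra_simps)

section \<open>Lattice points\<close>

lemma bij_vec_box:
  "bij_betw (\<lambda>g. \<chi> k. g k) (PiE (UNIV :: 'd::finite set) (\<lambda>_. A)) {n :: 'a ^ 'd. \<forall>k. n $ k \<in> A}"
  by (rule bij_betw_byWitness[where f' = "\<lambda>n k. n $ k"]) (auto simp: vec_eq_iff)

lemma prod_sum_vec_box:
  fixes f :: "'d::finite \<Rightarrow> 'a \<Rightarrow> 'b::comm_semiring_1"
  assumes "finite A"
  shows "(\<Prod>k\<in>UNIV. \<Sum>a\<in>A. f k a) = (\<Sum>n\<in>{n :: 'a ^ 'd. \<forall>k. n $ k \<in> A}. \<Prod>k\<in>UNIV. f k (n $ k))"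
  by (subst prod_sum_PiE) (use assms in \<open>auto intro!: sum.reindex_bij_betw[OF bij_vec_box, THEN trans, symmetric] sum.cong simp: sum.reindex_bij_betw[OF bij_vec_box, symmetric]\<close>)

lemma card_vec_box: "card {n :: 'a ^ 'd::finite. \<forall>k. n $ k \<in> A} = card A ^ CARD('d)"
  using bij_betw_same_card[OF bij_vec_box[where 'd = 'd and A = A]] by (simp add: card_PiE)

lemma finite_vec_box: "finite A \<Longrightarrow> finite {n :: 'a ^ 'd::finite. \<forall>k. n $ k \<in> A}"
  using bij_betw_finite[OF bij_vec_box[where 'd = 'd and A = A]] by (simp add: finite_PiE)

lemma lattice_ball:
  assumes "0 \<le> r"
  shows "finite {n :: int ^ 'd::finite. norm (lat n) \<le> r}"
    and "real (card {n :: int ^ 'd. norm (lat n) \<le> r}) \<le> (2 * r + 1) ^ CARD('d)"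
proof -
  let ?A = "{-\<lfloor>r\<rfloor>..\<lfloor>r\<rfloor>}"
  have sub: "{n :: int ^ 'd. norm (lat n) \<le> r} \<subseteq> {n. \<forall>k. n $ k \<in> ?A}"
  proof safe
    fix n :: "int ^ 'd" and k assume "norm (lat n) \<le> r"
    then have "\<bar>real_of_int (n $ k)\<bar> \<le> r"
      using component_le_norm_cart[of "lat n" k] by simp
    then have "- (n $ k) \<le> \<lfloor>r\<rfloor>" "n $ k \<le> \<lfloor>r\<rfloor>" by (auto simp: le_floor_iff abs_le_iff)
    then show "n $ k \<in> ?A" by simp
  qed
  show "finite {n :: int ^ 'd. norm (lat n) \<le> r}"
    by (rule finite_subset[OF sub finite_vec_box]) simp
  have "real (card {n :: int ^ 'd. norm (lat n) \<le> r}) \<le> real (card ?A ^ CARD('d))"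
    using card_mono[OF finite_vec_box[OF finite_atLeastAtMost_int] sub] unfolding card_vec_box by (rule of_nat_mono)
  also have "\<dots> = real (card ?A) ^ CARD('d)" by simp
  also have "\<dots> \<le> (2 * r + 1) ^ CARD('d)"
  proof (intro power_mono)
    have "0 \<le> \<lfloor>r\<rfloor>" using assms by simp
    then have "real (card ?A) = 2 * of_int \<lfloor>r\<rfloor> + 1" by (simp add: of_nat_nat)
    then show "real (card ?A) \<le> 2 * r + 1" by simp
  qed simp
  finally show "real (card {n :: int ^ 'd. norm (lat n) \<le> r}) \<le> (2 * r + 1) ^ CARD('d)" .
qed

section \<open>Kernels of smooth multipliers\<close>

lemma diff_op_support:
  assumes "\<And>n. g n \<noteq> 0 \<Longrightarrow> norm (lat n) \<le> r" and "diff_op j g n \<noteq> 0"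
  shows "norm (lat n) \<le> r + 1"
proof -
  have "g (n + axis j 1) \<noteq> 0 \<or> g n \<noteq> 0" using assms(2) by (auto simp: diff_op_def)
  moreover have "norm (lat n) \<le> norm (lat (n + axis j 1)) + 1"
    using norm_triangle_ineq4[of "lat n + axis j 1" "axis j 1"] by simp
  ultimately show ?thesis using assms(1)[of n] assms(1)[of "n + axis j 1"] by auto
qed

lemma tpoly_norm_le:
  fixes g :: "int ^ 'd::finite \<Rightarrow> complex"
  assumes "\<And>n. g n \<noteq> 0 \<Longrightarrow> norm (lat n) \<le> r" and "\<And>n. norm (g n) \<le> B" and "0 \<le> r"
  shows "norm (tpoly g x) \<le> (2 * r + 1) ^ CARD('d) * B"
proof -
  let ?S = "{n :: int ^ 'd. norm (lat n) \<le> r}"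
  have "0 \<le> B" using assms(2)[of 0] norm_ge_zero order_trans by blast
  have "tpoly g x = (\<Sum>n\<in>?S. g n * chr n x)"
    by (rule tpoly_eq_sum) (use assms lattice_ball(1) in auto)
  also have "norm \<dots> \<le> (\<Sum>n\<in>?S. norm (g n))"
    by (rule order_trans[OF norm_sum]) (simp add: norm_mult)
  also have "\<dots> \<le> real (card ?S) * B"
    by (rule order_trans[OF sum_bounded_above[where K = B]]) (use assms in auto)
  also have "\<dots> \<le> (2 * r + 1) ^ CARD('d) * B"
    by (intro mult_right_mono lattice_ball \<open>0 \<le> r\<close> \<open>0 \<le> B\<close>)
  finally show ?thesis .
qed

text \<open>Summation by parts: a difference of the coefficients is a multiplication in \<open>x\<close>.\<close>

lemma tpoly_diff_op:
  fixes g :: "int ^ 'd::finite \<Rightarrow> complex"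
  assumes fin: "finite {n. g n \<noteq> 0}"
  shows "tpoly (diff_op k g) x = (chr (- axis k 1) x - 1) * tpoly g x"
proof -
  let ?e = "axis k 1 :: int ^ 'd"
  let ?S = "{n. g n \<noteq> 0} \<union> (\<lambda>n. n - ?e) ` {n. g n \<noteq> 0}"
  have finS: "finite ?S" using fin by simp
  have "tpoly (diff_op k g) x = (\<Sum>n\<in>?S. diff_op k g n * chr n x)"
  proof (rule tpoly_eq_sum[OF finS])
    fix n assume "diff_op k g n \<noteq> 0"
    then have "g (n + ?e) \<noteq> 0 \<or> g n \<noteq> 0" by (auto simp: diff_op_def)
    moreover have "n = (n + ?e) - ?e" by simp
    ultimately show "n \<in> ?S" by blast
  qed
  also have "\<dots> = (\<Sum>n\<in>?S. g (n + ?e) * chr n x) - (\<Sum>n\<in>?S. g n * chr n x)"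
    by (simp add: diff_op_def algebra_simps sum_subtractf)
  also have "(\<Sum>n\<in>?S. g n * chr n x) = tpoly g x"
    by (rule tpoly_eq_sum[OF finS, symmetric]) auto
  also have "(\<Sum>n\<in>?S. g (n + ?e) * chr n x) = (\<Sum>n\<in>(\<lambda>n. n + ?e) ` ?S. g n * chr (n - ?e) x)"
    by (subst sum.reindex) (auto simp: inj_on_def)
  also have "\<dots> = chr (- ?e) x * (\<Sum>n\<in>(\<lambda>n. n + ?e) ` ?S. g n * chr n x)"
    unfolding sum_distrib_left
    using chr_add[of _ "- ?e" x] by (intro sum.cong refl) simp
  also have "(\<Sum>n\<in>(\<lambda>n. n + ?e) ` ?S. g n * chr n x) = tpoly g x"
  proof (rule tpoly_eq_sum[symmetric])
    fix n assume "g n \<noteq> 0"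
    then have "n - ?e \<in> ?S" by auto
    then show "n \<in> (\<lambda>n. n + ?e) ` ?S"
      by (rule rev_image_eqI) simp
  qed (use finS in auto)
  finally show ?thesis by (simp add: algebra_simps)
qed

text \<open>After \<open>M\<close> summations by parts in one coordinate the remaining polynomial is bounded
  trivially, by the number of its frequencies times the size of its coefficients.\<close>

lemma kernel_axis_bound:
  fixes g :: "int ^ 'd::finite \<Rightarrow> complex"
  assumes supp: "\<And>n. g n \<noteq> 0 \<Longrightarrow> norm (lat n) \<le> r" and "0 \<le> r"
    and D: "\<And>n. norm (foldr diff_op (replicate M k) g n) \<le> D"
  shows "norm (1 - chr (axis k 1) x) ^ M * norm (tpoly g x) \<le> (2 * (r + M) + 1) ^ CARD('d) * D"
proof -
  have *: "(\<forall>n. foldr diff_op (replicate i k) g n \<noteq> 0 \<longrightarrow> norm (lat n) \<le> r + real i) \<and>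
    tpoly (foldr diff_op (replicate i k) g) x = (chr (- axis k 1) x - 1) ^ i * tpoly g x" for i
  proof (induction i)
    case (Suc i)
    then have s: "\<And>n. foldr diff_op (replicate i k) g n \<noteq> 0 \<Longrightarrow> norm (lat n) \<le> r + real i"
      and t: "tpoly (foldr diff_op (replicate i k) g) x = (chr (- axis k 1) x - 1) ^ i * tpoly g x"
      by blast+
    have fin: "finite {n. foldr diff_op (replicate i k) g n \<noteq> 0}"
      by (rule finite_subset[OF _ lattice_ball(1)[of "r + real i"]]) (use s \<open>0 \<le> r\<close> in auto)
    have "norm (lat n) \<le> r + real (Suc i)" if "diff_op k (foldr diff_op (replicate i k) g) n \<noteq> 0" for n
      using diff_op_support[OF s that] by simp
    then show ?case using tpoly_diff_op[OF fin] t by (simp add: mult_ac)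
  qed (use supp in auto)
  have "norm (chr (- axis k 1) x - 1) = norm (1 - chr (axis k 1) x)"
  proof -
    have "chr (- axis k 1) x - 1 = - cnj (1 - chr (axis k 1) x)" by (simp add: chr_uminus)
    then show ?thesis by (simp only: norm_minus_cancel complex_mod_cnj)
  qed
  then have "norm (1 - chr (axis k 1) x) ^ M * norm (tpoly g x) = norm (tpoly (foldr diff_op (replicate M k) g) x)"
    using * by (simp add: norm_mult norm_power)
  also have "\<dots> \<le> (2 * (r + M) + 1) ^ CARD('d) * D"
    by (rule tpoly_norm_le) (use * D \<open>0 \<le> r\<close> in auto)
  finally show ?thesis .
qed

text \<open>The factor \<open>norm (1 - chr (axis k 1) x)\<close> is comparable with the distance of \<open>x $ k\<close> to the
  multiples of \<open>2 * pi\<close>. The product over the coordinates, rather than a norm of \<open>x\<close>, makes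
  integrals over the torus factor.\<close>

definition decay :: "real \<Rightarrow> real ^ 'd \<Rightarrow> real" where
  "decay R x = (\<Prod>k\<in>UNIV. max 1 (R * norm (1 - chr (axis k 1) x)))"

lemma decay_ge_1: "1 \<le> decay R x"
  unfolding decay_def by (intro prod_ge_1) auto

lemma continuous_on_decay [continuous_intros]: "continuous_on S (decay R)"
  unfolding decay_def by (intro continuous_intros)

text \<open>A multiplier that is smooth on the scale \<open>R\<close> has a kernel concentrated within \<open>1 / R\<close> of
  the origin. Since \<open>M * CARD('d)\<close> summations by parts are carried out in each coordinate, the
  product of the resulting \<open>CARD('d)\<close> inequalities is the power \<open>CARD('d)\<close> of the claim.\<close>

lemma kernel_pointwise:
  fixes \<theta> :: "real ^ 'd::finite \<Rightarrow> complex"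
  assumes \<theta>: "smooth \<theta>" and van: "\<And>x. norm x > r \<Longrightarrow> \<theta> x = 0" and "0 \<le> r"
  shows "\<exists>E>0. \<forall>R\<ge>1. \<forall>x. decay R x ^ M * norm (tpoly (\<lambda>n. \<theta> ((1 / R) *\<^sub>R lat n)) x) \<le> E * R ^ CARD('d)"
proof -
  let ?d = "CARD('d)"
  let ?N = "?d * M"
  obtain C0 where C0: "C0 > 0" "\<And>js x. length js = 0 \<Longrightarrow> norm (foldr partial js \<theta> x) \<le> C0"
    using smooth_compact_bounded[OF \<theta> van, where M = "0"] by metis
  obtain C1 where C1: "C1 > 0" "\<And>js x. length js = ?N \<Longrightarrow> norm (foldr partial js \<theta> x) \<le> C1"
    using smooth_compact_bounded[OF \<theta> van, where M = "?N"] by metis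
  define E where "E = (2 * (r + ?N) + 1) ^ ?d * (C0 + C1)"
  have "E > 0" unfolding E_def using C0(1) C1(1) \<open>0 \<le> r\<close>
    by (intro mult_pos_pos zero_less_power add_nonneg_pos) auto
  moreover have "decay R x ^ M * norm (tpoly (\<lambda>n. \<theta> ((1 / R) *\<^sub>R lat n)) x) \<le> E * R ^ ?d" if "R \<ge> 1" for R x
  proof -
    let ?g = "\<lambda>n. \<theta> ((1 / R) *\<^sub>R lat n)"
    let ?K = "norm (tpoly ?g x)"
    have supp: "norm (lat n) \<le> r * R" if "?g n \<noteq> 0" for n
    proof (rule ccontr)
      assume "\<not> norm (lat n) \<le> r * R"
      then have "r < norm ((1 / R) *\<^sub>R lat n)" using \<open>R \<ge> 1\<close> by (simp add: pos_less_divide_eq)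
      then show False using van that by blast
    qed
    have rR: "0 \<le> r * R" using \<open>0 \<le> r\<close> \<open>R \<ge> 1\<close> by simp
    have count: "(2 * (r * R + real i) + 1) ^ ?d * C \<le> E * R ^ ?d" if "i \<le> ?N" "0 \<le> C" "C \<le> C0 + C1" for i C
    proof -
      have "real i \<le> real ?N * R"
        using mult_left_mono[of 1 R "real ?N"] that(1) \<open>R \<ge> 1\<close> by (metis mult.right_neutral of_nat_0_le_iff of_nat_mono order_trans)
      then have "2 * (r * R + real i) + 1 \<le> (2 * (r + ?N) + 1) * R"
        using \<open>R \<ge> 1\<close> by (simp add: algebra_simps)
      then have "(2 * (r * R + real i) + 1) ^ ?d * C \<le> ((2 * (r + ?N) + 1) * R) ^ ?d * (C0 + C1)"
        using that rR by (intro mult_mono power_mono) auto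
      then show ?thesis by (simp add: E_def power_mult_distrib mult_ac)
    qed
    have triv: "?K \<le> E * R ^ ?d"
    proof -
      have "?K \<le> (2 * (r * R) + 1) ^ ?d * C0"
        by (rule tpoly_norm_le) (use supp rR C0(2)[of "[]"] in auto)
      also have "\<dots> \<le> E * R ^ ?d" using count[of 0 C0] C0(1) C1(1) by simp
      finally show ?thesis .
    qed
    have axis: "max 1 (R * norm (1 - chr (axis k 1) x)) ^ ?N * ?K \<le> E * R ^ ?d" for k
    proof (cases "R * norm (1 - chr (axis k 1) x) \<le> 1")
      case True
      then have "max 1 (R * norm (1 - chr (axis k 1) x)) = 1" by linarith
      then show ?thesis using triv by simp
    next
      case False
      have "norm (foldr diff_op (replicate ?N k) ?g n) \<le> (1 / R) ^ ?N * C1" for n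
        using diff_sample_bound[of "1 / R" \<theta> ?N C1 "replicate ?N k" 0 n] \<open>R \<ge> 1\<close> \<theta> C1 by simp
      from kernel_axis_bound[OF supp rR this]
      have "norm (1 - chr (axis k 1) x) ^ ?N * ?K \<le> (2 * (r * R + ?N) + 1) ^ ?d * ((1 / R) ^ ?N * C1)" .
      then have "R ^ ?N * (norm (1 - chr (axis k 1) x) ^ ?N * ?K) \<le> R ^ ?N * ((2 * (r * R + ?N) + 1) ^ ?d * ((1 / R) ^ ?N * C1))"
        using \<open>R \<ge> 1\<close> by (intro mult_left_mono) auto
      also have "\<dots> = (2 * (r * R + ?N) + 1) ^ ?d * C1"
        using \<open>R \<ge> 1\<close> by (simp add: power_one_over)
      also have "\<dots> \<le> E * R ^ ?d" using count[of ?N C1] C0(1) C1(1) by simp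
      finally show ?thesis using False by (simp add: max_def power_mult_distrib mult_ac)
    qed
    have "(decay R x ^ M * ?K) ^ ?d = (\<Prod>k\<in>UNIV. max 1 (R * norm (1 - chr (axis k 1) x)) ^ ?N * ?K)"
      by (simp add: prod.distrib decay_def power_mult_distrib mult.commute[of ?d] flip: power_mult prod_power_distrib)
    also have "\<dots> \<le> (\<Prod>k\<in>(UNIV :: 'd set). E * R ^ ?d)"
      by (intro prod_mono) (auto simp: axis)
    also have "\<dots> = (E * R ^ ?d) ^ ?d" by simp
    finally show ?thesis
      using \<open>E > 0\<close> \<open>R \<ge> 1\<close> decay_ge_1[of R x] by (subst (asm) power_mono_iff) auto
  qed
  ultimately show ?thesis by blast
qed

text \<open>The cubic Taylor bound gives this as long as \<open>y\<^sup>2 \<le> 3\<close>; the number \<open>8 / 5\<close> satisfies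
  this and exceeds \<open>pi / 2\<close>.\<close>

lemma sin_half_bound:
  assumes "0 \<le> y" "y \<le> 8 / 5"
  shows "y / 2 \<le> sin (y :: real)"
proof -
  have "\<bar>sin y - (\<Sum>m<3. sin_coeff m * y ^ m)\<bar> \<le> inverse (fact 3) * \<bar>y\<bar> ^ 3"
    by (rule Maclaurin_sin_bound)
  then have "y - y ^ 3 / 6 \<le> sin y"
    using assms by (simp add: eval_nat_numeral sin_coeff_def abs_if split: if_splits)
  moreover have "y * (y * y) \<le> y * 3"
    using mult_mono[of y "8/5" y "8/5"] assms by (intro mult_left_mono) auto
  ultimately show ?thesis by (simp add: power3_eq_cube)
qed

lemma norm_one_minus_exp: "norm (1 - exp (\<i> * of_real t)) = 2 * \<bar>sin (t / 2)\<bar>"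
proof -
  have "norm (1 - exp (\<i> * of_real t)) = norm (exp (\<i> * of_real t) - exp (\<i> * of_real 0))"
    by (simp add: norm_minus_commute)
  also have "\<dots> = 2 * \<bar>sin ((t - 0) / 2)\<bar>" using dist_exp_i_1[of t] by (simp add: dist_norm)
  finally show ?thesis by simp
qed

text \<open>On each half of the period the integrand is dominated by a Cauchy density, centred at the
  nearest end point, whose primitive is an arctangent.\<close>

lemma decay_integral_1:
  assumes "R > 0"
  shows "(\<integral>\<^sup>+t. ennreal (1 / (max 1 (R * norm (1 - exp (\<i> * of_real t))))\<^sup>2) * indicator {0..2*pi} t \<partial>lborel)
            \<le> ennreal (4 * pi / R)"
proof -
  let ?m = "\<lambda>t. max 1 (R * norm (1 - exp (\<i> * of_real t)))"
  have low: "1 / (?m t)\<^sup>2 \<le> 2 / (1 + (R * s / 2)\<^sup>2)" if "s / 2 \<le> norm (1 - exp (\<i> * of_real t))" "0 \<le> s" for s t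
  proof -
    have "R * (s / 2) \<le> R * norm (1 - exp (\<i> * of_real t))"
      using that(1) \<open>R > 0\<close> by (intro mult_left_mono) auto
    then have "R * s / 2 \<le> ?m t" by simp
    then have "(R * s / 2)\<^sup>2 \<le> (?m t)\<^sup>2" using that \<open>R > 0\<close> by (intro power_mono) auto
    moreover have "1 \<le> (?m t)\<^sup>2" by (simp add: one_le_power)
    moreover have "(1 + a) / 2 \<le> b" if "a \<le> b" "1 \<le> b" for a b :: real
      using that by simp
    ultimately have "(1 + (R * s / 2)\<^sup>2) / 2 \<le> (?m t)\<^sup>2" by blast
    then have "1 / (?m t)\<^sup>2 \<le> 1 / ((1 + (R * s / 2)\<^sup>2) / 2)"
      by (intro divide_left_mono mult_pos_pos) (auto simp: add_pos_nonneg intro: less_le_trans[OF zero_less_one])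
    then show ?thesis by simp
  qed
  let ?f = "\<lambda>t. 2 / (1 + (R * t / 2)\<^sup>2)" and ?g = "\<lambda>t. 2 / (1 + (R * (2 * pi - t) / 2)\<^sup>2)"
  have pt: "1 / (?m t)\<^sup>2 \<le> ?f t + ?g t" if "t \<in> {0..2*pi}" for t
  proof (cases "t \<le> pi")
    case True
    have "t / 2 / 2 \<le> sin (t / 2)"
      using that True pi_less_4 pi_approx by (intro sin_half_bound) auto
    then have "t / 2 \<le> norm (1 - exp (\<i> * of_real t))" unfolding norm_one_minus_exp by linarith
    from low[OF this] that have "1 / (?m t)\<^sup>2 \<le> ?f t" by simp
    moreover have "0 \<le> ?g t" by simp
    ultimately show ?thesis by linarith
  next
    case False
    have "(2 * pi - t) / 2 / 2 \<le> sin ((2 * pi - t) / 2)"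
      using that False pi_approx by (intro sin_half_bound) auto
    also have "(2 * pi - t) / 2 = pi - t / 2" by simp
    finally have "(2 * pi - t) / 2 \<le> norm (1 - exp (\<i> * of_real t))"
      unfolding norm_one_minus_exp by simp
    from low[OF this] that have "1 / (?m t)\<^sup>2 \<le> ?g t" by simp
    moreover have "0 \<le> ?f t" by simp
    ultimately show ?thesis by linarith
  qed
  have If: "(\<integral>\<^sup>+t. ennreal (?f t) * indicator {0..2*pi} t \<partial>lborel) = ennreal (4 / R * arctan (R * (2*pi) / 2) - 4 / R * arctan (R * 0 / 2))"
  proof (rule nn_integral_FTC_Icc[where F = "\<lambda>t. 4 / R * arctan (R * t / 2)"])
    fix t
    have "((\<lambda>t. 4 / R * arctan (R * t / 2)) has_real_derivative 4 / R * (inverse (1 + (R * t / 2)\<^sup>2) * (R / 2))) (at t)"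
      by (auto intro!: derivative_eq_intros)
    moreover have "4 / R * (inverse X * (R / 2)) = 2 / X" for X
      using \<open>R > 0\<close> by (simp add: field_simps)
    ultimately show "((\<lambda>t. 4 / R * arctan (R * t / 2)) has_real_derivative ?f t) (at t)"
      by (simp only:)
  qed auto
  have Ig: "(\<integral>\<^sup>+t. ennreal (?g t) * indicator {0..2*pi} t \<partial>lborel)
      = ennreal (- 4 / R * arctan (R * (2*pi - 2*pi) / 2) - (- 4 / R * arctan (R * (2*pi - 0) / 2)))"
  proof (rule nn_integral_FTC_Icc[where F = "\<lambda>t. - 4 / R * arctan (R * (2*pi - t) / 2)"])
    fix t
    have "((\<lambda>t. - 4 / R * arctan (R * (2*pi - t) / 2)) has_real_derivative - 4 / R * (inverse (1 + (R * (2*pi - t) / 2)\<^sup>2) * (- (R / 2)))) (at t)"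
      by (auto intro!: derivative_eq_intros)
    moreover have "- 4 / R * (inverse X * (- (R / 2))) = 2 / X" for X
      using \<open>R > 0\<close> by (simp add: field_simps)
    ultimately show "((\<lambda>t. - 4 / R * arctan (R * (2*pi - t) / 2)) has_real_derivative ?g t) (at t)"
      by (simp only:)
  qed auto
  have arc: "4 / R * arctan (R * (2*pi) / 2) \<le> 2 * pi / R"
  proof -
    have "arctan (R * (2*pi) / 2) \<le> pi / 2" using arctan_ubound less_imp_le by blast
    then have "4 / R * arctan (R * (2*pi) / 2) \<le> 4 / R * (pi / 2)"
      using \<open>R > 0\<close> by (intro mult_left_mono) auto
    then show ?thesis by simp
  qed
  have "(\<integral>\<^sup>+t. ennreal (1 / (?m t)\<^sup>2) * indicator {0..2*pi} t \<partial>lborel)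
     \<le> (\<integral>\<^sup>+t. (ennreal (?f t) * indicator {0..2*pi} t + ennreal (?g t) * indicator {0..2*pi} t) \<partial>lborel)"
  proof (rule nn_integral_mono)
    fix t
    show "ennreal (1 / (?m t)\<^sup>2) * indicator {0..2*pi} t \<le> ennreal (?f t) * indicator {0..2*pi} t + ennreal (?g t) * indicator {0..2*pi} t"
    proof (cases "t \<in> {0..2*pi}")
      case True
      then show ?thesis using pt[OF True] by (simp flip: ennreal_plus)
    qed simp
  qed
  also have "\<dots> = (\<integral>\<^sup>+t. ennreal (?f t) * indicator {0..2*pi} t \<partial>lborel) + (\<integral>\<^sup>+t. ennreal (?g t) * indicator {0..2*pi} t \<partial>lborel)"
    by (rule nn_integral_add) auto
  also have "\<dots> \<le> ennreal (2 * pi / R) + ennreal (2 * pi / R)"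
    unfolding If Ig using arc by (intro add_mono ennreal_leI) auto
  also have "\<dots> = ennreal (4 * pi / R)" using \<open>R > 0\<close> by (simp flip: ennreal_plus)
  finally show ?thesis .
qed

lemma decay_integral:
  assumes "R > 0"
  shows "(\<integral>\<^sup>+x. ennreal (1 / (decay R x)\<^sup>2) \<partial>(torus :: (real ^ 'd::finite) measure)) \<le> ennreal ((4 * pi / R) ^ CARD('d))"
proof -
  let ?h = "\<lambda>t. ennreal (1 / (max 1 (R * norm (1 - exp (\<i> * of_real t))))\<^sup>2)"
  have chr: "chr (axis k 1) x = exp (\<i> * of_real (x $ k))" for k and x :: "real ^ 'd"
    by (simp add: chr_def inner_axis')
  have "(\<integral>\<^sup>+x. ennreal (1 / (decay R x)\<^sup>2) \<partial>(torus :: (real ^ 'd) measure))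
      = (\<integral>\<^sup>+x. (\<Prod>k\<in>UNIV. ?h (x $ k)) \<partial>(torus :: (real ^ 'd) measure))"
  proof (rule nn_integral_cong)
    fix x :: "real ^ 'd"
    have "1 / (decay R x)\<^sup>2 = (\<Prod>k\<in>UNIV. 1 / (max 1 (R * norm (1 - exp (\<i> * of_real (x $ k)))))\<^sup>2)"
      by (simp add: decay_def chr prod_dividef prod_power_distrib)
    then show "ennreal (1 / (decay R x)\<^sup>2) = (\<Prod>k\<in>UNIV. ?h (x $ k))"
      by (simp add: prod_ennreal)
  qed
  also have "\<dots> = (\<integral>\<^sup>+t. ?h t * indicator {0..2*pi} t \<partial>lborel) ^ CARD('d)"
    by (rule torus_nn_integral_prod) simp
  also have "\<dots> \<le> ennreal (4 * pi / R) ^ CARD('d)"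
    by (intro power_mono decay_integral_1 assms) simp
  finally show ?thesis using assms by (simp add: ennreal_power)
qed

text \<open>Small exponents \<open>r\<close> are paid for by a high order \<open>M\<close> of decay, which leaves the
  integrable weight \<open>1 / (decay R x)\<^sup>2\<close>.\<close>

lemma decay_Lr:
  fixes G :: "real ^ 'd::finite \<Rightarrow> real"
  assumes "0 < r" "2 \<le> real M * r" "R \<ge> 1" "0 \<le> A"
    and G: "\<And>x. 0 \<le> G x" "\<And>x. decay R x ^ M * G x \<le> A"
  shows "(\<integral>\<^sup>+x. ennreal (G x powr r) \<partial>torus) \<le> ennreal (A powr r * (4 * pi / R) ^ CARD('d))"
proof -
  have pt: "G x powr r \<le> A powr r * (1 / (decay R x)\<^sup>2)" for x
  proof -
    let ?D = "decay R x"
    have D: "?D \<ge> 1" by (rule decay_ge_1)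
    have "?D powr 2 \<le> ?D powr (real M * r)" using D assms by (intro powr_mono) auto
    also have "\<dots> = (?D ^ M) powr r" using D by (simp add: powr_realpow[symmetric] powr_powr)
    finally have "?D\<^sup>2 * G x powr r \<le> (?D ^ M) powr r * G x powr r"
      using D by (intro mult_right_mono) (auto simp: powr_numeral)
    also have "\<dots> = (?D ^ M * G x) powr r" using D G by (simp add: powr_mult)
    also have "\<dots> \<le> A powr r" using D G assms by (intro powr_mono2) auto
    finally show ?thesis using D by (simp add: field_simps)
  qed
  have "(\<integral>\<^sup>+x. ennreal (G x powr r) \<partial>torus) \<le> (\<integral>\<^sup>+x. ennreal (A powr r) * ennreal (1 / (decay R x)\<^sup>2) \<partial>(torus :: (real ^ 'd) measure))"
    by (intro nn_integral_mono) (use pt in \<open>simp flip: ennreal_mult'\<close>)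
  also have "\<dots> = ennreal (A powr r) * (\<integral>\<^sup>+x. ennreal (1 / (decay R x)\<^sup>2) \<partial>(torus :: (real ^ 'd) measure))"
  proof (rule nn_integral_cmult)
    have "continuous_on UNIV (\<lambda>x :: real ^ 'd. 1 / (decay R x)\<^sup>2)"
    proof (intro continuous_intros ballI)
      fix x :: "real ^ 'd"
      show "(decay R x)\<^sup>2 \<noteq> 0" using decay_ge_1[of R x] by simp
    qed
    then show "(\<lambda>x :: real ^ 'd. ennreal (1 / (decay R x)\<^sup>2)) \<in> borel_measurable torus"
      by (intro measurable_compose[OF borel_measurable_torus]) auto
  qed
  also have "\<dots> \<le> ennreal (A powr r) * ennreal ((4 * pi / R) ^ CARD('d))"
    using assms by (intro mult_left_mono decay_integral) auto
  also have "\<dots> = ennreal (A powr r * (4 * pi / R) ^ CARD('d))"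
    by (simp add: ennreal_mult')
  finally show ?thesis .
qed

section \<open>Rudin--Shapiro signs\<close>

text \<open>The recursion does not close for a single sequence: the second one is the companion that it
  needs.\<close>

primrec rudin_shapiro :: "nat \<Rightarrow> (nat \<Rightarrow> real) \<times> (nat \<Rightarrow> real)" where
  "rudin_shapiro 0 = (\<lambda>_. 1, \<lambda>_. 1)"
| "rudin_shapiro (Suc l) =
     (\<lambda>k. if k < 2 ^ l then fst (rudin_shapiro l) k else snd (rudin_shapiro l) (k - 2 ^ l),
      \<lambda>k. if k < 2 ^ l then fst (rudin_shapiro l) k else - snd (rudin_shapiro l) (k - 2 ^ l))"

lemma abs_rudin_shapiro: "\<bar>fst (rudin_shapiro l) k\<bar> = 1 \<and> \<bar>snd (rudin_shapiro l) k\<bar> = 1"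
  by (induction l arbitrary: k) auto

lemma sum_lessThan_add: "(\<Sum>k<a + b. f k) = (\<Sum>k<a. f k) + (\<Sum>k<b. f (a + k :: nat))"
  for f :: "nat \<Rightarrow> 'a::comm_monoid_add"
  by (induction b) (auto simp: add.assoc)

lemma parallelogram: "(norm (a + b))\<^sup>2 + (norm (a - b))\<^sup>2 = 2 * ((norm a)\<^sup>2 + (norm b)\<^sup>2)" for a b :: complex
  unfolding cmod_power2 by (simp add: algebra_simps power2_eq_square)

text \<open>With \<open>P\<close> and \<open>Q\<close> the two polynomials of length \<open>2 ^ l\<close>, the next pair is
  \<open>P + z ^ (2 ^ l) * Q\<close> and \<open>P - z ^ (2 ^ l) * Q\<close>, so the parallelogram law doubles the sum of
  squares. Each polynomial is thus bounded by the square root of its length, up to a constant.\<close>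

lemma rudin_shapiro_flat:
  fixes z :: complex
  assumes "norm z = 1"
  shows "(norm (\<Sum>k<2 ^ l. of_real (fst (rudin_shapiro l) k) * z ^ k))\<^sup>2
       + (norm (\<Sum>k<2 ^ l. of_real (snd (rudin_shapiro l) k) * z ^ k))\<^sup>2 = 2 * 2 ^ l"
proof (induction l)
  case (Suc l)
  let ?P = "\<Sum>k<2 ^ l. of_real (fst (rudin_shapiro l) k) * z ^ k"
  let ?Q = "\<Sum>k<2 ^ l. of_real (snd (rudin_shapiro l) k) * z ^ k"
  have two: "(2::nat) ^ Suc l = 2 ^ l + 2 ^ l" by simp
  have "(\<Sum>k<2 ^ Suc l. of_real (fst (rudin_shapiro (Suc l)) k) * z ^ k) = ?P + z ^ 2 ^ l * ?Q"
    unfolding two sum_lessThan_add by (simp add: sum_distrib_left power_add mult_ac)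
  moreover have "(\<Sum>k<2 ^ Suc l. of_real (snd (rudin_shapiro (Suc l)) k) * z ^ k) = ?P - z ^ 2 ^ l * ?Q"
    unfolding two sum_lessThan_add by (simp add: sum_distrib_left power_add mult_ac sum_negf)
  ultimately show ?case
    using Suc assms by (simp add: parallelogram norm_mult norm_power)
qed simp

section \<open>Blocks of signed bumps\<close>

definition cube :: "nat \<Rightarrow> (int ^ 'd) set" where
  "cube K = {k. \<forall>i. k $ i \<in> {0..<int K}}"

text \<open>A product over the coordinates, so that exponential sums with these signs factor.\<close>

definition signs :: "nat \<Rightarrow> int ^ 'd \<Rightarrow> real" where
  "signs l k = (\<Prod>i\<in>UNIV. fst (rudin_shapiro l) (nat (k $ i)))"

definition centre :: "nat \<Rightarrow> int ^ 'd \<Rightarrow> int ^ 'd \<Rightarrow> int ^ 'd" where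
  "centre L n\<^sub>0 k = (\<chi> i. n\<^sub>0 $ i + int L * k $ i)"

text \<open>A cube of \<open>2 ^ l\<close> cells of side \<open>L\<close> in every direction, with corner \<open>n\<^sub>0\<close>, each
  carrying a signed copy of the bump \<open>\<eta>\<close>.\<close>

definition block :: "(real ^ 'd \<Rightarrow> complex) \<Rightarrow> nat \<Rightarrow> nat \<Rightarrow> int ^ 'd \<Rightarrow> int ^ 'd \<Rightarrow> complex" where
  "block \<eta> l L n\<^sub>0 n =
     (\<Sum>k\<in>cube (2 ^ l). of_real (signs l k) * \<eta> ((1 / real L) *\<^sub>R lat (n - centre L n\<^sub>0 k)))"

lemma finite_cube [simp]: "finite (cube K :: (int ^ 'd::finite) set)"
  unfolding cube_def by (rule finite_vec_box) simp

lemma card_cube: "card (cube K :: (int ^ 'd::finite) set) = K ^ CARD('d)"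
  unfolding cube_def by (subst card_vec_box) simp

lemma abs_signs [simp]: "\<bar>signs l k\<bar> = 1"
  by (simp add: signs_def abs_prod abs_rudin_shapiro)

lemma lat_centre: "lat (centre L n\<^sub>0 k) = lat n\<^sub>0 + real L *\<^sub>R lat k"
  by (simp add: vec_eq_iff centre_def)

lemma norm_lat_ge_1:
  assumes "n \<noteq> (0 :: int ^ 'd::finite)"
  shows "1 \<le> norm (lat n)"
proof -
  obtain i where "n $ i \<noteq> 0" using assms by (auto simp: vec_eq_iff)
  then have "1 \<le> \<bar>real_of_int (n $ i)\<bar>" by linarith
  also have "\<dots> \<le> norm (lat n)" using component_le_norm_cart[of "lat n" i] by simp
  finally show ?thesis .
qed

lemma centre_separated:
  fixes k k' :: "int ^ 'd::finite"
  assumes "k \<noteq> k'"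
  shows "real L \<le> norm (lat (centre L n\<^sub>0 k) - lat (centre L n\<^sub>0 k'))"
proof -
  have "lat (centre L n\<^sub>0 k) - lat (centre L n\<^sub>0 k') = real L *\<^sub>R lat (k - k')"
    by (simp add: lat_centre algebra_simps)
  moreover have "1 \<le> norm (lat (k - k'))" using assms by (intro norm_lat_ge_1) simp
  ultimately show ?thesis using mult_left_mono[of 1 "norm (lat (k - k'))" "real L"] by simp
qed

text \<open>The radius \<open>1 / 8\<close> leaves room between neighbouring bumps, whose centres are at least
  \<open>L\<close> apart: even at distance \<open>L / 4\<close> from a centre no other bump is visible.\<close>

locale bump =
  fixes \<eta> :: "real ^ 'd::finite \<Rightarrow> complex" and L :: nat
  assumes supp: "\<And>\<xi>. \<eta> \<xi> \<noteq> 0 \<Longrightarrow> norm \<xi> \<le> 1 / 8" and L_pos: "L > 0"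
begin

lemma sample_support:
  assumes "\<eta> ((1 / real L) *\<^sub>R v) \<noteq> 0"
  shows "norm v \<le> real L / 8"
proof -
  have "norm ((1 / real L) *\<^sub>R v) \<le> 1 / 8" by (rule supp[OF assms])
  then show ?thesis using L_pos by (simp add: field_simps)
qed

lemma block_support:
  assumes "block \<eta> l L n\<^sub>0 n \<noteq> 0"
  obtains k where "k \<in> cube (2 ^ l)" "norm (lat (n - centre L n\<^sub>0 k)) \<le> real L / 8"
proof -
  obtain k where "k \<in> cube (2 ^ l)" "of_real (signs l k) * \<eta> ((1 / real L) *\<^sub>R lat (n - centre L n\<^sub>0 k)) \<noteq> 0"
    using assms unfolding block_def by (meson sum.neutral)
  then show ?thesis using that[of k] sample_support by (auto simp del: lat_diff)
qed

lemma block_eq_piece: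
  assumes "k \<in> cube (2 ^ l)" "norm (lat (n - centre L n\<^sub>0 k)) \<le> real L / 4"
  shows "block \<eta> l L n\<^sub>0 n = of_real (signs l k) * \<eta> ((1 / real L) *\<^sub>R lat (n - centre L n\<^sub>0 k))"
proof -
  have "\<eta> ((1 / real L) *\<^sub>R lat (n - centre L n\<^sub>0 k')) = 0" if "k' \<noteq> k" for k'
  proof (rule ccontr)
    assume "\<not> ?thesis"
    then have "norm (lat (n - centre L n\<^sub>0 k')) \<le> real L / 8" by (rule sample_support)
    moreover have "real L \<le> norm (lat (n - centre L n\<^sub>0 k') - lat (n - centre L n\<^sub>0 k))"
      using centre_separated[of k k' L n\<^sub>0] that by (simp add: norm_minus_commute)
    ultimately have "real L \<le> real L / 8 + real L / 4"
      using norm_triangle_ineq4[of "lat (n - centre L n\<^sub>0 k')" "lat (n - centre L n\<^sub>0 k)"] assms(2) by linarith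
    then show False using L_pos by simp
  qed
  then have "block \<eta> l L n\<^sub>0 n = (\<Sum>k'\<in>cube (2 ^ l). if k' = k then of_real (signs l k) * \<eta> ((1 / real L) *\<^sub>R lat (n - centre L n\<^sub>0 k)) else 0)"
    unfolding block_def by (intro sum.cong) (auto simp del: lat_diff)
  then show ?thesis using assms(1) by simp
qed

lemma block_bound:
  assumes "\<And>\<xi>. norm (\<eta> \<xi>) \<le> C"
  shows "norm (block \<eta> l L n\<^sub>0 n) \<le> C"
proof (cases "block \<eta> l L n\<^sub>0 n = 0")
  case True
  then show ?thesis using order_trans[OF norm_ge_zero assms] by simp
next
  case False
  then obtain k where k: "k \<in> cube (2 ^ l)" "norm (lat (n - centre L n\<^sub>0 k)) \<le> real L / 8"
    by (rule block_support)
  then have "norm (lat (n - centre L n\<^sub>0 k)) \<le> real L / 4" by linarith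
  from block_eq_piece[OF k(1) this] assms show ?thesis by (simp add: norm_mult)
qed

lemma finite_block_support: "finite {n. block \<eta> l L n\<^sub>0 n \<noteq> 0}"
proof -
  have "finite (\<Union>k\<in>cube (2 ^ l). (\<lambda>m. m + centre L n\<^sub>0 k) ` {m :: int ^ 'd. norm (lat m) \<le> real L / 8})"
    by (intro finite_UN_I finite_imageI lattice_ball) auto
  moreover have "{n. block \<eta> l L n\<^sub>0 n \<noteq> 0} \<subseteq> (\<Union>k\<in>cube (2 ^ l). (\<lambda>m. m + centre L n\<^sub>0 k) ` {m. norm (lat m) \<le> real L / 8})"
  proof safe
    fix n assume "block \<eta> l L n\<^sub>0 n \<noteq> 0"
    then obtain k where k: "k \<in> cube (2 ^ l)" "norm (lat (n - centre L n\<^sub>0 k)) \<le> real L / 8"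
      by (rule block_support)
    have "n = (n - centre L n\<^sub>0 k) + centre L n\<^sub>0 k" by simp
    with k show "n \<in> (\<Union>k\<in>cube (2 ^ l). (\<lambda>m. m + centre L n\<^sub>0 k) ` {m. norm (lat m) \<le> real L / 8})"
      by blast
  qed
  ultimately show ?thesis by (rule finite_subset[rotated])
qed

text \<open>All bumps are translates of each other, so the kernel of the block is that of one bump times
  an exponential sum over the centres.\<close>

lemma tpoly_block:
  "tpoly (block \<eta> l L n\<^sub>0) x =
     (\<Sum>k\<in>cube (2 ^ l). of_real (signs l k) * chr (centre L n\<^sub>0 k) x) * tpoly (\<lambda>m. \<eta> ((1 / real L) *\<^sub>R lat m)) x"
proof -
  let ?T = "{m :: int ^ 'd. norm (lat m) \<le> real L / 8}"
  let ?S = "{n. block \<eta> l L n\<^sub>0 n \<noteq> 0} \<union> (\<Union>k\<in>cube (2 ^ l). (\<lambda>m. m + centre L n\<^sub>0 k) ` ?T)"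
  have finT: "finite ?T" by (intro lattice_ball) simp
  have finS: "finite ?S" using finite_block_support finT by auto
  have T: "tpoly (\<lambda>m. \<eta> ((1 / real L) *\<^sub>R lat m)) x = (\<Sum>m\<in>?T. \<eta> ((1 / real L) *\<^sub>R lat m) * chr m x)"
    by (rule tpoly_eq_sum[OF finT]) (use sample_support in auto)
  have piece: "(\<Sum>n\<in>?S. \<eta> ((1 / real L) *\<^sub>R lat (n - centre L n\<^sub>0 k)) * chr n x)
      = chr (centre L n\<^sub>0 k) x * tpoly (\<lambda>m. \<eta> ((1 / real L) *\<^sub>R lat m)) x" if k: "k \<in> cube (2 ^ l)" for k
  proof -
    let ?c = "centre L n\<^sub>0 k"
    have "(\<Sum>n\<in>?S. \<eta> ((1 / real L) *\<^sub>R lat (n - ?c)) * chr n x)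
        = (\<Sum>n\<in>(\<lambda>m. m + ?c) ` ?T. \<eta> ((1 / real L) *\<^sub>R lat (n - ?c)) * chr n x)"
    proof (rule sum.mono_neutral_right[OF finS])
      show "(\<lambda>m. m + ?c) ` ?T \<subseteq> ?S" using k by blast
      show "\<forall>n\<in>?S - (\<lambda>m. m + ?c) ` ?T. \<eta> ((1 / real L) *\<^sub>R lat (n - ?c)) * chr n x = 0"
      proof
        fix n assume "n \<in> ?S - (\<lambda>m. m + ?c) ` ?T"
        then have n: "n \<notin> (\<lambda>m. m + ?c) ` ?T" by blast
        have "n - ?c \<notin> ?T"
        proof
          assume "n - ?c \<in> ?T"
          then have "(\<lambda>m. m + ?c) (n - ?c) \<in> (\<lambda>m. m + ?c) ` ?T" by (rule imageI)
          then have "n \<in> (\<lambda>m. m + ?c) ` ?T" by (simp only: diff_add_cancel)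
          with n show False by contradiction
        qed
        then have "\<eta> ((1 / real L) *\<^sub>R lat (n - ?c)) = 0" using sample_support by blast
        then show "\<eta> ((1 / real L) *\<^sub>R lat (n - ?c)) * chr n x = 0" by simp
      qed
    qed
    also have "\<dots> = (\<Sum>m\<in>?T. \<eta> ((1 / real L) *\<^sub>R lat m) * chr (m + ?c) x)"
      by (subst sum.reindex) (auto simp: inj_on_def)
    finally show ?thesis unfolding T by (simp add: chr_add sum_distrib_left mult_ac)
  qed
  have "tpoly (block \<eta> l L n\<^sub>0) x = (\<Sum>n\<in>?S. block \<eta> l L n\<^sub>0 n * chr n x)"
    by (rule tpoly_eq_sum[OF finS]) auto
  also have "\<dots> = (\<Sum>k\<in>cube (2 ^ l). of_real (signs l k) * (\<Sum>n\<in>?S. \<eta> ((1 / real L) *\<^sub>R lat (n - centre L n\<^sub>0 k)) * chr n x))"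
    unfolding block_def sum_distrib_right sum_distrib_left by (subst sum.swap) (simp add: mult_ac)
  also have "\<dots> = (\<Sum>k\<in>cube (2 ^ l). of_real (signs l k) * (chr (centre L n\<^sub>0 k) x * tpoly (\<lambda>m. \<eta> ((1 / real L) *\<^sub>R lat m)) x))"
    by (intro sum.cong refl) (simp only: piece)
  also have "\<dots> = (\<Sum>k\<in>cube (2 ^ l). of_real (signs l k) * chr (centre L n\<^sub>0 k) x) * tpoly (\<lambda>m. \<eta> ((1 / real L) *\<^sub>R lat m)) x"
    unfolding sum_distrib_right by (simp only: mult.assoc)
  finally show ?thesis .
qed

end

text \<open>The sum is a product over the coordinates of one-dimensional Rudin--Shapiro polynomials.\<close>

lemma signed_character_sum:
  "norm (\<Sum>k\<in>cube (2 ^ l). of_real (signs l k) * chr (centre L n\<^sub>0 k) x) \<le> sqrt (2 * 2 ^ l) ^ CARD('d)"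
  for x :: "real ^ 'd::finite"
proof -
  let ?z = "\<lambda>i. exp (\<i> * of_real (real L * x $ i))"
  let ?A = "{0..<int (2 ^ l)}"
  have chr: "chr (centre L n\<^sub>0 k) x = chr n\<^sub>0 x * (\<Prod>i\<in>UNIV. ?z i ^ nat (k $ i))" if "k \<in> cube (2 ^ l)" for k
  proof -
    have k: "0 \<le> k $ i" for i using that by (auto simp: cube_def)
    have "chr (centre L n\<^sub>0 k) x = chr n\<^sub>0 x * (\<Prod>i\<in>UNIV. exp (\<i> * of_real (real L * real_of_int (k $ i) * x $ i)))"
      unfolding chr_prod prod.distrib[symmetric]
      by (intro prod.cong refl) (simp add: centre_def algebra_simps flip: exp_add)
    also have "(\<Prod>i\<in>UNIV. exp (\<i> * of_real (real L * real_of_int (k $ i) * x $ i))) = (\<Prod>i\<in>UNIV. ?z i ^ nat (k $ i))"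
    proof (intro prod.cong refl)
      fix i
      have "?z i ^ nat (k $ i) = exp (of_nat (nat (k $ i)) * (\<i> * of_real (real L * x $ i)))"
        by (rule exp_of_nat_mult[symmetric])
      also have "of_nat (nat (k $ i)) = complex_of_real (real_of_int (k $ i))" using k[of i] by simp
      finally show "exp (\<i> * of_real (real L * real_of_int (k $ i) * x $ i)) = ?z i ^ nat (k $ i)"
        by (simp add: mult_ac)
    qed
    finally show ?thesis .
  qed
  have "(\<Sum>k\<in>cube (2 ^ l). of_real (signs l k) * chr (centre L n\<^sub>0 k) x)
      = chr n\<^sub>0 x * (\<Sum>k\<in>{k :: int ^ 'd. \<forall>i. k $ i \<in> ?A}. \<Prod>i\<in>UNIV. of_real (fst (rudin_shapiro l) (nat (k $ i))) * ?z i ^ nat (k $ i))"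
    unfolding sum_distrib_left cube_def[symmetric]
    by (intro sum.cong refl) (simp add: chr signs_def prod.distrib mult_ac)
  also have "\<dots> = chr n\<^sub>0 x * (\<Prod>i\<in>UNIV. \<Sum>a\<in>?A. of_real (fst (rudin_shapiro l) (nat a)) * ?z i ^ nat a)"
    by (subst prod_sum_vec_box) auto
  finally have "norm (\<Sum>k\<in>cube (2 ^ l). of_real (signs l k) * chr (centre L n\<^sub>0 k) x)
      = (\<Prod>i\<in>UNIV. norm (\<Sum>a\<in>?A. of_real (fst (rudin_shapiro l) (nat a)) * ?z i ^ nat a))"
    by (simp add: norm_mult prod_norm)
  also have "\<dots> \<le> (\<Prod>i\<in>(UNIV :: 'd set). sqrt (2 * 2 ^ l))"
  proof (intro prod_mono conjI)
    fix i
    have "(\<Sum>a\<in>?A. of_real (fst (rudin_shapiro l) (nat a)) * ?z i ^ nat a)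
        = (\<Sum>k<2 ^ l. of_real (fst (rudin_shapiro l) k) * ?z i ^ k)"
      by (rule sum.reindex_bij_witness[of _ int nat]) auto
    moreover have "(norm (\<Sum>k<2 ^ l. of_real (fst (rudin_shapiro l) k) * ?z i ^ k))\<^sup>2 \<le> 2 * 2 ^ l"
      using rudin_shapiro_flat[OF norm_exp_i_times[of "real L * x $ i"], of l]
        zero_le_power2[of "norm (\<Sum>k<2 ^ l. of_real (snd (rudin_shapiro l) k) * ?z i ^ k)"]
      by linarith
    ultimately show "norm (\<Sum>a\<in>?A. of_real (fst (rudin_shapiro l) (nat a)) * ?z i ^ nat a) \<le> sqrt (2 * 2 ^ l)"
      by (metis real_le_rsqrt)
  qed auto
  finally show ?thesis by simp
qed

context bump
begin

text \<open>The square root of the number of cells, rather than that number, multiplies the trivial bound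
  for one bump: this cancellation is the source of the loss of derivatives.\<close>

lemma block_kernel_bound:
  assumes "\<And>\<xi>. norm (\<eta> \<xi>) \<le> C"
  shows "norm (tpoly (block \<eta> l L n\<^sub>0) x) \<le> sqrt (2 * 2 ^ l) ^ CARD('d) * ((2 * real L) ^ CARD('d) * C)"
proof -
  have C0: "0 \<le> C" using assms norm_ge_zero order_trans by blast
  have "norm (tpoly (\<lambda>m. \<eta> ((1 / real L) *\<^sub>R lat m)) x) \<le> (2 * (real L / 8) + 1) ^ CARD('d) * C"
    by (rule tpoly_norm_le) (use assms sample_support in auto)
  also have "\<dots> \<le> (2 * real L) ^ CARD('d) * C"
  proof (intro mult_right_mono power_mono C0)
    have "1 \<le> real L" using L_pos by linarith
    then show "2 * (real L / 8) + 1 \<le> 2 * real L" by linarith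
  qed simp
  finally have "norm (tpoly (\<lambda>m. \<eta> ((1 / real L) *\<^sub>R lat m)) x) \<le> (2 * real L) ^ CARD('d) * C" .
  then show ?thesis
    unfolding tpoly_block norm_mult by (intro mult_mono signed_character_sum) auto
qed

text \<open>The bumps are disjoint and each is of size at least \<open>1 / 2\<close> at about \<open>(r * L) ^ CARD('d)\<close>
  lattice points.\<close>

lemma block_mass:
  assumes half: "\<And>\<xi>. norm \<xi> \<le> r \<Longrightarrow> 1 / 2 \<le> norm (\<eta> \<xi>)" and "0 < r"
  shows "(1 / 4) * (2 ^ l * (r * real L / CARD('d))) ^ CARD('d) \<le> (\<Sum>n | block \<eta> l L n\<^sub>0 n \<noteq> 0. (norm (block \<eta> l L n\<^sub>0 n))\<^sup>2)"
proof -
  let ?d = "CARD('d)"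
  let ?N = "nat \<lfloor>r * real L / ?d\<rfloor>"
  let ?T = "cube (Suc ?N) :: (int ^ 'd) set"
  have small: "norm (lat m) \<le> r * real L" if "m \<in> ?T" for m
  proof -
    have "norm (lat m) \<le> (\<Sum>i\<in>UNIV. \<bar>lat m $ i\<bar>)" by (rule norm_le_l1_cart)
    also have "\<dots> \<le> (\<Sum>i\<in>(UNIV :: 'd set). r * real L / ?d)"
    proof (rule sum_mono)
      fix i
      have "m $ i \<in> {0..<int (Suc ?N)}" using that unfolding cube_def by blast
      then have "0 \<le> m $ i" "m $ i < int (Suc ?N)" by (simp_all only: atLeastLessThan_iff)
      then have "0 \<le> m $ i" "m $ i \<le> int ?N" by linarith+
      then have "real_of_int (m $ i) \<le> real ?N" "0 \<le> real_of_int (m $ i)"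
        by linarith+
      moreover have "real ?N \<le> r * real L / ?d"
        using \<open>0 < r\<close> by (intro of_nat_floor) simp
      ultimately show "\<bar>lat m $ i\<bar> \<le> r * real L / ?d" by simp
    qed
    also have "\<dots> = r * real L" by simp
    finally show ?thesis .
  qed
  have half': "1 / 2 \<le> norm (\<eta> ((1 / real L) *\<^sub>R lat m))" if "m \<in> ?T" for m
    using small[OF that] L_pos by (intro half) (simp add: field_simps)
  have big: "1 / 2 \<le> norm (block \<eta> l L n\<^sub>0 (m + centre L n\<^sub>0 k))" if "m \<in> ?T" "k \<in> cube (2 ^ l)" for m k
  proof -
    have "\<eta> ((1 / real L) *\<^sub>R lat m) \<noteq> 0" using half'[OF that(1)] by auto
    then have "norm (lat m) \<le> real L / 8" by (rule sample_support)
    then have "norm (lat (m + centre L n\<^sub>0 k - centre L n\<^sub>0 k)) \<le> real L / 4" by simp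
    from block_eq_piece[OF that(2) this] show ?thesis using half'[OF that(1)] by (simp add: norm_mult)
  qed
  let ?f = "\<lambda>(k, m). m + centre L n\<^sub>0 k :: int ^ 'd"
  have inj: "inj_on ?f (cube (2 ^ l) \<times> ?T)"
  proof (rule inj_onI, clarsimp)
    fix k m k' m' assume *: "k \<in> cube (2 ^ l)" "m \<in> ?T" "k' \<in> cube (2 ^ l)" "m' \<in> ?T"
      and eq: "m + centre L n\<^sub>0 k = m' + centre L n\<^sub>0 k'"
    have "k = k'"
    proof (rule ccontr)
      assume "k \<noteq> k'"
      then have "real L \<le> norm (lat (centre L n\<^sub>0 k) - lat (centre L n\<^sub>0 k'))" by (rule centre_separated)
      also have "lat (centre L n\<^sub>0 k) - lat (centre L n\<^sub>0 k') = lat m' - lat m"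
        using arg_cong[OF eq, of lat] by (simp add: algebra_simps)
      also have "norm \<dots> \<le> norm (lat m') + norm (lat m)" by (rule norm_triangle_ineq4)
      also have "\<dots> \<le> real L / 8 + real L / 8"
        using half'[OF *(2)] half'[OF *(4)] by (intro add_mono sample_support) auto
      finally show False using L_pos by simp
    qed
    with eq show "k = k' \<and> m = m'" by simp
  qed
  have "r * real L / ?d \<le> real (Suc ?N)" using \<open>0 < r\<close> by linarith
  then have "(2 ^ l * (r * real L / ?d)) ^ ?d \<le> (2 ^ l * real (Suc ?N)) ^ ?d"
    using \<open>0 < r\<close> by (intro power_mono mult_left_mono) auto
  also have "\<dots> = real (card ((cube (2 ^ l) :: (int ^ 'd) set) \<times> ?T))"
    unfolding card_cartesian_product card_cube by (simp add: power_mult_distrib flip: power_mult)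
  also have "\<dots> = real (card (?f ` (cube (2 ^ l) \<times> ?T)))" by (simp add: card_image[OF inj])
  finally have "(1 / 4) * (2 ^ l * (r * real L / ?d)) ^ ?d \<le> (\<Sum>n\<in>?f ` (cube (2 ^ l) \<times> ?T). 1 / 4)"
    by simp
  also have "\<dots> \<le> (\<Sum>n\<in>?f ` (cube (2 ^ l) \<times> ?T). (norm (block \<eta> l L n\<^sub>0 n))\<^sup>2)"
  proof (rule sum_mono)
    fix n assume "n \<in> ?f ` (cube (2 ^ l) \<times> ?T)"
    then have "1 / 2 \<le> norm (block \<eta> l L n\<^sub>0 n)" using big by auto
    from power_mono[OF this, of 2] show "1 / 4 \<le> (norm (block \<eta> l L n\<^sub>0 n))\<^sup>2" by (simp add: power2_eq_square)
  qed
  also have "\<dots> \<le> (\<Sum>n | block \<eta> l L n\<^sub>0 n \<noteq> 0. (norm (block \<eta> l L n\<^sub>0 n))\<^sup>2)"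
  proof (rule sum_mono2[OF finite_block_support])
    show "?f ` (cube (2 ^ l) \<times> ?T) \<subseteq> {n. block \<eta> l L n\<^sub>0 n \<noteq> 0}"
      using big by fastforce
  qed simp
  finally show ?thesis .
qed

end

lemma cnj_block: "cnj (block \<eta> l L n\<^sub>0 n) = block (\<lambda>\<xi>. cnj (\<eta> \<xi>)) l L n\<^sub>0 n"
  by (simp add: block_def)

section \<open>Trigonometric polynomials as distributions\<close>

definition tdistr :: "(int ^ 'd \<Rightarrow> complex) \<Rightarrow> (real ^ 'd \<Rightarrow> complex) \<Rightarrow> complex" where
  "tdistr c \<psi> = (if \<psi> \<in> torus_smooth then (\<Sum>n | c n \<noteq> 0. c n * (LINT x|torus. chr n x * \<psi> x)) else 0)"

lemma torus_smooth_continuous: "\<psi> \<in> torus_smooth \<Longrightarrow> continuous_on S \<psi>"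
  by (auto simp: torus_smooth_def smooth_imp_continuous)

lemma torus_smooth_integrable: "\<psi> \<in> torus_smooth \<Longrightarrow> integrable torus (\<lambda>x. chr n x * \<psi> x)"
  by (intro integrable_torus continuous_intros torus_smooth_continuous)

text \<open>By periodicity the values on one compact period cell are all the values.\<close>

lemma torus_smooth_bounded:
  fixes \<psi> :: "real ^ 'd::finite \<Rightarrow> complex"
  assumes "\<psi> \<in> torus_smooth"
  shows "bdd_above (range (\<lambda>x. norm (\<psi> x)))"
proof -
  have "compact (\<psi> ` cbox 0 (\<chi> j. 2 * pi))"
    by (intro compact_continuous_image torus_smooth_continuous assms) auto
  then obtain B where B: "\<forall>x\<in>cbox 0 (\<chi> j. 2 * pi). norm (\<psi> x) \<le> B"
    by (auto dest!: compact_imp_bounded simp: bounded_iff)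
  have "norm (\<psi> x) \<le> B" for x
  proof -
    \<comment> \<open>The translation that moves \<open>x\<close> into the period cell.\<close>
    define k :: "int ^ 'd" where "k = (\<chi> j. - \<lfloor>x $ j / (2 * pi)\<rfloor>)"
    have "x + (2 * pi) *\<^sub>R lat k \<in> cbox 0 (\<chi> j. 2 * pi)"
    proof -
      have "0 \<le> x $ j + 2 * pi * of_int (k $ j) \<and> x $ j + 2 * pi * of_int (k $ j) \<le> 2 * pi" for j
      proof -
        have "x $ j = 2 * pi * (x $ j / (2 * pi))" by simp
        moreover have "of_int \<lfloor>x $ j / (2 * pi)\<rfloor> \<le> x $ j / (2 * pi)" "x $ j / (2 * pi) \<le> of_int \<lfloor>x $ j / (2 * pi)\<rfloor> + 1"
          by linarith+
        ultimately have "2 * pi * of_int \<lfloor>x $ j / (2 * pi)\<rfloor> \<le> x $ j" "x $ j \<le> 2 * pi * (of_int \<lfloor>x $ j / (2 * pi)\<rfloor> + 1)"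
          by (metis mult_left_mono pi_ge_zero mult_nonneg_nonneg zero_le_numeral)+
        then show ?thesis by (simp add: k_def algebra_simps)
      qed
      then show ?thesis by (simp add: mem_box_cart)
    qed
    moreover have "\<psi> (x + (2 * pi) *\<^sub>R lat k) = \<psi> x" using assms by (simp add: torus_smooth_def)
    ultimately show ?thesis using B by metis
  qed
  then show ?thesis by (auto intro!: bdd_aboveI)
qed

lemma torus_smooth_add: "\<psi> \<in> torus_smooth \<Longrightarrow> \<eta> \<in> torus_smooth \<Longrightarrow> (\<lambda>x. \<psi> x + \<eta> x) \<in> torus_smooth"
  by (simp add: torus_smooth_def smooth_add)

lemma torus_smooth_cmult: "\<psi> \<in> torus_smooth \<Longrightarrow> (\<lambda>x. c * \<psi> x) \<in> torus_smooth"
  by (simp add: torus_smooth_def smooth_mult)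

lemma torus_smooth_const [simp]: "(\<lambda>x. c) \<in> torus_smooth"
  by (simp add: torus_smooth_def)

lemma msize_0: "{\<beta>. msize \<beta> \<le> 0} = {0 :: nat ^ 'd::finite}"
  by (auto simp: msize_def vec_eq_iff)

lemma mpartial_0 [simp]: "mpartial 0 f = f" for f :: "real ^ 'd::finite \<Rightarrow> complex"
proof -
  have "foldr (\<lambda>j. partial j ^^ ((0 :: nat ^ 'd) $ j)) js f = f" for js :: "'d list"
    by (induction js) auto
  then show ?thesis by (simp add: mpartial_def)
qed

lemma tdistr_in_distr:
  fixes c :: "int ^ 'd::finite \<Rightarrow> complex"
  shows "tdistr c \<in> torus_distr"
proof -
  have "norm (tdistr c \<psi>) \<le> ((\<Sum>n | c n \<noteq> 0. norm (c n)) * (2 * pi) ^ CARD('d)) * (\<Sum>\<beta> | msize \<beta> \<le> 0. (SUP x. norm (mpartial \<beta> \<psi> x)))"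
    if \<psi>: "\<psi> \<in> torus_smooth" for \<psi>
  proof -
    let ?S = "SUP x. norm (\<psi> x)"
    have S: "norm (\<psi> x) \<le> ?S" for x
      by (rule cSUP_upper[OF UNIV_I torus_smooth_bounded[OF \<psi>]])
    interpret finite_measure "torus :: (real ^ 'd) measure" by (rule finite_measure_torus)
    have I: "norm (LINT x|torus. chr n x * \<psi> x) \<le> (2 * pi) ^ CARD('d) * ?S" for n
    proof -
      have "norm (LINT x|torus. chr n x * \<psi> x) \<le> (LINT x|torus. norm (chr n x * \<psi> x))"
        by (rule integral_norm_bound)
      also have "\<dots> \<le> (LINT x|(torus :: (real ^ 'd) measure). ?S)"
        by (rule integral_mono[OF integrable_norm[OF torus_smooth_integrable[OF \<psi>]]]) (auto simp: norm_mult S)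
      also have "\<dots> = (2 * pi) ^ CARD('d) * ?S" by (simp add: measure_torus)
      finally show ?thesis .
    qed
    have "norm (tdistr c \<psi>) \<le> (\<Sum>n | c n \<noteq> 0. norm (c n) * norm (LINT x|torus. chr n x * \<psi> x))"
      using \<psi> by (simp add: tdistr_def norm_mult[symmetric] norm_sum)
    also have "\<dots> \<le> (\<Sum>n | c n \<noteq> 0. norm (c n) * ((2 * pi) ^ CARD('d) * ?S))"
      by (intro sum_mono mult_left_mono I) simp
    finally show ?thesis by (simp add: msize_0[simplified] sum_distrib_right mult.assoc)
  qed
  then have "\<exists>C N. \<forall>\<psi>\<in>torus_smooth. norm (tdistr c \<psi>) \<le> C * (\<Sum>\<beta> | msize \<beta> \<le> N. (SUP x. norm (mpartial \<beta> \<psi> x)))"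
    by blast
  moreover have "tdistr c (\<lambda>x. \<psi> x + \<eta> x) = tdistr c \<psi> + tdistr c \<eta>" if "\<psi> \<in> torus_smooth" "\<eta> \<in> torus_smooth" for \<psi> \<eta>
    using that by (simp add: tdistr_def torus_smooth_add distrib_left torus_smooth_integrable sum.distrib)
  moreover have "tdistr c (\<lambda>x. k * \<psi> x) = k * tdistr c \<psi>" if "\<psi> \<in> torus_smooth" for k \<psi>
    using that by (simp add: tdistr_def torus_smooth_cmult sum_distrib_left mult.left_commute[of _ k])
  ultimately show ?thesis by (simp add: torus_distr_def tdistr_def)
qed

lemma integral_chr_chr:
  "(LINT x|torus. chr m x * chr (- n) x) = (if m = n then of_real ((2 * pi) ^ CARD('d)) else 0)"
  for m n :: "int ^ 'd::finite"
  using integral_chr[of "m - n"] chr_add[of m "- n"] by simp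

lemma fourier_tdistr [simp]:
  assumes "finite {n. c n \<noteq> 0}"
  shows "fourier (tdistr c) n = c n"
proof -
  have "tdistr c (chr (- n)) = (\<Sum>m | c m \<noteq> 0. if m = n then c n * of_real ((2 * pi) ^ CARD('a)) else 0)"
    by (simp add: tdistr_def integral_chr_chr if_distrib cong: if_cong)
  also have "\<dots> = c n * of_real ((2 * pi) ^ CARD('a))"
    using assms by (subst sum.delta) auto
  finally show ?thesis by (simp add: fourier_def)
qed

lemma tdistr_plus:
  assumes "finite {n. c n \<noteq> 0}" "\<And>n. c n \<noteq> 0 \<Longrightarrow> n \<in> nonneg_lat"
  shows "tdistr c \<in> torus_distr_plus"
  using assms tdistr_in_distr by (auto simp: torus_distr_plus_def)

lemma infsum_finite_support:
  fixes f :: "'a \<Rightarrow> complex"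
  assumes "finite S" "\<And>n. n \<notin> S \<Longrightarrow> f n = 0"
  shows "(\<Sum>\<^sub>\<infinity>n. f n) = (\<Sum>n\<in>S. f n)"
proof -
  have "(\<Sum>\<^sub>\<infinity>n. f n) = (\<Sum>\<^sub>\<infinity>n\<in>S. f n)"
    by (rule infsum_cong_neutral) (use assms in auto)
  then show ?thesis using assms by simp
qed

lemma quant_tdistr:
  assumes fin: "finite {n. c n \<noteq> 0}"
  shows "quant (\<lambda>x. a) (tdistr c) = tdistr (\<lambda>n. a n * c n)"
proof
  fix \<psi>
  show "quant (\<lambda>x. a) (tdistr c) \<psi> = tdistr (\<lambda>n. a n * c n) \<psi>"
  proof (cases "\<psi> \<in> torus_smooth")
    case True
    have "quant (\<lambda>x. a) (tdistr c) \<psi> = (\<Sum>\<^sub>\<infinity>n. a n * c n * (LINT x|torus. chr n x * \<psi> x))"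
    proof -
      have "(LINT x|torus. a n * chr n x * \<psi> x) = a n * (LINT x|torus. chr n x * \<psi> x)" for n
        by (simp add: mult.assoc)
      then show ?thesis using True fin by (simp add: quant_def mult_ac)
    qed
    also have "\<dots> = (\<Sum>n | a n * c n \<noteq> 0. a n * c n * (LINT x|torus. chr n x * \<psi> x))"
      by (rule infsum_finite_support) (auto intro: finite_subset[OF _ fin])
    finally show ?thesis using True by (simp add: tdistr_def)
  qed (simp add: quant_def tdistr_def)
qed

lemma lp_block_tdistr:
  assumes fin: "finite {n. c n \<noteq> 0}"
  shows "lp_block \<phi>\<^sub>0 \<phi> j (tdistr c) x = tpoly (\<lambda>n. lp_cutoff \<phi>\<^sub>0 \<phi> j (lat n) * c n) x"
  unfolding lp_block_def tpoly_def fourier_tdistr[OF fin]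
  by (rule infsum_finite_support) (auto intro: finite_subset[OF _ fin])

section \<open>Holomorphic extensions\<close>

text \<open>The condition in the definition of \<open>hol_polydisc\<close>, at a single point.\<close>

definition complex_differentiable_at :: "(complex ^ 'd \<Rightarrow> complex) \<Rightarrow> complex ^ 'd \<Rightarrow> bool" where
  "complex_differentiable_at f z \<longleftrightarrow> (\<exists>f'. (f has_derivative f') (at z) \<and> (\<forall>c v. f' (c *s v) = c * f' v))"

lemma complex_differentiable_const: "complex_differentiable_at (\<lambda>z. c) z"
  unfolding complex_differentiable_at_def by (intro exI[of _ "\<lambda>v. 0"]) auto

lemma complex_differentiable_nth: "complex_differentiable_at (\<lambda>z. z $ j) z"
  unfolding complex_differentiable_at_def
  by (intro exI[of _ "\<lambda>v. v $ j"]) (auto intro!: bounded_linear_imp_has_derivative bounded_linear_vec_nth)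

lemma complex_differentiable_mult:
  assumes "complex_differentiable_at f z" "complex_differentiable_at g z"
  shows "complex_differentiable_at (\<lambda>z. f z * g z) z"
proof -
  from assms obtain f' g' where "(f has_derivative f') (at z)" "\<forall>c v. f' (c *s v) = c * f' v"
    "(g has_derivative g') (at z)" "\<forall>c v. g' (c *s v) = c * g' v"
    unfolding complex_differentiable_at_def by blast
  then show ?thesis unfolding complex_differentiable_at_def
    by (intro exI[of _ "\<lambda>v. f z * g' v + f' v * g z"] conjI has_derivative_mult)
       (auto simp: algebra_simps)
qed

lemma complex_differentiable_add:
  assumes "complex_differentiable_at f z" "complex_differentiable_at g z"
  shows "complex_differentiable_at (\<lambda>z. f z + g z) z"
proof -
  from assms obtain f' g' where "(f has_derivative f') (at z)" "\<forall>c v. f' (c *s v) = c * f' v"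
    "(g has_derivative g') (at z)" "\<forall>c v. g' (c *s v) = c * g' v"
    unfolding complex_differentiable_at_def by blast
  then show ?thesis unfolding complex_differentiable_at_def
    by (intro exI[of _ "\<lambda>v. f' v + g' v"] conjI has_derivative_add)
       (auto simp: algebra_simps)
qed

lemma complex_differentiable_power:
  "complex_differentiable_at f z \<Longrightarrow> complex_differentiable_at (\<lambda>z. f z ^ n) z"
  by (induction n) (auto intro: complex_differentiable_const complex_differentiable_mult)

lemma complex_differentiable_prod:
  "(\<And>i. i \<in> I \<Longrightarrow> complex_differentiable_at (f i) z) \<Longrightarrow> complex_differentiable_at (\<lambda>z. \<Prod>i\<in>I. f i z) z"
  by (induction I rule: infinite_finite_induct) (auto intro: complex_differentiable_const complex_differentiable_mult)

lemma complex_differentiable_sum: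
  "(\<And>i. i \<in> I \<Longrightarrow> complex_differentiable_at (f i) z) \<Longrightarrow> complex_differentiable_at (\<lambda>z. \<Sum>i\<in>I. f i z) z"
  by (induction I rule: infinite_finite_induct) (auto intro: complex_differentiable_const complex_differentiable_add)

lemma open_polydisc: "open (polydisc :: (complex ^ 'd::finite) set)"
proof -
  have "polydisc = (\<Inter>j. {z :: complex ^ 'd. norm (z $ j) < 1})" by (auto simp: polydisc_def)
  also have "open \<dots>" by (intro open_INT ballI open_Collect_less continuous_intros) auto
  finally show ?thesis .
qed

definition hpoly :: "(int ^ 'd \<Rightarrow> complex) \<Rightarrow> complex ^ 'd \<Rightarrow> complex" where
  "hpoly c z = (if z \<in> polydisc then (\<Sum>n | c n \<noteq> 0. c n * mpow z n) else 0)"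

lemma hpoly_in_hol: "hpoly c \<in> hol_polydisc"
proof -
  have "\<exists>f'. (hpoly c has_derivative f') (at z) \<and> (\<forall>k v. f' (k *s v) = k * f' v)" if z: "z \<in> polydisc" for z
  proof -
    have "complex_differentiable_at (\<lambda>z. \<Sum>n | c n \<noteq> 0. c n * mpow z n) z"
      unfolding mpow_def
      by (intro complex_differentiable_sum complex_differentiable_mult complex_differentiable_const
          complex_differentiable_prod complex_differentiable_power complex_differentiable_nth)
    then obtain f' where f': "((\<lambda>z. \<Sum>n | c n \<noteq> 0. c n * mpow z n) has_derivative f') (at z)" "\<forall>k v. f' (k *s v) = k * f' v"
      unfolding complex_differentiable_at_def by blast
    have "(hpoly c has_derivative f') (at z)"
      by (rule has_derivative_transform_within_open[OF f'(1) open_polydisc z]) (simp add: hpoly_def)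
    with f'(2) show ?thesis by blast
  qed
  then show ?thesis by (auto simp: hol_polydisc_def hpoly_def)
qed

lemma has_sum_finite_support:
  fixes f :: "'a \<Rightarrow> complex"
  assumes "finite S" "S \<subseteq> A" "\<And>n. n \<in> A \<Longrightarrow> n \<notin> S \<Longrightarrow> f n = 0"
  shows "(f has_sum (\<Sum>n\<in>S. f n)) A"
  using has_sum_finite[OF assms(1), of f] by (subst has_sum_cong_neutral[where T = S and g = f]) (use assms in auto)

lemma hpoly_boundary_value:
  fixes c :: "int ^ 'd::finite \<Rightarrow> complex"
  assumes "finite {n. c n \<noteq> 0}" "\<And>n. c n \<noteq> 0 \<Longrightarrow> n \<in> nonneg_lat"
  shows "has_boundary_value (hpoly c) (tdistr c)"
  unfolding has_boundary_value_def
proof (intro conjI hpoly_in_hol tdistr_in_distr exI[of _ c] ballI)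
  fix z :: "complex ^ 'd" assume "z \<in> polydisc"
  then show "((\<lambda>n. c n * mpow z n) has_sum hpoly c z) nonneg_lat"
    unfolding hpoly_def by simp (rule has_sum_finite_support, use assms in auto)
next
  fix \<psi> :: "real ^ 'd \<Rightarrow> complex" assume "\<psi> \<in> torus_smooth"
  then show "((\<lambda>n. c n * (LINT x|torus. chr n x * \<psi> x)) has_sum tdistr c \<psi>) nonneg_lat"
    unfolding tdistr_def by simp (rule has_sum_finite_support, use assms in auto)
qed

lemma boundary_coeff:
  fixes c :: "int ^ 'd::finite \<Rightarrow> complex"
  assumes "((\<lambda>n. c n * (LINT x|torus. chr n x * chr (- m) x)) has_sum u (chr (- m))) nonneg_lat" "m \<in> nonneg_lat"
  shows "c m = fourier u m"
proof -
  have "((\<lambda>n. c n * (LINT x|torus. chr n x * chr (- m) x)) has_sum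
      (\<Sum>n\<in>{m}. c n * (LINT x|torus. chr n x * chr (- m) x))) nonneg_lat"
    by (rule has_sum_finite_support) (use assms in \<open>auto simp: integral_chr_chr\<close>)
  from has_sum_unique[OF assms(1) this] show ?thesis
    by (simp add: integral_chr_chr fourier_def)
qed

lemma boundary_value_determines_function:
  assumes "has_boundary_value f u" "has_boundary_value g u"
  shows "f = g"
proof -
  from assms obtain c e where hol: "f \<in> hol_polydisc" "g \<in> hol_polydisc"
    and f: "\<And>z. z \<in> polydisc \<Longrightarrow> ((\<lambda>n. c n * mpow z n) has_sum f z) nonneg_lat"
    and g: "\<And>z. z \<in> polydisc \<Longrightarrow> ((\<lambda>n. e n * mpow z n) has_sum g z) nonneg_lat"
    and u: "\<And>\<psi>. \<psi> \<in> torus_smooth \<Longrightarrow> ((\<lambda>n. c n * (LINT x|torus. chr n x * \<psi> x)) has_sum u \<psi>) nonneg_lat"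
      "\<And>\<psi>. \<psi> \<in> torus_smooth \<Longrightarrow> ((\<lambda>n. e n * (LINT x|torus. chr n x * \<psi> x)) has_sum u \<psi>) nonneg_lat"
    unfolding has_boundary_value_def by blast
  have eq: "c m = e m" if "m \<in> nonneg_lat" for m
    using boundary_coeff[of c m u] boundary_coeff[of e m u] u that by simp
  show ?thesis
  proof
    fix z
    show "f z = g z"
    proof (cases "z \<in> polydisc")
      case True
      have "((\<lambda>n. c n * mpow z n) has_sum g z) nonneg_lat"
        using g[OF True] by (subst has_sum_cong[where g = "\<lambda>n. e n * mpow z n"]) (auto simp: eq)
      with f[OF True] show ?thesis by (rule has_sum_unique)
    qed (use hol in \<open>auto simp: hol_polydisc_def\<close>)
  qed
qed

text \<open>On the torus of radius \<open>1 / 2\<close> the power series is an absolutely convergent Fourier series,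
  so its coefficients are integrals of partial sums up to an arbitrarily small error.\<close>

lemma power_series_zero:
  fixes e :: "int ^ 'd::finite \<Rightarrow> complex"
  assumes zero: "\<And>z. z \<in> polydisc \<Longrightarrow> ((\<lambda>n. e n * mpow z n) has_sum 0) nonneg_lat" and m: "m \<in> nonneg_lat"
  shows "e m = 0"
proof -
  \<comment> \<open>The monomials on the torus of radius one half are \<open>w n * chr n x\<close>.\<close>
  define w where "w = (\<lambda>n :: int ^ 'd. (\<Prod>j\<in>UNIV. (1 / 2 :: complex) ^ nat (n $ j)))"
  define E where "E = (\<lambda>n. e n * w n)"
  have E: "((\<lambda>n. E n * chr n x) has_sum 0) nonneg_lat" for x
  proof -
    define z :: "complex ^ 'd" where "z = (\<chi> j. 1 / 2 * exp (\<i> * of_real (x $ j)))"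
    have "z \<in> polydisc" by (simp add: z_def polydisc_def norm_mult)
    from zero[OF this] have "((\<lambda>n. e n * mpow z n) has_sum 0) nonneg_lat" .
    moreover have "e n * mpow z n = E n * chr n x" if "n \<in> nonneg_lat" for n
    proof -
      have "(exp (\<i> * of_real (x $ j))) ^ nat (n $ j) = exp (\<i> * of_real (real_of_int (n $ j) * x $ j))" for j
      proof -
        have "0 \<le> n $ j" using that by (simp add: nonneg_lat_def)
        have "(exp (\<i> * of_real (x $ j))) ^ nat (n $ j) = exp (of_nat (nat (n $ j)) * (\<i> * of_real (x $ j)))"
          by (rule exp_of_nat_mult[symmetric])
        also have "of_nat (nat (n $ j)) = complex_of_real (real_of_int (n $ j))"
          using \<open>0 \<le> n $ j\<close> by simp
        finally show ?thesis by (simp add: mult_ac)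
      qed
      then show ?thesis
        unfolding mpow_def E_def w_def z_def chr_prod vec_lambda_beta power_mult_distrib prod.distrib by simp
    qed
    ultimately show ?thesis by (subst has_sum_cong[where g = "\<lambda>n. e n * mpow z n"]) auto
  qed
  have "(\<lambda>n. E n) summable_on nonneg_lat"
    using has_sum_imp_summable[OF E[of 0]] by simp
  then have abs: "(\<lambda>n. norm (E n)) summable_on nonneg_lat"
    by (simp add: summable_on_iff_abs_summable_on_complex)
  have "norm (E m) \<le> \<epsilon>" if "\<epsilon> > 0" for \<epsilon>
  proof -
    let ?T = "\<Sum>\<^sub>\<infinity>n\<in>nonneg_lat. norm (E n)"
    have "((\<lambda>n. norm (E n)) has_sum ?T) nonneg_lat" using abs by simp
    then have "\<forall>\<^sub>F F in finite_subsets_at_top nonneg_lat. dist (\<Sum>n\<in>F. norm (E n)) ?T < \<epsilon>"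
      unfolding has_sum_def using \<open>\<epsilon> > 0\<close> by (rule tendstoD)
    then have "\<exists>F0. finite F0 \<and> F0 \<subseteq> nonneg_lat \<and>
        (\<forall>F. finite F \<and> F0 \<subseteq> F \<and> F \<subseteq> nonneg_lat \<longrightarrow> dist (\<Sum>n\<in>F. norm (E n)) ?T < \<epsilon>)"
      by (simp only: eventually_finite_subsets_at_top)
    then obtain F0 where F0: "finite F0" "F0 \<subseteq> nonneg_lat"
      "\<forall>F. finite F \<and> F0 \<subseteq> F \<and> F \<subseteq> nonneg_lat \<longrightarrow> dist (\<Sum>n\<in>F. norm (E n)) ?T < \<epsilon>"
      by (elim exE conjE)
    define F where "F = insert m F0"
    have F: "finite F" "F \<subseteq> nonneg_lat" "m \<in> F" "dist (\<Sum>n\<in>F. norm (E n)) ?T < \<epsilon>"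
      using F0(1,2) m F0(3)[rule_format, of "insert m F0"] by (auto simp: F_def)
    have tail: "norm (\<Sum>n\<in>F. E n * chr n x) \<le> \<epsilon>" for x
    proof -
      have "((\<lambda>n. E n * chr n x) has_sum 0 - (\<Sum>n\<in>F. E n * chr n x)) (nonneg_lat - F)"
        by (rule has_sum_Diff[OF E has_sum_finite]) (use F in auto)
      moreover have "((\<lambda>n. norm (E n)) has_sum ?T - (\<Sum>n\<in>F. norm (E n))) (nonneg_lat - F)"
        by (rule has_sum_Diff[OF _ has_sum_finite]) (use F abs in auto)
      then have "((\<lambda>n. norm (E n * chr n x)) has_sum ?T - (\<Sum>n\<in>F. norm (E n))) (nonneg_lat - F)"
        by (simp add: norm_mult)
      ultimately have "norm (0 - (\<Sum>n\<in>F. E n * chr n x)) \<le> ?T - (\<Sum>n\<in>F. norm (E n))"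
        by (intro norm_has_sum_bound)
      then show ?thesis using F(4) by (simp add: dist_real_def)
    qed
    have "E m * of_real ((2 * pi) ^ CARD('d)) = (LINT x|torus. (\<Sum>n\<in>F. E n * chr n x) * chr (- m) x)"
    proof -
      have "(LINT x|torus. (\<Sum>n\<in>F. E n * chr n x) * chr (- m) x) = (LINT x|torus. (\<Sum>n\<in>F. E n * (chr n x * chr (- m) x)))"
        by (simp add: sum_distrib_right mult.assoc)
      also have "\<dots> = (\<Sum>n\<in>F. E n * (LINT x|torus. chr n x * chr (- m) x))"
        by (subst Bochner_Integration.integral_sum) (auto intro!: integrable_torus continuous_intros)
      also have "\<dots> = (\<Sum>n\<in>F. if n = m then E m * of_real ((2 * pi) ^ CARD('d)) else 0)"
        by (intro sum.cong) (auto simp: integral_chr_chr)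
      also have "\<dots> = E m * of_real ((2 * pi) ^ CARD('d))" using F by simp
      finally show ?thesis by simp
    qed
    also have "norm \<dots> \<le> (LINT x|torus. norm ((\<Sum>n\<in>F. E n * chr n x) * chr (- m) x))"
      by (rule integral_norm_bound)
    also have "\<dots> \<le> (LINT x|(torus :: (real ^ 'd) measure). \<epsilon>)"
    proof (rule integral_mono)
      interpret finite_measure "torus :: (real ^ 'd) measure" by (rule finite_measure_torus)
      show "integrable (torus :: (real ^ 'd) measure) (\<lambda>x. \<epsilon>)" by simp
    qed (auto simp: norm_mult tail intro!: integrable_norm integrable_torus continuous_intros)
    also have "\<dots> = \<epsilon> * (2 * pi) ^ CARD('d)" by (simp add: measure_torus)
    finally have "norm (E m) * (2 * pi) ^ CARD('d) \<le> \<epsilon> * (2 * pi) ^ CARD('d)"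
      by (simp add: norm_mult norm_power)
    then show ?thesis by (rule mult_right_le_imp_le) simp
  qed
  then have "norm (E m) \<le> 0" by (rule field_le_epsilon) simp
  then have "E m = 0" by simp
  moreover have "w m \<noteq> 0" by (simp add: w_def)
  ultimately show ?thesis by (simp add: E_def)
qed

lemma function_determines_boundary_value:
  assumes "has_boundary_value f u" "has_boundary_value f v"
  shows "u = v"
proof -
  from assms obtain c e where distr: "u \<in> torus_distr" "v \<in> torus_distr"
    and f: "\<And>z. z \<in> polydisc \<Longrightarrow> ((\<lambda>n. c n * mpow z n) has_sum f z) nonneg_lat"
      "\<And>z. z \<in> polydisc \<Longrightarrow> ((\<lambda>n. e n * mpow z n) has_sum f z) nonneg_lat"
    and u: "\<And>\<psi>. \<psi> \<in> torus_smooth \<Longrightarrow> ((\<lambda>n. c n * (LINT x|torus. chr n x * \<psi> x)) has_sum u \<psi>) nonneg_lat"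
    and v: "\<And>\<psi>. \<psi> \<in> torus_smooth \<Longrightarrow> ((\<lambda>n. e n * (LINT x|torus. chr n x * \<psi> x)) has_sum v \<psi>) nonneg_lat"
    unfolding has_boundary_value_def by blast
  have "((\<lambda>n. (c n - e n) * mpow z n) has_sum 0) nonneg_lat" if "z \<in> polydisc" for z
    using has_sum_add[OF f(1)[OF that] has_sum_uminusI[OF f(2)[OF that]]] by (simp add: algebra_simps)
  then have eq: "c m = e m" if "m \<in> nonneg_lat" for m
    using power_series_zero[of "\<lambda>n. c n - e n" m] that by simp
  show ?thesis
  proof
    fix \<psi>
    show "u \<psi> = v \<psi>"
    proof (cases "\<psi> \<in> torus_smooth")
      case True
      have "((\<lambda>n. c n * (LINT x|torus. chr n x * \<psi> x)) has_sum v \<psi>) nonneg_lat"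
        using v[OF True] by (subst has_sum_cong[where g = "\<lambda>n. e n * (LINT x|torus. chr n x * \<psi> x)"]) (auto simp: eq)
      with u[OF True] show ?thesis by (rule has_sum_unique)
    qed (use distr in \<open>auto simp: torus_distr_def\<close>)
  qed
qed

lemma boundary_value_eq: "has_boundary_value f u \<Longrightarrow> boundary_value f = u"
  unfolding boundary_value_def using function_determines_boundary_value by blast

lemma hol_extension_eq: "has_boundary_value f u \<Longrightarrow> hol_extension u = f"
  unfolding hol_extension_def using boundary_value_determines_function by blast

text \<open>What remains of the boundedness of a Fourier multiplier, on the torus and on the polydisc
  alike, when it is tested on analytic trigonometric polynomials.\<close>

definition tpoly_bounded where
  "tpoly_bounded a N\<^sub>1 N\<^sub>2 \<longleftrightarrow> (\<exists>C::real. \<forall>c :: int ^ 'd::finite \<Rightarrow> complex.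
     finite {n. c n \<noteq> 0} \<longrightarrow> (\<forall>n. c n \<noteq> 0 \<longrightarrow> n \<in> nonneg_lat) \<longrightarrow> N\<^sub>1 (tdistr c) < \<infinity> \<longrightarrow>
     N\<^sub>2 (tdistr (\<lambda>n. a n * c n)) \<le> ennreal C * N\<^sub>1 (tdistr c))"

lemma bounded_imp_tpoly_bounded:
  fixes a :: "int ^ 'd::finite \<Rightarrow> complex"
  assumes "bounded_map (quant (\<lambda>x. a)) {u \<in> torus_distr_plus. N\<^sub>1 u < \<infinity>} N\<^sub>1 Y N\<^sub>2"
  shows "tpoly_bounded a N\<^sub>1 N\<^sub>2"
proof -
  from assms obtain C :: real where C: "\<And>u. u \<in> torus_distr_plus \<Longrightarrow> N\<^sub>1 u < \<infinity> \<Longrightarrow> N\<^sub>2 (quant (\<lambda>x. a) u) \<le> ennreal C * N\<^sub>1 u"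
    unfolding bounded_map_def by auto
  show ?thesis unfolding tpoly_bounded_def
    using C[OF tdistr_plus] quant_tdistr[of _ a] by (intro exI[of _ C]) auto
qed

text \<open>For trigonometric polynomials the boundary value and the holomorphic extension are explicit,
  and by uniqueness they are the ones chosen in the definition of \<open>hol_quant\<close>.\<close>

lemma hol_bounded_imp_tpoly_bounded:
  fixes a :: "int ^ 'd::finite \<Rightarrow> complex"
  assumes "bounded_map (hol_quant (\<lambda>x. a)) {f. \<exists>u\<in>{u \<in> torus_distr_plus. N\<^sub>1 u < \<infinity>}. has_boundary_value f u} (\<lambda>f. N\<^sub>1 (boundary_value f))
     Y (\<lambda>f. N\<^sub>2 (boundary_value f))"
  shows "tpoly_bounded a N\<^sub>1 N\<^sub>2"
proof -
  from assms obtain C :: real where C: "\<And>f u. u \<in> torus_distr_plus \<Longrightarrow> N\<^sub>1 u < \<infinity> \<Longrightarrow> has_boundary_value f u \<Longrightarrow>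
      N\<^sub>2 (boundary_value (hol_quant (\<lambda>x. a) f)) \<le> ennreal C * N\<^sub>1 (boundary_value f)"
    unfolding bounded_map_def by auto
  show ?thesis unfolding tpoly_bounded_def
  proof (intro exI[of _ C] allI impI)
    fix c :: "int ^ 'd \<Rightarrow> complex"
    assume c: "finite {n. c n \<noteq> 0}" "\<forall>n. c n \<noteq> 0 \<longrightarrow> n \<in> nonneg_lat" and N: "N\<^sub>1 (tdistr c) < \<infinity>"
    have h: "has_boundary_value (hpoly c) (tdistr c)"
      using c by (intro hpoly_boundary_value) auto
    have "finite {n. a n * c n \<noteq> 0}" by (rule finite_subset[OF _ c(1)]) auto
    then have h': "has_boundary_value (hpoly (\<lambda>n. a n * c n)) (tdistr (\<lambda>n. a n * c n))"
      using c by (intro hpoly_boundary_value) auto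
    have "hol_quant (\<lambda>x. a) (hpoly c) = hpoly (\<lambda>n. a n * c n)"
      unfolding hol_quant_def boundary_value_eq[OF h] quant_tdistr[OF c(1)] by (rule hol_extension_eq[OF h'])
    moreover have "tdistr c \<in> torus_distr_plus" using c by (intro tdistr_plus) auto
    ultimately show "N\<^sub>2 (tdistr (\<lambda>n. a n * c n)) \<le> ennreal C * N\<^sub>1 (tdistr c)"
      using C[OF _ N h] by (simp add: boundary_value_eq[OF h] boundary_value_eq[OF h'])
  qed
qed

section \<open>Quasi-norms\<close>

lemma epow_ennreal: "0 \<le> a \<Longrightarrow> epow (ennreal a) r = ennreal (a powr r)"
  by (simp add: epow_def)

lemma epow_0 [simp]: "epow 0 r = 0"
  using epow_ennreal[of 0 r] by simp

lemma epow_mono: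
  assumes "x \<le> y" "0 \<le> r"
  shows "epow x r \<le> epow y r"
proof (cases y)
  case (real b)
  then obtain a where "x = ennreal a" "0 \<le> a" using assms by (cases x) (auto simp: top_unique)
  then show ?thesis using real assms by (auto simp: epow_ennreal intro!: ennreal_leI powr_mono2)
qed (simp add: epow_def)

lemma epow_mult:
  assumes "0 < a"
  shows "epow (ennreal a * x) r = ennreal (a powr r) * epow x r"
proof (cases x)
  case (real b)
  then show ?thesis using assms
    by (simp add: epow_ennreal powr_mult flip: ennreal_mult)
next
  case top
  then show ?thesis using assms by (simp add: epow_def ennreal_mult_top)
qed

text \<open>The reciprocal of an exponent, with value \<open>0\<close> at infinity.\<close>

definition recip :: "ennreal \<Rightarrow> real" where
  "recip q = enn2real (inverse q)"

lemma recip_top [simp]: "recip top = 0"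
  by (simp add: recip_def)

lemma finite_exponent:
  assumes "0 < q" "q \<noteq> \<infinity>"
  shows "0 < enn2real q" "recip q = 1 / enn2real q" "q = ennreal (enn2real q)"
proof -
  obtain r where r: "q = ennreal r" "0 < r" using assms by (cases q) auto
  then show "0 < enn2real q" "recip q = 1 / enn2real q" "q = ennreal (enn2real q)"
    by (auto simp: recip_def inverse_ennreal divide_inverse)
qed

lemma lq_upper:
  fixes e :: "nat \<Rightarrow> ennreal"
  assumes "0 < q" and I: "finite I" "real (card I) \<le> N" and "0 \<le> D"
    and e: "\<And>i. i \<in> I \<Longrightarrow> e i \<le> ennreal D" "\<And>i. i \<notin> I \<Longrightarrow> e i = 0"
    and "1 \<le> N"
  shows "Lp_qnorm (count_space UNIV) q e \<le> ennreal (D * N powr recip q)"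
proof (cases "q = \<infinity>")
  case True
  have "e i \<le> ennreal D" for i using e by (cases "i \<in> I") auto
  then have "esssup (count_space UNIV) e \<le> ennreal D" by (intro esssup_I) auto
  then show ?thesis using True \<open>1 \<le> N\<close> by (simp add: Lp_qnorm_def)
next
  case False
  note q = finite_exponent[OF \<open>0 < q\<close> False]
  let ?r = "enn2real q"
  have "(\<integral>\<^sup>+i. epow (e i) ?r \<partial>count_space UNIV) = (\<Sum>i\<in>I. epow (e i) ?r)"
    by (rule nn_integral_count_space') (use I e in auto)
  also have "\<dots> \<le> (\<Sum>i\<in>I. ennreal (D powr ?r))"
    using e(1) epow_mono[of _ "ennreal D" ?r] q \<open>0 \<le> D\<close> by (intro sum_mono) (auto simp: epow_ennreal)
  also have "\<dots> = ennreal (real (card I) * D powr ?r)"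
    by (simp add: ennreal_of_nat_eq_real_of_nat ennreal_mult)
  also have "\<dots> \<le> ennreal (N * D powr ?r)"
    using I by (intro ennreal_leI mult_right_mono) auto
  finally have "Lp_qnorm (count_space UNIV) q e \<le> epow (ennreal (N * D powr ?r)) (1 / ?r)"
    using False q by (simp add: Lp_qnorm_def epow_mono)
  also have "\<dots> = ennreal (D * N powr recip q)"
    using q \<open>0 \<le> D\<close> \<open>1 \<le> N\<close> by (simp add: epow_ennreal powr_mult powr_powr mult.commute)
  finally show ?thesis .
qed

lemma lq_lower:
  fixes e :: "nat \<Rightarrow> ennreal"
  assumes "0 < q" and J: "finite J" "J \<noteq> {}" and "0 \<le> D"
    and e: "\<And>j. j \<in> J \<Longrightarrow> ennreal D \<le> e j"
  shows "ennreal (D * real (card J) powr recip q) \<le> Lp_qnorm (count_space UNIV) q e"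
proof (cases "q = \<infinity>")
  case True
  have card: "card J \<noteq> 0" using J by auto
  obtain j where j: "j \<in> J" using J by blast
  have "ennreal D \<le> e j" using e j by blast
  also have "e j \<le> esssup (count_space UNIV) e"
    using esssup_AE[of e "count_space UNIV"] by (simp add: AE_count_space)
  finally show ?thesis using True card by (simp add: Lp_qnorm_def)
next
  case False
  note q = finite_exponent[OF \<open>0 < q\<close> False]
  let ?r = "enn2real q"
  have "ennreal (real (card J) * D powr ?r) = (\<Sum>i\<in>J. ennreal (D powr ?r))"
    by (simp add: ennreal_of_nat_eq_real_of_nat ennreal_mult)
  also have "\<dots> \<le> (\<Sum>i\<in>J. epow (e i) ?r)"
    using e epow_mono[of "ennreal D" _ ?r] q \<open>0 \<le> D\<close> by (intro sum_mono) (auto simp: epow_ennreal)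
  also have "\<dots> = (\<integral>\<^sup>+i. epow (e i) ?r * indicator J i \<partial>count_space UNIV)"
    by (subst nn_integral_count_space'[where A = J]) (use J in auto)
  also have "\<dots> \<le> (\<integral>\<^sup>+i. epow (e i) ?r \<partial>count_space UNIV)"
    by (intro nn_integral_mono) (auto simp: indicator_def)
  finally have "epow (ennreal (real (card J) * D powr ?r)) (1 / ?r) \<le> Lp_qnorm (count_space UNIV) q e"
    using False q by (simp add: Lp_qnorm_def epow_mono)
  also have "epow (ennreal (real (card J) * D powr ?r)) (1 / ?r) = ennreal (D * real (card J) powr recip q)"
    using q \<open>0 \<le> D\<close> by (simp add: epow_ennreal powr_mult powr_powr mult.commute)
  finally show ?thesis .
qed

definition Lnorm :: "ennreal \<Rightarrow> (real ^ 'd \<Rightarrow> real) \<Rightarrow> ennreal" where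
  "Lnorm p G = Lp_qnorm torus p (\<lambda>x. ennreal (G x))"

lemma Lp_qnorm_mono:
  assumes "f \<in> borel_measurable M \<or> p \<noteq> \<infinity>" "\<And>x. f x \<le> g x"
  shows "Lp_qnorm M p f \<le> Lp_qnorm M p g"
proof (cases "p = \<infinity>")
  case True
  then show ?thesis using assms by (simp add: Lp_qnorm_def esssup_mono)
next
  case False
  then show ?thesis using assms
    by (auto simp: Lp_qnorm_def intro!: epow_mono nn_integral_mono)
qed

lemma measurable_ennreal_torus:
  "continuous_on UNIV G \<Longrightarrow> (\<lambda>x. ennreal (G x)) \<in> borel_measurable (torus :: (real ^ 'd::finite) measure)"
  by (intro measurable_compose[OF borel_measurable_torus]) auto

lemma Lnorm_mono:
  assumes "continuous_on UNIV G" "\<And>x. G x \<le> H x"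
  shows "Lnorm p G \<le> Lnorm p H"
  unfolding Lnorm_def using assms by (intro Lp_qnorm_mono ennreal_leI disjI1 measurable_ennreal_torus)

lemma Lnorm_scale_le:
  fixes G :: "real ^ 'd::finite \<Rightarrow> real"
  assumes cont: "continuous_on UNIV G" and nn: "\<And>x. 0 \<le> G x" and "0 < c" "0 < p"
  shows "Lnorm p (\<lambda>x. c * G x) \<le> ennreal c * Lnorm p G"
proof (cases "p = \<infinity>")
  case True
  have "esssup torus (\<lambda>x. ennreal (c * G x)) \<le> ennreal c * esssup torus (\<lambda>x. ennreal (G x))"
  proof (rule esssup_I)
    show "(\<lambda>x. ennreal (c * G x)) \<in> borel_measurable torus"
      by (intro measurable_ennreal_torus continuous_intros cont)
    show "AE x in torus. ennreal (c * G x) \<le> ennreal c * esssup torus (\<lambda>x. ennreal (G x))"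
      using esssup_AE[of "\<lambda>x. ennreal (G x)" torus]
      by eventually_elim (use \<open>0 < c\<close> in \<open>simp add: ennreal_mult' mult_left_mono\<close>)
  qed
  then show ?thesis using True by (simp add: Lnorm_def Lp_qnorm_def)
next
  case False
  note p = finite_exponent[OF \<open>0 < p\<close> False]
  let ?r = "enn2real p"
  have cont': "continuous_on UNIV (\<lambda>x. G x powr ?r)"
    using cont nn p by (intro continuous_on_powr') auto
  have "(\<integral>\<^sup>+x. epow (ennreal (c * G x)) ?r \<partial>torus) = (\<integral>\<^sup>+x. ennreal (c powr ?r) * ennreal (G x powr ?r) \<partial>torus)"
    using nn \<open>0 < c\<close> by (intro nn_integral_cong) (simp add: ennreal_mult' epow_mult epow_ennreal)
  also have "\<dots> = ennreal (c powr ?r) * (\<integral>\<^sup>+x. ennreal (G x powr ?r) \<partial>torus)"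
    by (rule nn_integral_cmult) (rule measurable_ennreal_torus[OF cont'])
  also have "(\<integral>\<^sup>+x. ennreal (G x powr ?r) \<partial>torus) = (\<integral>\<^sup>+x. epow (ennreal (G x)) ?r \<partial>torus)"
    using nn by (simp add: epow_ennreal)
  finally show ?thesis
    using False p \<open>0 < c\<close> by (simp add: Lnorm_def Lp_qnorm_def epow_mult powr_powr)
qed

lemma Lnorm_scale:
  fixes G :: "real ^ 'd::finite \<Rightarrow> real"
  assumes cont: "continuous_on UNIV G" and nn: "\<And>x. 0 \<le> G x" and "0 < c" "0 < p"
  shows "Lnorm p (\<lambda>x. c * G x) = ennreal c * Lnorm p G"
proof (rule antisym)
  have "Lnorm p (\<lambda>x. 1 / c * (c * G x)) \<le> ennreal (1 / c) * Lnorm p (\<lambda>x. c * G x)"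
    using assms by (intro Lnorm_scale_le continuous_intros) auto
  then have "Lnorm p G \<le> ennreal (1 / c) * Lnorm p (\<lambda>x. c * G x)" using \<open>0 < c\<close> by simp
  then have "ennreal c * Lnorm p G \<le> ennreal c * (ennreal (1 / c) * Lnorm p (\<lambda>x. c * G x))"
    by (rule mult_left_mono) simp
  also have "\<dots> = Lnorm p (\<lambda>x. c * G x)"
    using \<open>0 < c\<close> by (simp add: mult.assoc[symmetric] ennreal_mult''[symmetric])
  finally show "ennreal c * Lnorm p G \<le> Lnorm p (\<lambda>x. c * G x)" .
qed (rule Lnorm_scale_le[OF assms])

lemma Lnorm_zero [simp]: "0 < p \<Longrightarrow> Lnorm p (\<lambda>x :: real ^ 'd::finite. 0) = 0"
proof (cases "p = \<infinity>")
  case True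
  have "esssup (torus :: (real ^ 'd) measure) (\<lambda>x. 0 :: ennreal) \<le> 0" by (rule esssup_I) auto
  then show ?thesis using True by (simp add: Lnorm_def Lp_qnorm_def)
next
  case False
  assume "0 < p"
  with False show ?thesis by (simp add: Lnorm_def Lp_qnorm_def)
qed

section \<open>Littlewood--Paley blocks of trigonometric polynomials\<close>

text \<open>The absolute value of the Littlewood--Paley block number \<open>i\<close> of the trigonometric polynomial
  with coefficients \<open>v\<close>.\<close>

definition lp_size where
  "lp_size \<phi>\<^sub>0 \<phi> i v x = norm (tpoly (\<lambda>n. lp_cutoff \<phi>\<^sub>0 \<phi> i (lat n) * v n) x)"

lemma continuous_on_lp_size: "continuous_on S (lp_size \<phi>\<^sub>0 \<phi> i v)"
proof -
  have "lp_size \<phi>\<^sub>0 \<phi> i v = (\<lambda>x. norm (tpoly (\<lambda>n. lp_cutoff \<phi>\<^sub>0 \<phi> i (lat n) * v n) x))"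
    by (simp add: lp_size_def[abs_def])
  then show ?thesis by (simp add: continuous_intros)
qed

lemma lp_size_nonneg [simp]: "0 \<le> lp_size \<phi>\<^sub>0 \<phi> i v x"
  by (simp add: lp_size_def)

lemma besov_tdistr:
  assumes "finite {n. c n \<noteq> 0}"
  shows "besov_qnorm \<phi>\<^sub>0 \<phi> s p q (tdistr c) =
     Lp_qnorm (count_space UNIV) q (\<lambda>i. ennreal (2 powr (real i * s)) * Lnorm p (lp_size \<phi>\<^sub>0 \<phi> i c))"
  unfolding besov_qnorm_def Lnorm_def lp_size_def by (simp add: lp_block_tdistr[OF assms])

lemma tl_tdistr:
  assumes "finite {n. c n \<noteq> 0}"
  shows "tl_qnorm \<phi>\<^sub>0 \<phi> s p q (tdistr c) =
     Lp_qnorm torus p (\<lambda>x. Lp_qnorm (count_space UNIV) q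
       (\<lambda>i. ennreal (2 powr (real i * s)) * ennreal (lp_size \<phi>\<^sub>0 \<phi> i c x)))"
  unfolding tl_qnorm_def lp_size_def by (simp add: lp_block_tdistr[OF assms])

lemma lp_size_cong:
  "(\<And>n. lp_cutoff \<phi>\<^sub>0 \<phi> i (lat n) * v n = k * (lp_cutoff \<phi>\<^sub>0 \<phi> i (lat n) * w n)) \<Longrightarrow> 0 < k \<Longrightarrow>
     lp_size \<phi>\<^sub>0 \<phi> i v x = \<bar>k\<bar> * lp_size \<phi>\<^sub>0 \<phi> i w x" for k :: real
proof -
  assume eq: "\<And>n. lp_cutoff \<phi>\<^sub>0 \<phi> i (lat n) * v n = k * (lp_cutoff \<phi>\<^sub>0 \<phi> i (lat n) * w n)" and "0 < k"
  have "tpoly (\<lambda>n. lp_cutoff \<phi>\<^sub>0 \<phi> i (lat n) * v n) x = k * tpoly (\<lambda>n. lp_cutoff \<phi>\<^sub>0 \<phi> i (lat n) * w n) x"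
    unfolding eq tpoly_def using \<open>0 < k\<close> by (simp add: sum_distrib_left mult.assoc)
  then show ?thesis by (simp add: lp_size_def norm_mult)
qed

lemma lp_resolution_support:
  assumes "lp_resolution \<phi>\<^sub>0 \<phi>"
  shows "\<phi>\<^sub>0 \<xi> \<noteq> 0 \<Longrightarrow> norm \<xi> \<le> 2" "\<phi> \<xi> \<noteq> 0 \<Longrightarrow> 1 / 2 \<le> norm \<xi>" "\<phi> \<xi> \<noteq> 0 \<Longrightarrow> norm \<xi> \<le> 2"
  using assms closure_subset[of "{\<xi>. \<phi>\<^sub>0 \<xi> \<noteq> 0}"] closure_subset[of "{\<xi>. \<phi> \<xi> \<noteq> 0}"]
  unfolding lp_resolution_def by blast+

definition annulus :: "nat \<Rightarrow> (int ^ 'd) set" where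
  "annulus j = {n. 7 / 8 * 2 ^ j \<le> norm (lat n) \<and> norm (lat n) \<le> 9 / 8 * 2 ^ j}"

text \<open>The cutoff number \<open>i\<close> lives between the radii \<open>2 ^ (i - 1)\<close> and \<open>2 ^ (i + 1)\<close>. For
  \<open>j \<ge> 3\<close> the low frequency cutoff, number \<open>0\<close>, cannot interfere.\<close>

lemma lp_cutoff_annulus:
  assumes "lp_resolution \<phi>\<^sub>0 \<phi>" "3 \<le> j" "n \<in> annulus j" "lp_cutoff \<phi>\<^sub>0 \<phi> i (lat n) \<noteq> 0"
  shows "i \<in> {j - 1, j, j + 1}"
proof -
  let ?x = "norm (lat n)"
  have x: "7 / 8 * 2 ^ j \<le> ?x" "?x \<le> 9 / 8 * 2 ^ j" using assms(3) by (auto simp: annulus_def)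
  have j: "(8::real) \<le> 2 ^ j" using power_increasing[OF assms(2), of "2::real"] by simp
  show ?thesis
  proof (cases "i = 0")
    case True
    then have "?x \<le> 2" using lp_resolution_support(1)[OF assms(1), of "lat n"] assms(4) by (simp add: lp_cutoff_def)
    then show ?thesis using x j by linarith
  next
    case False
    then have nz: "\<phi> ((1 / 2 ^ i) *\<^sub>R lat n) \<noteq> 0" using assms(4) by (simp add: lp_cutoff_def)
    have i: "2 ^ i / 2 \<le> ?x" "?x \<le> 2 * 2 ^ i"
      using lp_resolution_support(2,3)[OF assms(1) nz] by (simp_all add: field_simps)
    have "\<not> j + 2 \<le> i"
    proof
      assume "j + 2 \<le> i"
      then have "(2::real) ^ (j + 2) \<le> 2 ^ i" by (intro power_increasing) auto
      then show False using i x j by simp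
    qed
    moreover have "\<not> i + 2 \<le> j"
    proof
      assume "i + 2 \<le> j"
      then have "(2::real) ^ (i + 2) \<le> 2 ^ j" by (intro power_increasing) auto
      then show False using i x j by simp
    qed
    ultimately show ?thesis by auto
  qed
qed

section \<open>From extremal blocks to the necessary conditions\<close>

text \<open>A multiplier \<open>a\<close> together with inputs \<open>v j\<close>, at frequencies of size \<open>2 ^ j\<close>, that it
  enlarges in \<open>L\<^sup>p\<close> by at least \<open>2 powr (j * \<mu>)\<close>. The upper bound concerns the sum of the
  absolute values of the three blocks that can be nonzero: this one function dominates the
  Besov and the Triebel--Lizorkin quasi-norm of the input.\<close>

locale extremal =
  fixes \<phi>\<^sub>0 \<phi> :: "real ^ 'd::finite \<Rightarrow> complex" and a :: "int ^ 'd \<Rightarrow> complex"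
    and v :: "nat \<Rightarrow> int ^ 'd \<Rightarrow> complex" and B :: "nat \<Rightarrow> real" and \<gamma> \<mu> :: real and p :: ennreal and j\<^sub>0 :: nat
  assumes res: "lp_resolution \<phi>\<^sub>0 \<phi>" and p_pos: "0 < p" and \<gamma>: "0 < \<gamma>" and j0: "3 \<le> j\<^sub>0"
    and fin: "\<And>j. j\<^sub>0 \<le> j \<Longrightarrow> finite {n. v j n \<noteq> 0}"
    and supp: "\<And>j n. j\<^sub>0 \<le> j \<Longrightarrow> v j n \<noteq> 0 \<Longrightarrow> n \<in> nonneg_lat \<and> n \<in> annulus j"
    and B_pos: "\<And>j. j\<^sub>0 \<le> j \<Longrightarrow> 0 < B j"
    and upper: "\<And>j. j\<^sub>0 \<le> j \<Longrightarrow> Lnorm p (\<lambda>x. \<Sum>i\<in>{j - 1, j, j + 1}. lp_size \<phi>\<^sub>0 \<phi> i (v j) x) \<le> ennreal (B j)"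
    and lower: "\<And>j. j\<^sub>0 \<le> j \<Longrightarrow> ennreal (\<gamma> * 2 powr (real j * \<mu>) * B j) \<le> Lnorm p (lp_size \<phi>\<^sub>0 \<phi> j (\<lambda>n. a n * v j n))"
begin

lemma lp_size_single_le: "i \<in> {j - 1, j, j + 1} \<Longrightarrow> lp_size \<phi>\<^sub>0 \<phi> i w x \<le> (\<Sum>i\<in>{j - 1, j, j + 1}. lp_size \<phi>\<^sub>0 \<phi> i w x)"
  by (rule member_le_sum) auto

lemma lp_size_vanish:
  assumes "j\<^sub>0 \<le> j" "i \<notin> {j - 1, j, j + 1}"
  shows "lp_cutoff \<phi>\<^sub>0 \<phi> i (lat n) * v j n = 0"
  using assms supp[OF assms(1), of n] lp_cutoff_annulus[OF res, of j n i] j0 by (cases "v j n = 0") auto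

lemma weight_le:
  assumes "i \<in> {j - 1, j, j + 1}" "1 \<le> j"
  shows "2 powr (real i * u) \<le> 2 powr \<bar>u\<bar> * 2 powr (real j * u)"
proof -
  have "real i * u - real j * u = (real i - real j) * u" by (simp add: algebra_simps)
  also have "\<dots> \<le> \<bar>real i - real j\<bar> * \<bar>u\<bar>" by (metis abs_ge_self abs_mult)
  also have "\<dots> \<le> 1 * \<bar>u\<bar>" using assms by (intro mult_right_mono) auto
  finally have "real i * u \<le> \<bar>u\<bar> + real j * u" by simp
  then show ?thesis by (simp flip: powr_add)
qed

text \<open>The inputs at the scales in \<open>J\<close> are normalized so that each of their nonzero blocks
  contributes at most a constant to the source quasi-norm. Since the scales are multiples of \<open>4\<close>, no
  block sees two of them, and both quasi-norms are sequence quasi-norms of nearly constant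
  sequences.\<close>

lemma besov_test:
  assumes bd: "tpoly_bounded a (besov_qnorm \<phi>\<^sub>0 \<phi> u p q) (besov_qnorm \<phi>\<^sub>0 \<phi> s p t)" and "0 < q" "0 < t"
  shows "\<exists>C. \<forall>J D. finite J \<longrightarrow> J \<noteq> {} \<longrightarrow> (\<forall>j\<in>J. j\<^sub>0 \<le> j \<and> 4 dvd j) \<longrightarrow> 0 \<le> D \<longrightarrow>
      (\<forall>j\<in>J. D \<le> 2 powr (real j * (\<mu> + s - u))) \<longrightarrow>
      D * real (card J) powr recip t \<le> C * real (card J) powr recip q"
proof -
  obtain C0 :: real where C0: "\<And>c :: int ^ 'd \<Rightarrow> complex. finite {n. c n \<noteq> 0} \<Longrightarrow> (\<forall>n. c n \<noteq> 0 \<longrightarrow> n \<in> nonneg_lat) \<Longrightarrow>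
      besov_qnorm \<phi>\<^sub>0 \<phi> u p q (tdistr c) < \<infinity> \<Longrightarrow>
      besov_qnorm \<phi>\<^sub>0 \<phi> s p t (tdistr (\<lambda>n. a n * c n)) \<le> ennreal C0 * besov_qnorm \<phi>\<^sub>0 \<phi> u p q (tdistr c)"
    using bd unfolding tpoly_bounded_def by blast
  define C where "C = \<bar>C0\<bar> * (2 powr \<bar>u\<bar> * 3 powr recip q) / \<gamma>"
  have "D * real (card J) powr recip t \<le> C * real (card J) powr recip q"
    if J: "finite J" "J \<noteq> {}" "\<And>j. j \<in> J \<Longrightarrow> j\<^sub>0 \<le> j" "\<And>j. j \<in> J \<Longrightarrow> 4 dvd j" and "0 \<le> D"
      and D: "\<And>j. j \<in> J \<Longrightarrow> D \<le> 2 powr (real j * (\<mu> + s - u))" for J D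
  proof -
    define wt where "wt = (\<lambda>j. 1 / (2 powr (real j * u) * B j))"
    define c where "c = (\<lambda>n. \<Sum>j\<in>J. of_real (wt j) * v j n)"
    have wt: "0 < wt j" if "j \<in> J" for j using B_pos[OF J(3)[OF that]] by (simp add: wt_def)
    have c_nz: "\<exists>j\<in>J. v j n \<noteq> 0" if "c n \<noteq> 0" for n
    proof (rule ccontr)
      assume "\<not> ?thesis"
      then have "c n = 0" by (simp add: c_def)
      with that show False by simp
    qed
    have fin_c: "finite {n. c n \<noteq> 0}"
      by (rule finite_subset[of _ "\<Union>j\<in>J. {n. v j n \<noteq> 0}"]) (use c_nz J fin in auto)
    have nonneg_c: "\<forall>n. c n \<noteq> 0 \<longrightarrow> n \<in> nonneg_lat" using c_nz supp J(3) by blast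
    have sep: "j = j'" if jj: "j \<in> J" "j' \<in> J" and i: "i \<in> {j - 1, j, j + 1}" "i \<in> {j' - 1, j', j' + 1}" for i j j'
    proof -
      obtain k where k: "j = 4 * k" using J(4)[OF jj(1)] by (rule dvdE)
      obtain k' where k': "j' = 4 * k'" using J(4)[OF jj(2)] by (rule dvdE)
      have "3 \<le> j" "3 \<le> j'" using J(3) jj j0 by (auto intro: order_trans)
      then have "\<bar>int j - int j'\<bar> \<le> 2" using i by auto
      then have "\<bar>int k - int k'\<bar> < 1" unfolding k k' by simp
      then show ?thesis using k k' by simp
    qed
    have cut: "lp_cutoff \<phi>\<^sub>0 \<phi> i (lat n) * c n = of_real (wt j) * (lp_cutoff \<phi>\<^sub>0 \<phi> i (lat n) * v j n)"
      if "j \<in> J" "i \<in> {j - 1, j, j + 1}" for i j n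
    proof -
      have "lp_cutoff \<phi>\<^sub>0 \<phi> i (lat n) * c n = (\<Sum>j'\<in>J. of_real (wt j') * (lp_cutoff \<phi>\<^sub>0 \<phi> i (lat n) * v j' n))"
        by (simp add: c_def sum_distrib_left mult_ac)
      also have "\<dots> = (\<Sum>j'\<in>J. if j' = j then of_real (wt j) * (lp_cutoff \<phi>\<^sub>0 \<phi> i (lat n) * v j n) else 0)"
      proof (rule sum.cong[OF refl])
        fix j' assume j': "j' \<in> J"
        show "of_real (wt j') * (lp_cutoff \<phi>\<^sub>0 \<phi> i (lat n) * v j' n)
            = (if j' = j then of_real (wt j) * (lp_cutoff \<phi>\<^sub>0 \<phi> i (lat n) * v j n) else 0)"
        proof (cases "j' = j")
          case False
          then have "i \<notin> {j' - 1, j', j' + 1}" using sep[OF j' that(1) _ that(2)] by blast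
          from lp_size_vanish[OF J(3)[OF j'] this, of n] show ?thesis using False by simp
        qed simp
      qed
      finally show ?thesis using J that by simp
    qed
    let ?I = "\<Union>j\<in>J. {j - 1, j, j + 1}"
    have finI: "finite ?I" using J by auto
    have cardI: "real (card ?I) \<le> 3 * real (card J)"
    proof -
      have "card ?I \<le> (\<Sum>j\<in>J. card {j - 1, j, j + 1})" by (rule card_UN_le[OF J(1)])
      also have "\<dots> \<le> (\<Sum>j\<in>J. 3)" by (intro sum_mono) (auto simp: card_insert_if)
      finally show ?thesis by simp
    qed
    have card1: "1 \<le> real (card J)" using J by (simp add: Suc_le_eq card_gt_0_iff)
    have in_le: "besov_qnorm \<phi>\<^sub>0 \<phi> u p q (tdistr c) \<le> ennreal (2 powr \<bar>u\<bar> * (3 * real (card J)) powr recip q)"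
      unfolding besov_tdistr[OF fin_c]
    proof (rule lq_upper[OF \<open>0 < q\<close> finI cardI])
      fix i assume "i \<in> ?I"
      then obtain j where j: "j \<in> J" "i \<in> {j - 1, j, j + 1}" by blast
      have "lp_size \<phi>\<^sub>0 \<phi> i c x = wt j * lp_size \<phi>\<^sub>0 \<phi> i (v j) x" for x
        using lp_size_cong[OF cut[OF j] wt[OF j(1)]] wt[OF j(1)] by simp
      then have "lp_size \<phi>\<^sub>0 \<phi> i c = (\<lambda>x. wt j * lp_size \<phi>\<^sub>0 \<phi> i (v j) x)" by blast
      then have "Lnorm p (lp_size \<phi>\<^sub>0 \<phi> i c) = ennreal (wt j) * Lnorm p (lp_size \<phi>\<^sub>0 \<phi> i (v j))"
        by (simp only:) (rule Lnorm_scale, auto intro: continuous_on_lp_size wt j p_pos)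
      also have "Lnorm p (lp_size \<phi>\<^sub>0 \<phi> i (v j)) \<le> ennreal (B j)"
        using Lnorm_mono[OF continuous_on_lp_size lp_size_single_le[OF j(2)]] upper[OF J(3)[OF j(1)]] order_trans by blast
      finally have "ennreal (2 powr (real i * u)) * Lnorm p (lp_size \<phi>\<^sub>0 \<phi> i c)
          \<le> ennreal (2 powr (real i * u)) * (ennreal (wt j) * ennreal (B j))"
        by (simp add: mult_left_mono)
      also have "\<dots> = ennreal (2 powr (real i * u) * wt j * B j)"
        using wt[OF j(1)] B_pos[OF J(3)[OF j(1)]] by (simp add: ennreal_mult mult.assoc)
      also have "\<dots> \<le> ennreal (2 powr \<bar>u\<bar>)"
      proof (rule ennreal_leI)
        have "3 \<le> j" using j0 J(3)[OF j(1)] by simp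
        then have "2 powr (real i * u) * wt j * B j \<le> 2 powr \<bar>u\<bar> * 2 powr (real j * u) * wt j * B j"
          using weight_le[OF j(2), of u] wt[OF j(1)] B_pos[OF J(3)[OF j(1)]] by (intro mult_right_mono) auto
        also have "\<dots> = 2 powr \<bar>u\<bar>" using B_pos[OF J(3)[OF j(1)]] by (simp add: wt_def)
        finally show "2 powr (real i * u) * wt j * B j \<le> 2 powr \<bar>u\<bar>" .
      qed
      finally show "ennreal (2 powr (real i * u)) * Lnorm p (lp_size \<phi>\<^sub>0 \<phi> i c) \<le> ennreal (2 powr \<bar>u\<bar>)" .
    next
      fix i assume "i \<notin> ?I"
      then have "lp_cutoff \<phi>\<^sub>0 \<phi> i (lat n) * c n = 0" for n
        unfolding c_def sum_distrib_left
        using lp_size_vanish[OF J(3), of _ i n] by (intro sum.neutral ballI) (auto simp: mult.left_commute)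
      then have "lp_size \<phi>\<^sub>0 \<phi> i c = (\<lambda>x. 0)" by (auto simp: lp_size_def tpoly_def)
      then show "ennreal (2 powr (real i * u)) * Lnorm p (lp_size \<phi>\<^sub>0 \<phi> i c) = 0" using p_pos by simp
    qed (use card1 in auto)
    have fin_ac: "finite {n. a n * c n \<noteq> 0}" by (rule finite_subset[OF _ fin_c]) auto
    have out_ge: "ennreal (\<gamma> * D * real (card J) powr recip t) \<le> besov_qnorm \<phi>\<^sub>0 \<phi> s p t (tdistr (\<lambda>n. a n * c n))"
      unfolding besov_tdistr[OF fin_ac]
    proof (rule lq_lower[OF \<open>0 < t\<close> J(1,2)])
      fix j assume j: "j \<in> J"
      have "lp_cutoff \<phi>\<^sub>0 \<phi> j (lat n) * (a n * c n) = of_real (wt j) * (lp_cutoff \<phi>\<^sub>0 \<phi> j (lat n) * (a n * v j n))" for n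
        using cut[OF j, of j n] by (simp add: mult_ac)
      from lp_size_cong[OF this wt[OF j]] have "lp_size \<phi>\<^sub>0 \<phi> j (\<lambda>n. a n * c n) = (\<lambda>x. wt j * lp_size \<phi>\<^sub>0 \<phi> j (\<lambda>n. a n * v j n) x)"
        using wt[OF j] by auto
      then have eq: "Lnorm p (lp_size \<phi>\<^sub>0 \<phi> j (\<lambda>n. a n * c n)) = ennreal (wt j) * Lnorm p (lp_size \<phi>\<^sub>0 \<phi> j (\<lambda>n. a n * v j n))"
        by (simp only:) (rule Lnorm_scale, auto intro: continuous_on_lp_size wt j p_pos)
      note Bj = B_pos[OF J(3)[OF j]]
      have "\<gamma> * D \<le> \<gamma> * 2 powr (real j * (\<mu> + s - u))"
        using D[OF j] \<gamma> by simp
      also have "\<dots> = 2 powr (real j * s) * (wt j * (\<gamma> * 2 powr (real j * \<mu>) * B j))"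
        using Bj by (simp add: wt_def algebra_simps powr_add powr_diff)
      finally have "ennreal (\<gamma> * D) \<le> ennreal (2 powr (real j * s) * (wt j * (\<gamma> * 2 powr (real j * \<mu>) * B j)))"
        by (rule ennreal_leI)
      also have "\<dots> = ennreal (2 powr (real j * s)) * (ennreal (wt j) * ennreal (\<gamma> * 2 powr (real j * \<mu>) * B j))"
        using wt[OF j] Bj \<gamma> by (simp add: ennreal_mult)
      also have "\<dots> \<le> ennreal (2 powr (real j * s)) * (ennreal (wt j) * Lnorm p (lp_size \<phi>\<^sub>0 \<phi> j (\<lambda>n. a n * v j n)))"
        by (intro mult_left_mono lower J j) auto
      finally show "ennreal (\<gamma> * D) \<le> ennreal (2 powr (real j * s)) * Lnorm p (lp_size \<phi>\<^sub>0 \<phi> j (\<lambda>n. a n * c n))"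
        unfolding eq .
    qed (use \<gamma> \<open>0 \<le> D\<close> in auto)
    have "besov_qnorm \<phi>\<^sub>0 \<phi> u p q (tdistr c) < \<infinity>" using in_le by (rule le_less_trans) simp
    from C0[OF fin_c nonneg_c this]
    have "ennreal (\<gamma> * D * real (card J) powr recip t) \<le> ennreal C0 * besov_qnorm \<phi>\<^sub>0 \<phi> u p q (tdistr c)"
      using out_ge by (rule order_trans[rotated])
    also have "\<dots> \<le> ennreal \<bar>C0\<bar> * ennreal (2 powr \<bar>u\<bar> * (3 * real (card J)) powr recip q)"
      by (intro mult_mono in_le ennreal_leI) auto
    also have "\<dots> = ennreal (\<bar>C0\<bar> * (2 powr \<bar>u\<bar> * (3 * real (card J)) powr recip q))"
      by (simp add: ennreal_mult)
    finally have "\<gamma> * D * real (card J) powr recip t \<le> \<bar>C0\<bar> * (2 powr \<bar>u\<bar> * (3 * real (card J)) powr recip q)"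
      by (subst (asm) ennreal_le_iff) auto
    then show ?thesis using \<gamma> by (simp add: C_def field_simps powr_mult)
  qed
  then show ?thesis by (intro exI[of _ C]) blast
qed

lemma exponent_from_bound:
  assumes bd: "\<And>j. j\<^sub>0 \<le> j \<Longrightarrow> 4 dvd j \<Longrightarrow> 2 powr (real j * e) \<le> C"
  shows "e \<le> 0"
proof (rule ccontr)
  assume "\<not> e \<le> 0"
  then have e: "0 < e" by simp
  obtain N :: nat where N: "C / (e * ln 2) < real N" using reals_Archimedean2 by blast
  let ?j = "4 * (j\<^sub>0 + N)"
  have "C < real N * (e * ln 2)" using N e by (simp add: pos_divide_less_eq)
  also have "\<dots> \<le> real ?j * (e * ln 2)" using e by (intro mult_right_mono) auto
  also have "\<dots> \<le> exp (real ?j * (e * ln 2))"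
    using exp_ge_add_one_self[of "real ?j * (e * ln 2)"] by linarith
  also have "\<dots> = 2 powr (real ?j * e)" by (simp add: powr_def mult_ac)
  also have "\<dots> \<le> C" by (rule bd) auto
  finally show False by simp
qed

text \<open>A single scale, tending to infinity.\<close>

lemma besov_loss:
  assumes bd: "tpoly_bounded a (besov_qnorm \<phi>\<^sub>0 \<phi> u p q) (besov_qnorm \<phi>\<^sub>0 \<phi> s p t)" and "0 < q" "0 < t"
  shows "\<mu> + s \<le> u"
proof -
  obtain C where C: "\<And>J D. finite J \<Longrightarrow> J \<noteq> {} \<Longrightarrow> \<forall>j\<in>J. j\<^sub>0 \<le> j \<and> 4 dvd j \<Longrightarrow> 0 \<le> D \<Longrightarrow>
      \<forall>j\<in>J. D \<le> 2 powr (real j * (\<mu> + s - u)) \<Longrightarrow>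
      D * real (card J) powr recip t \<le> C * real (card J) powr recip q"
    using besov_test[OF assms] by blast
  have "2 powr (real j * (\<mu> + s - u)) \<le> C" if "j\<^sub>0 \<le> j" "4 dvd j" for j
    using C[of "{j}" "2 powr (real j * (\<mu> + s - u))"] that by simp
  then have "\<mu> + s - u \<le> 0" by (rule exponent_from_bound)
  then show ?thesis by simp
qed

text \<open>At the critical smoothness \<open>N\<close> scales give \<open>N powr (1 / t) \<le> C * N powr (1 / q)\<close>; here
  \<open>N\<close> runs through the powers of two.\<close>

lemma besov_fine_index:
  assumes bd: "tpoly_bounded a (besov_qnorm \<phi>\<^sub>0 \<phi> (\<mu> + s) p q) (besov_qnorm \<phi>\<^sub>0 \<phi> s p t)" and "0 < q" "0 < t"
  shows "q \<le> t"
proof (rule ccontr)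
  assume "\<not> q \<le> t"
  then have tq: "t < q" by simp
  then have t: "t \<noteq> \<infinity>" by auto
  have less: "recip q < recip t"
  proof (cases "q = \<infinity>")
    case True
    then show ?thesis using finite_exponent[OF \<open>0 < t\<close> t] by simp
  next
    case False
    note q' = finite_exponent[OF \<open>0 < q\<close> False] and t' = finite_exponent[OF \<open>0 < t\<close> t]
    have "ennreal (enn2real t) < ennreal (enn2real q)" using tq q'(3) t'(3) by simp
    then have "enn2real t < enn2real q" by (simp add: ennreal_less_iff)
    then show ?thesis using q' t' by (simp add: frac_less2)
  qed
  obtain C where C: "\<And>J D. finite J \<Longrightarrow> J \<noteq> {} \<Longrightarrow> \<forall>j\<in>J. j\<^sub>0 \<le> j \<and> 4 dvd j \<Longrightarrow> 0 \<le> D \<Longrightarrow>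
      \<forall>j\<in>J. D \<le> 2 powr (real j * (\<mu> + s - (\<mu> + s))) \<Longrightarrow>
      D * real (card J) powr recip t \<le> C * real (card J) powr recip q"
    using besov_test[OF assms] by blast
  have "2 powr (real j * (recip t - recip q)) \<le> C" if "j\<^sub>0 \<le> j" for j
  proof -
    let ?J = "(\<lambda>k. 4 * (j\<^sub>0 + k)) ` {..<2 ^ j}"
    have "card ?J = 2 ^ j" by (subst card_image) (auto simp: inj_on_def)
    moreover have "1 * real (card ?J) powr recip t \<le> C * real (card ?J) powr recip q"
    proof (rule C)
      have "(0::nat) \<in> {..<2 ^ j}" by simp
      then show "?J \<noteq> {}" by blast
    qed auto
    ultimately have "(2 ^ j) powr recip t \<le> C * (2 ^ j) powr recip q" by simp
    then have "2 powr (real j * recip t) \<le> C * 2 powr (real j * recip q)"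
      by (simp add: powr_realpow[symmetric] powr_powr)
    then show ?thesis by (simp add: right_diff_distrib powr_diff field_simps)
  qed
  then have "recip t - recip q \<le> 0" by (intro exponent_from_bound)
  then show False using less by simp
qed

text \<open>For an input at a single scale the inner sequence has at most three nonzero entries, and the
  order of the sequence and the function quasi-norm is immaterial.\<close>

lemma tl_loss:
  assumes bd: "tpoly_bounded a (tl_qnorm \<phi>\<^sub>0 \<phi> u p q) (tl_qnorm \<phi>\<^sub>0 \<phi> s p t)" and "0 < q" "0 < t" "p < \<infinity>"
  shows "\<mu> + s \<le> u"
proof -
  obtain C0 :: real where C0: "\<And>c :: int ^ 'd \<Rightarrow> complex. finite {n. c n \<noteq> 0} \<Longrightarrow> (\<forall>n. c n \<noteq> 0 \<longrightarrow> n \<in> nonneg_lat) \<Longrightarrow>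
      tl_qnorm \<phi>\<^sub>0 \<phi> u p q (tdistr c) < \<infinity> \<Longrightarrow>
      tl_qnorm \<phi>\<^sub>0 \<phi> s p t (tdistr (\<lambda>n. a n * c n)) \<le> ennreal C0 * tl_qnorm \<phi>\<^sub>0 \<phi> u p q (tdistr c)"
    using bd unfolding tpoly_bounded_def by blast
  define K where "K = 2 powr \<bar>u\<bar> * 3 powr recip q"
  have "2 powr (real j * (\<mu> + s - u)) \<le> \<bar>C0\<bar> * K / \<gamma>" if j: "j\<^sub>0 \<le> j" for j
  proof -
    note Bj = B_pos[OF j]
    have j3: "3 \<le> j" using j j0 by simp
    let ?G = "\<lambda>x. \<Sum>i\<in>{j - 1, j, j + 1}. lp_size \<phi>\<^sub>0 \<phi> i (v j) x"
    let ?k = "K * 2 powr (real j * u)"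
    have G0: "0 \<le> ?G x" for x by (intro sum_nonneg) simp
    have "tl_qnorm \<phi>\<^sub>0 \<phi> u p q (tdistr (v j)) \<le> Lnorm p (\<lambda>x. ?k * ?G x)"
      unfolding tl_tdistr[OF fin[OF j]] Lnorm_def
    proof (rule Lp_qnorm_mono)
      fix x
      have "Lp_qnorm (count_space UNIV) q (\<lambda>i. ennreal (2 powr (real i * u)) * ennreal (lp_size \<phi>\<^sub>0 \<phi> i (v j) x))
          \<le> ennreal (2 powr \<bar>u\<bar> * 2 powr (real j * u) * ?G x * 3 powr recip q)"
      proof (rule lq_upper[OF \<open>0 < q\<close>, of "{j - 1, j, j + 1}"])
        fix i assume i: "i \<in> {j - 1, j, j + 1}"
        have "2 powr (real i * u) * lp_size \<phi>\<^sub>0 \<phi> i (v j) x \<le> 2 powr \<bar>u\<bar> * 2 powr (real j * u) * ?G x"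
          using weight_le[OF i, of u] lp_size_single_le[OF i] j3 by (intro mult_mono) auto
        then show "ennreal (2 powr (real i * u)) * ennreal (lp_size \<phi>\<^sub>0 \<phi> i (v j) x) \<le> ennreal (2 powr \<bar>u\<bar> * 2 powr (real j * u) * ?G x)"
          by (simp add: ennreal_leI flip: ennreal_mult)
      next
        fix i assume "i \<notin> {j - 1, j, j + 1}"
        then have van: "lp_cutoff \<phi>\<^sub>0 \<phi> i (lat n) * v j n = 0" for n by (rule lp_size_vanish[OF j])
        have "lp_size \<phi>\<^sub>0 \<phi> i (v j) x = 0" unfolding lp_size_def van tpoly_def by simp
        then show "ennreal (2 powr (real i * u)) * ennreal (lp_size \<phi>\<^sub>0 \<phi> i (v j) x) = 0" by simp
      next
        show "0 \<le> 2 powr \<bar>u\<bar> * 2 powr (real j * u) * ?G x" using G0 by simp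
        show "real (card {j - 1, j, j + 1}) \<le> 3" by (auto simp: card_insert_if)
      qed auto
      also have "2 powr \<bar>u\<bar> * 2 powr (real j * u) * ?G x * 3 powr recip q = ?k * ?G x" by (simp add: K_def)
      finally show "Lp_qnorm (count_space UNIV) q (\<lambda>i. ennreal (2 powr (real i * u)) * ennreal (lp_size \<phi>\<^sub>0 \<phi> i (v j) x)) \<le> ennreal (?k * ?G x)" .
    qed (rule disjI2, use \<open>p < \<infinity>\<close> in auto)
    also have "\<dots> = ennreal ?k * Lnorm p ?G"
      by (rule Lnorm_scale) (auto simp: K_def p_pos intro!: continuous_intros continuous_on_lp_size sum_nonneg)
    also have "\<dots> \<le> ennreal ?k * ennreal (B j)" by (intro mult_left_mono upper[OF j]) simp
    also have "\<dots> = ennreal (?k * B j)" using Bj by (simp add: ennreal_mult K_def)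
    finally have in_le: "tl_qnorm \<phi>\<^sub>0 \<phi> u p q (tdistr (v j)) \<le> ennreal (?k * B j)" .
    have fin_av: "finite {n. a n * v j n \<noteq> 0}" by (rule finite_subset[OF _ fin[OF j]]) auto
    have "ennreal (2 powr (real j * s) * (\<gamma> * 2 powr (real j * \<mu>) * B j)) = ennreal (2 powr (real j * s)) * ennreal (\<gamma> * 2 powr (real j * \<mu>) * B j)"
      using Bj \<gamma> by (simp add: ennreal_mult)
    also have "\<dots> \<le> ennreal (2 powr (real j * s)) * Lnorm p (lp_size \<phi>\<^sub>0 \<phi> j (\<lambda>n. a n * v j n))"
      by (intro mult_left_mono lower[OF j]) simp
    also have "\<dots> = Lnorm p (\<lambda>x. 2 powr (real j * s) * lp_size \<phi>\<^sub>0 \<phi> j (\<lambda>n. a n * v j n) x)"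
      by (rule Lnorm_scale[symmetric]) (auto simp: p_pos intro!: continuous_on_lp_size)
    also have "\<dots> \<le> tl_qnorm \<phi>\<^sub>0 \<phi> s p t (tdistr (\<lambda>n. a n * v j n))"
      unfolding tl_tdistr[OF fin_av] Lnorm_def
    proof (rule Lp_qnorm_mono)
      fix x
      have "ennreal (2 powr (real j * s) * lp_size \<phi>\<^sub>0 \<phi> j (\<lambda>n. a n * v j n) x * real (card {j}) powr recip t) \<le>
          Lp_qnorm (count_space UNIV) t (\<lambda>i. ennreal (2 powr (real i * s)) * ennreal (lp_size \<phi>\<^sub>0 \<phi> i (\<lambda>n. a n * v j n) x))"
        by (rule lq_lower[OF \<open>0 < t\<close>]) (auto simp flip: ennreal_mult)
      then show "ennreal (2 powr (real j * s) * lp_size \<phi>\<^sub>0 \<phi> j (\<lambda>n. a n * v j n) x) \<le>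
          Lp_qnorm (count_space UNIV) t (\<lambda>i. ennreal (2 powr (real i * s)) * ennreal (lp_size \<phi>\<^sub>0 \<phi> i (\<lambda>n. a n * v j n) x))"
        by simp
    qed (rule disjI2, use \<open>p < \<infinity>\<close> in auto)
    also have "\<dots> \<le> ennreal C0 * tl_qnorm \<phi>\<^sub>0 \<phi> u p q (tdistr (v j))"
    proof (rule C0[OF fin[OF j]])
      show "\<forall>n. v j n \<noteq> 0 \<longrightarrow> n \<in> nonneg_lat" using supp[OF j] by blast
      show "tl_qnorm \<phi>\<^sub>0 \<phi> u p q (tdistr (v j)) < \<infinity>" using in_le by (rule le_less_trans) simp
    qed
    also have "\<dots> \<le> ennreal \<bar>C0\<bar> * ennreal (?k * B j)"
      by (intro mult_mono in_le ennreal_leI) auto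
    also have "\<dots> = ennreal (\<bar>C0\<bar> * (?k * B j))" by (simp add: ennreal_mult')
    finally have "2 powr (real j * s) * (\<gamma> * 2 powr (real j * \<mu>) * B j) \<le> \<bar>C0\<bar> * (?k * B j)"
      by (subst (asm) ennreal_le_iff) (use Bj in \<open>auto simp: K_def\<close>)
    then have "\<gamma> * (2 powr (real j * s) * 2 powr (real j * \<mu>)) * B j \<le> \<bar>C0\<bar> * K * 2 powr (real j * u) * B j"
      by (simp add: mult_ac)
    then have "\<gamma> * (2 powr (real j * s) * 2 powr (real j * \<mu>)) \<le> \<bar>C0\<bar> * K * 2 powr (real j * u)"
      by (rule mult_right_le_imp_le[OF _ Bj])
    then show ?thesis using \<gamma> by (simp add: algebra_simps powr_add powr_diff field_simps)
  qed
  then have "\<mu> + s - u \<le> 0" by (intro exponent_from_bound)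
  then show ?thesis by simp
qed

end

section \<open>The oscillating symbol\<close>

text \<open>The point of the unit sphere of the positive orthant that is farthest from the boundary of
  the orthant.\<close>

definition diagonal :: "real ^ 'd" where
  "diagonal = (\<chi> k. 1 / sqrt (real CARD('d)))"

lemma norm_diagonal: "norm (diagonal :: real ^ 'd::finite) = 1"
proof -
  have "(\<Sum>k\<in>(UNIV :: 'd set). (1 / sqrt (real CARD('d)))\<^sup>2) = 1"
    by (simp add: power_divide)
  then show ?thesis by (simp add: norm_vec_def L2_set_def diagonal_def)
qed

text \<open>The resolution of unity is evaluated at \<open>4 *\<^sub>R \<xi>\<close>, where \<open>\<phi>\<^sub>0\<close> vanishes. There the terms
  of the neighbouring indices sit on the boundary of the support of \<open>\<phi>\<close> and vanish by
  continuity, so that one term remains. On no open set need a cutoff be equal to one.\<close>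

lemma lp_resolution_values:
  fixes \<phi>\<^sub>0 \<phi> :: "real ^ 'd::finite \<Rightarrow> complex"
  assumes res: "lp_resolution \<phi>\<^sub>0 \<phi>"
  shows "\<phi>\<^sub>0 0 = 1" "norm \<xi> = 1 \<Longrightarrow> \<phi> \<xi> = 1"
proof -
  note supp = lp_resolution_support[OF res]
  have sums: "(\<lambda>j. \<phi> ((1 / 2 ^ Suc j) *\<^sub>R \<xi>)) sums (1 - \<phi>\<^sub>0 \<xi>)" for \<xi>
    using res by (simp add: lp_resolution_def)
  have "\<phi> 0 = 0" using supp(2)[of 0] by auto
  then have "(\<lambda>j. 0) sums (1 - \<phi>\<^sub>0 0)" using sums[of 0] by simp
  then show "\<phi>\<^sub>0 0 = 1" using sums_unique2[OF sums_zero] by force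
  show "\<phi> \<xi> = 1" if \<xi>: "norm \<xi> = 1"
  proof -
    have "smooth \<phi>" using res by (simp add: lp_resolution_def)
    have lim: "(\<lambda>t. \<phi> (t *\<^sub>R \<xi>)) \<midarrow>c\<rightarrow> \<phi> (c *\<^sub>R \<xi>)" for c
    proof -
      have "continuous_on UNIV (\<lambda>t. \<phi> (t *\<^sub>R \<xi>))"
        by (intro continuous_on_compose2[OF smooth_imp_continuous[OF \<open>smooth \<phi>\<close>]] continuous_intros) auto
      then show ?thesis by (simp add: continuous_on_eq_continuous_at isCont_def)
    qed
    have 2: "\<phi> (2 *\<^sub>R \<xi>) = 0"
    proof -
      have "\<forall>\<^sub>F t in at_right 2. \<phi> (t *\<^sub>R \<xi>) = 0"
        unfolding eventually_at_right_field using supp(3) \<xi> by (intro exI[of _ 3]) fastforce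
      then have zero: "((\<lambda>t. \<phi> (t *\<^sub>R \<xi>)) \<longlongrightarrow> 0) (at_right 2)" by (rule tendsto_eventually)
      have "((\<lambda>t. \<phi> (t *\<^sub>R \<xi>)) \<longlongrightarrow> \<phi> (2 *\<^sub>R \<xi>)) (at_right 2)"
        by (rule tendsto_mono[OF at_le lim]) simp
      from tendsto_unique[OF _ this zero] show ?thesis by simp
    qed
    have h: "\<phi> ((1 / 2) *\<^sub>R \<xi>) = 0"
    proof -
      have "\<forall>\<^sub>F t in at_left (1/2). \<phi> (t *\<^sub>R \<xi>) = 0"
        unfolding eventually_at_left_field using supp(2) \<xi> by (intro exI[of _ 0]) fastforce
      then have zero: "((\<lambda>t. \<phi> (t *\<^sub>R \<xi>)) \<longlongrightarrow> 0) (at_left (1/2))" by (rule tendsto_eventually)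
      have "((\<lambda>t. \<phi> (t *\<^sub>R \<xi>)) \<longlongrightarrow> \<phi> ((1/2) *\<^sub>R \<xi>)) (at_left (1/2))"
        by (rule tendsto_mono[OF at_le lim]) simp
      from tendsto_unique[OF _ this zero] show ?thesis by simp
    qed
    have "\<phi>\<^sub>0 (4 *\<^sub>R \<xi>) = 0" using supp(1)[of "4 *\<^sub>R \<xi>"] \<xi> by auto
    then have s: "(\<lambda>j. \<phi> ((1 / 2 ^ Suc j) *\<^sub>R (4 *\<^sub>R \<xi>))) sums 1" using sums[of "4 *\<^sub>R \<xi>"] by simp
    have zero: "\<phi> ((1 / 2 ^ Suc j) *\<^sub>R (4 *\<^sub>R \<xi>)) = 0" if j: "j \<noteq> 1" for j
    proof -
      consider "j = 0" | "j = 2" | "3 \<le> j" using j by linarith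
      then show ?thesis
      proof cases
        case 3
        then have "(2::real) ^ 3 \<le> 2 ^ j" by (intro power_increasing) auto
        then have "norm ((1 / 2 ^ Suc j) *\<^sub>R (4 *\<^sub>R \<xi>)) < 1 / 2" using \<xi> by (simp add: field_simps)
        then show ?thesis using supp(2) by force
      qed (use 2 h in auto)
    qed
    have "(\<lambda>j. \<phi> ((1 / 2 ^ Suc j) *\<^sub>R (4 *\<^sub>R \<xi>))) sums (\<Sum>j\<in>{1}. \<phi> ((1 / 2 ^ Suc j) *\<^sub>R (4 *\<^sub>R \<xi>)))"
      by (rule sums_finite) (use zero in auto)
    from sums_unique2[OF this s] show ?thesis by simp
  qed
qed

text \<open>A radius for balls around \<open>diagonal\<close> that stay inside the positive orthant and close to the
  unit sphere. The dimension enters through a type argument.\<close>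

definition window_radius :: "'d itself \<Rightarrow> real" where
  "window_radius _ = min (1 / 8) (1 / (2 * sqrt (real CARD('d))))"

lemma window_radius_pos: "0 < window_radius TYPE('d::finite)"
  by (simp add: window_radius_def)

lemma near_diagonal:
  fixes n :: "int ^ 'd::finite"
  assumes near: "norm (lat n - 2 ^ j *\<^sub>R diagonal) \<le> window_radius TYPE('d) * 2 ^ j"
  shows "n \<in> nonneg_lat" "n \<in> annulus j"
proof -
  let ?r = "window_radius TYPE('d)"
  have "norm (2 ^ j *\<^sub>R (diagonal :: real ^ 'd)) = 2 ^ j" by (simp add: norm_diagonal)
  moreover have "\<bar>norm (lat n) - norm (2 ^ j *\<^sub>R (diagonal :: real ^ 'd))\<bar> \<le> norm (lat n - 2 ^ j *\<^sub>R diagonal)"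
    by (rule norm_triangle_ineq3)
  moreover have "?r * 2 ^ j \<le> 1 / 8 * 2 ^ j"
    by (intro mult_right_mono) (auto simp: window_radius_def)
  ultimately have "7 / 8 * 2 ^ j \<le> norm (lat n)" "norm (lat n) \<le> 9 / 8 * 2 ^ j"
    using near by linarith+
  then show "n \<in> annulus j" by (simp add: annulus_def)
  have "0 \<le> n $ k" for k
  proof -
    have "\<bar>real_of_int (n $ k) - 2 ^ j * (1 / sqrt (real CARD('d)))\<bar> \<le> norm (lat n - 2 ^ j *\<^sub>R diagonal)"
      using component_le_norm_cart[of "lat n - 2 ^ j *\<^sub>R diagonal" k] by (simp add: diagonal_def)
    also have "\<dots> \<le> 1 / (2 * sqrt (real CARD('d))) * 2 ^ j"
      using near by (rule order_trans) (intro mult_right_mono, auto simp: window_radius_def)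
    finally have "2 ^ j * (1 / sqrt (real CARD('d))) - 1 / (2 * sqrt (real CARD('d))) * 2 ^ j \<le> real_of_int (n $ k)"
      by linarith
    moreover have "2 ^ j * (1 / sqrt (real CARD('d))) - 1 / (2 * sqrt (real CARD('d))) * 2 ^ j = 2 ^ j / (2 * sqrt (real CARD('d)))"
      by (simp add: field_simps)
    moreover have "0 \<le> 2 ^ j / (2 * sqrt (real CARD('d)))" by simp
    ultimately have "0 \<le> real_of_int (n $ k)" by linarith
    then show ?thesis by simp
  qed
  then show "n \<in> nonneg_lat" by (simp add: nonneg_lat_def)
qed

lemma annulus_disjoint:
  assumes "n \<in> annulus j" "n \<in> annulus j'"
  shows "j = j'"
proof -
  have "\<not> j < j'" if "n \<in> annulus j" "n \<in> annulus j'" for j j'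
  proof
    assume "j < j'"
    then have "(2::real) ^ Suc j \<le> 2 ^ j'" by (intro power_increasing) auto
    moreover have "7 / 8 * 2 ^ j' \<le> 9 / 8 * (2::real) ^ j"
      using that by (auto simp: annulus_def)
    moreover have "(0::real) < 2 ^ j" by simp
    ultimately show False by simp
  qed
  then show ?thesis using assms by (meson linorder_neqE_nat)
qed

lemma mdiff_conv_list: "\<exists>js. length js = msize \<alpha> \<and> mdiff \<alpha> = foldr diff_op js" for \<alpha> :: "nat ^ 'd::finite"
proof -
  have "\<exists>js. distinct js \<and> set js = (UNIV :: 'd set)"
    using finite_distinct_list[of "UNIV :: 'd set"] by auto
  then have coords: "distinct (coords :: 'd list)" "set (coords :: 'd list) = UNIV"
    unfolding coords_def by (rule someI2_ex, blast)+
  have fold: "foldr (\<lambda>j. diff_op j ^^ (\<alpha> $ j)) js = foldr diff_op (concat (map (\<lambda>j. replicate (\<alpha> $ j) j) js))" for js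
  proof (induction js)
    case (Cons j js)
    have rep: "foldr diff_op (replicate i j) = diff_op j ^^ i" for i
      by (induction i) auto
    have "foldr diff_op (concat (map (\<lambda>j. replicate (\<alpha> $ j) j) (j # js)))
        = foldr diff_op (replicate (\<alpha> $ j) j) \<circ> foldr diff_op (concat (map (\<lambda>j. replicate (\<alpha> $ j) j) js))"
      by (simp add: fun_eq_iff)
    then show ?case by (simp only: rep Cons.IH[symmetric] foldr.simps)
  qed auto
  have "length (concat (map (\<lambda>j. replicate (\<alpha> $ j) j) coords)) = sum_list (map (\<lambda>j. \<alpha> $ j) coords)"
    by (simp add: length_concat comp_def)
  also have "\<dots> = msize \<alpha>"
    using coords by (simp add: sum_list_distinct_conv_sum_set msize_def)
  finally show ?thesis using fold unfolding mdiff_def by blast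
qed

lemma mpartial_const:
  assumes "\<beta> \<noteq> 0"
  shows "mpartial \<beta> (\<lambda>x. c) = (\<lambda>x :: real ^ 'd::finite. 0)"
proof -
  have pow: "(partial j ^^ i) (\<lambda>x :: real ^ 'd. c) = (\<lambda>x. if i = 0 then c else 0)" for j i c
  proof (induction i)
    case (Suc i)
    have "(partial j ^^ Suc i) (\<lambda>x :: real ^ 'd. c) = partial j ((partial j ^^ i) (\<lambda>x. c))" by simp
    also have "\<dots> = (\<lambda>x. 0)" unfolding Suc.IH by (rule partial_const)
    finally show ?case by simp
  qed simp
  have fold: "foldr (\<lambda>j. partial j ^^ (\<beta> $ j)) js (\<lambda>x :: real ^ 'd. c) = (\<lambda>x. if \<forall>j\<in>set js. \<beta> $ j = 0 then c else 0)" for js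
    by (induction js) (auto simp: pow)
  have "\<exists>js. distinct js \<and> set js = (UNIV :: 'd set)"
    using finite_distinct_list[of "UNIV :: 'd set"] by auto
  then have coords: "set (coords :: 'd list) = UNIV"
    unfolding coords_def by (rule someI2_ex) blast
  show ?thesis using assms unfolding mpartial_def fold coords by (auto simp: vec_eq_iff)
qed

text \<open>A symbol that does not depend on \<open>x\<close> has no Fourier coefficient except at \<open>\<nu> = 0\<close>, which
  keeps the positive orthant invariant.\<close>

lemma multiplier_in_tri_symbols:
  fixes a :: "int ^ 'd::finite \<Rightarrow> complex"
  assumes "\<And>M. \<exists>C. \<forall>js n. length js = M \<longrightarrow> norm (foldr diff_op js a n) \<le> C * jbr n powr (m - \<rho> * real M)"
  shows "(\<lambda>x. a) \<in> tri_symbols m \<rho> \<delta>"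
proof -
  have "\<exists>C. \<forall>x n. norm (mdiff \<alpha> (\<lambda>k. mpartial \<beta> (\<lambda>y. a k) x) n) \<le> C * jbr n powr (m - \<rho> * real (msize \<alpha>) + \<delta> * real (msize \<beta>))" for \<alpha> \<beta> :: "nat ^ 'd"
  proof -
    obtain js where js: "length js = msize \<alpha>" "mdiff \<alpha> = foldr diff_op js" using mdiff_conv_list by blast
    show ?thesis
    proof (cases "\<beta> = 0")
      case True
      obtain C where "\<forall>js n. length js = msize \<alpha> \<longrightarrow> norm (foldr diff_op js a n) \<le> C * jbr n powr (m - \<rho> * real (msize \<alpha>))"
        using assms by blast
      then show ?thesis using True js by (intro exI[of _ C]) (auto simp: msize_def)
    next
      case False
      then show ?thesis by (intro exI[of _ 0]) (simp add: mpartial_const js foldr_diff_op_zero)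
    qed
  qed
  then have "(\<lambda>x. a) \<in> symbols m \<rho> \<delta>" by (simp add: symbols_def)
  moreover have "symbol_coeff (\<lambda>x. a) \<nu> n = 0" if "n \<in> nonneg_lat" "n + \<nu> \<notin> nonneg_lat" for n \<nu>
  proof -
    have "\<nu> \<noteq> 0" using that by auto
    then have "(LINT x|torus. a n * chr (- \<nu>) x) = 0"
      using integral_chr[of "- \<nu>"] by simp
    then show ?thesis by (simp add: symbol_coeff_def)
  qed
  ultimately show ?thesis by (auto simp: tri_symbols_def)
qed

text \<open>The multiplier at scale \<open>2 ^ j\<close> lives in a cube within \<open>\<epsilon> * 2 ^ j\<close> of the point
  \<open>2 ^ j *\<^sub>R diagonal\<close>, where the cutoff number \<open>j\<close> is close to one. The side of the cube is at
  most \<open>2 ^ j / 2 ^ c\<^sub>0\<close>, and from the scale \<open>j\<^sub>0\<close> on the cells and the rounding of the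
  corner to a lattice point are small compared with \<open>\<epsilon> * 2 ^ j\<close>. On the ball of radius \<open>r\<^sub>0\<close> the
  function \<open>\<phi>\<^sub>0\<close>, from which all bumps are made, is close to one.\<close>

locale oscillation =
  fixes \<phi>\<^sub>0 \<phi> :: "real ^ 'd::finite \<Rightarrow> complex" and \<rho> r\<^sub>0 \<epsilon> :: real and c\<^sub>0 j\<^sub>0 :: nat
  assumes res: "lp_resolution \<phi>\<^sub>0 \<phi>" and \<rho>: "0 < \<rho>" "\<rho> < 1"
    and r0: "0 < r\<^sub>0" "\<And>\<xi>. norm \<xi> \<le> r\<^sub>0 \<Longrightarrow> norm (\<phi>\<^sub>0 \<xi> - 1) \<le> 1 / 8"
    and \<epsilon>: "0 < \<epsilon>" "\<epsilon> \<le> window_radius TYPE('d)" "\<epsilon> * (2 / window_radius TYPE('d)) \<le> r\<^sub>0"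
      "\<And>\<xi>. norm (\<xi> - diagonal) \<le> \<epsilon> \<Longrightarrow> norm (\<phi> \<xi> - 1) \<le> 1 / 8"
    and c0: "real CARD('d) / 2 ^ c\<^sub>0 \<le> \<epsilon> / 2"
    and j0: "3 \<le> j\<^sub>0" "\<And>j. j\<^sub>0 \<le> j \<Longrightarrow> real c\<^sub>0 \<le> real j * (1 - \<rho>)"
      "\<And>j. j\<^sub>0 \<le> j \<Longrightarrow> 1 / 4 + real CARD('d) \<le> \<epsilon> / 2 * 2 powr (real j * (1 - \<rho>))"
begin

text \<open>The resolution of unity itself supplies a smooth bump.\<close>

definition \<eta> :: "real ^ 'd \<Rightarrow> complex" where
  "\<eta> \<xi> = \<phi>\<^sub>0 (16 *\<^sub>R \<xi>)"

text \<open>Cells of side about \<open>2 ^ j\<close> to the power \<open>\<rho>\<close>: a bump on a cell of this size is a symbol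
  of type \<open>\<rho>\<close>.\<close>

definition side :: "nat \<Rightarrow> nat" where
  "side j = nat \<lfloor>2 powr (real j * \<rho>)\<rfloor>"

text \<open>Logarithm of the number of cells in each direction, chosen such that they fill a fixed
  fraction of \<open>2 ^ j\<close>.\<close>

definition depth :: "nat \<Rightarrow> nat" where
  "depth j = nat \<lfloor>real j * (1 - \<rho>)\<rfloor> - c\<^sub>0"

definition base :: "nat \<Rightarrow> int ^ 'd" where
  "base j = (\<chi> k. \<lfloor>2 ^ j / sqrt (real CARD('d))\<rfloor>)"

definition blk :: "nat \<Rightarrow> int ^ 'd \<Rightarrow> complex" where
  "blk j = block \<eta> (depth j) (side j) (base j)"

lemma smooth_\<eta>: "smooth \<eta>"
  using smooth_affine[of \<phi>\<^sub>0 16 0] res by (simp add: lp_resolution_def \<eta>_def[abs_def])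

lemma \<eta>_support: "\<eta> \<xi> \<noteq> 0 \<Longrightarrow> norm \<xi> \<le> 1 / 8"
  using lp_resolution_support(1)[OF res, of "16 *\<^sub>R \<xi>"] by (simp add: \<eta>_def)

lemma side_bounds: "1 \<le> side j" "real (side j) \<le> 2 powr (real j * \<rho>)" "2 powr (real j * \<rho>) / 2 \<le> real (side j)"
proof -
  have "1 \<le> 2 powr (real j * \<rho>)" using \<rho> by (intro ge_one_powr_ge_zero) auto
  then have "1 \<le> \<lfloor>2 powr (real j * \<rho>)\<rfloor>" by simp
  moreover have "2 powr (real j * \<rho>) < of_int \<lfloor>2 powr (real j * \<rho>)\<rfloor> + 1" by linarith
  ultimately show "1 \<le> side j" "real (side j) \<le> 2 powr (real j * \<rho>)" "2 powr (real j * \<rho>) / 2 \<le> real (side j)"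
    unfolding side_def by linarith+
qed

lemma two_powr_split: "2 powr (real j * \<rho>) * 2 powr (real j * (1 - \<rho>)) = 2 ^ j"
  by (simp add: algebra_simps powr_realpow flip: powr_add)

lemma depth_bounds:
  assumes "j\<^sub>0 \<le> j"
  shows "2 ^ depth j \<le> 2 powr (real j * (1 - \<rho>)) / 2 ^ c\<^sub>0" "2 powr (real j * (1 - \<rho>)) / (2 * 2 ^ c\<^sub>0) \<le> 2 ^ depth j"
proof -
  let ?y = "real j * (1 - \<rho>)"
  have y: "real c\<^sub>0 \<le> ?y" by (rule j0(2)[OF assms])
  then have "real (depth j) \<le> ?y - real c\<^sub>0" "?y - 1 - real c\<^sub>0 \<le> real (depth j)"
    unfolding depth_def by linarith+
  then have "2 powr real (depth j) \<le> 2 powr (?y - real c\<^sub>0)" "2 powr (?y - 1 - real c\<^sub>0) \<le> 2 powr real (depth j)"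
    by (intro powr_mono; simp)+
  then show "2 ^ depth j \<le> 2 powr ?y / 2 ^ c\<^sub>0" "2 powr ?y / (2 * 2 ^ c\<^sub>0) \<le> 2 ^ depth j"
    by (simp_all add: powr_diff powr_realpow)
qed

lemma width_bounds:
  assumes "j\<^sub>0 \<le> j"
  shows "2 ^ depth j * real (side j) \<le> 2 ^ j / 2 ^ c\<^sub>0" "2 ^ j / (4 * 2 ^ c\<^sub>0) \<le> 2 ^ depth j * real (side j)"
proof -
  note d = depth_bounds[OF assms] and s = side_bounds[of j]
  have "2 ^ depth j * real (side j) \<le> 2 powr (real j * (1 - \<rho>)) / 2 ^ c\<^sub>0 * 2 powr (real j * \<rho>)"
    using d s by (intro mult_mono) auto
  also have "\<dots> = 2 ^ j / 2 ^ c\<^sub>0" using two_powr_split[of j] by (simp add: mult.commute)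
  finally show "2 ^ depth j * real (side j) \<le> 2 ^ j / 2 ^ c\<^sub>0" .
  have "2 ^ j / (4 * 2 ^ c\<^sub>0) = 2 powr (real j * (1 - \<rho>)) / (2 * 2 ^ c\<^sub>0) * (2 powr (real j * \<rho>) / 2)"
    using two_powr_split[of j] by (simp add: mult.commute)
  also have "\<dots> \<le> 2 ^ depth j * real (side j)"
    using d s by (intro mult_mono) auto
  finally show "2 ^ j / (4 * 2 ^ c\<^sub>0) \<le> 2 ^ depth j * real (side j)" .
qed

lemma bump: "bump \<eta> (side j)"
  using \<eta>_support side_bounds(1)[of j] by unfold_locales auto

lemma centre_near:
  assumes j: "j\<^sub>0 \<le> j" and k: "k \<in> cube (2 ^ depth j)"
    and n: "norm (lat (n - centre (side j) (base j) k)) \<le> real (side j) / 4"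
  shows "norm (lat n - 2 ^ j *\<^sub>R diagonal) \<le> \<epsilon> * 2 ^ j"
proof -
  let ?d = "real CARD('d)"
  have "lat n - 2 ^ j *\<^sub>R diagonal = lat (n - centre (side j) (base j) k) + real (side j) *\<^sub>R lat k + (lat (base j) - 2 ^ j *\<^sub>R diagonal)"
    by (simp add: lat_centre)
  also have "norm \<dots> \<le> norm (lat (n - centre (side j) (base j) k)) + norm (real (side j) *\<^sub>R lat k) + norm (lat (base j) - 2 ^ j *\<^sub>R diagonal)"
    by (intro norm_triangle_le add_mono order_refl norm_triangle_ineq)
  also have "\<dots> \<le> real (side j) / 4 + real (side j) * (?d * 2 ^ depth j) + ?d"
  proof (intro add_mono n)
    have "norm (lat k) \<le> (\<Sum>i\<in>UNIV. \<bar>lat k $ i\<bar>)" by (rule norm_le_l1_cart)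
    also have "\<dots> \<le> (\<Sum>i\<in>(UNIV :: 'd set). 2 ^ depth j)"
    proof (rule sum_mono)
      fix i
      have "0 \<le> k $ i" "k $ i < int (2 ^ depth j)" using k by (auto simp: cube_def)
      then have "0 \<le> real_of_int (k $ i)" "real_of_int (k $ i) \<le> real_of_int (int (2 ^ depth j))"
        by linarith+
      then show "\<bar>lat k $ i\<bar> \<le> 2 ^ depth j" by simp
    qed
    finally show "norm (real (side j) *\<^sub>R lat k) \<le> real (side j) * (?d * 2 ^ depth j)"
      by (simp add: mult_left_mono)
    have "norm (lat (base j) - 2 ^ j *\<^sub>R diagonal) \<le> (\<Sum>i\<in>UNIV. \<bar>(lat (base j) - 2 ^ j *\<^sub>R diagonal) $ i\<bar>)"
      by (rule norm_le_l1_cart)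
    also have "\<dots> \<le> (\<Sum>i\<in>(UNIV :: 'd set). 1)"
    proof (rule sum_mono)
      fix i
      have "\<bar>of_int \<lfloor>y\<rfloor> - y\<bar> \<le> 1" for y :: real by linarith
      then show "\<bar>(lat (base j) - 2 ^ j *\<^sub>R diagonal) $ i\<bar> \<le> 1"
        by (simp add: base_def diagonal_def)
    qed
    finally show "norm (lat (base j) - 2 ^ j *\<^sub>R diagonal) \<le> ?d" by simp
  qed
  also have "\<dots> \<le> 2 powr (real j * \<rho>) * (1 / 4 + ?d) + ?d * (2 ^ depth j * real (side j))"
  proof -
    have "?d \<le> 2 powr (real j * \<rho>) * ?d"
    proof -
      have "1 \<le> 2 powr (real j * \<rho>)" using \<rho> by (intro ge_one_powr_ge_zero) auto
      from mult_right_mono[OF this, of ?d] show ?thesis by simp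
    qed
    moreover have "real (side j) * (?d * 2 ^ depth j) = ?d * (2 ^ depth j * real (side j))"
      by (simp add: mult_ac)
    moreover have "2 powr (real j * \<rho>) * (1 / 4 + ?d) = 2 powr (real j * \<rho>) / 4 + 2 powr (real j * \<rho>) * ?d"
      by (simp add: distrib_left)
    ultimately show ?thesis using side_bounds(2)[of j] by linarith
  qed
  also have "\<dots> \<le> 2 powr (real j * \<rho>) * (\<epsilon> / 2 * 2 powr (real j * (1 - \<rho>))) + ?d * (2 ^ j / 2 ^ c\<^sub>0)"
    by (intro add_mono mult_left_mono j0 width_bounds j) auto
  also have "\<dots> = \<epsilon> / 2 * 2 ^ j + ?d / 2 ^ c\<^sub>0 * 2 ^ j"
    using two_powr_split[of j] by (simp add: mult_ac)
  also have "\<dots> \<le> \<epsilon> / 2 * 2 ^ j + \<epsilon> / 2 * 2 ^ j"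
    by (intro add_mono mult_right_mono c0) auto
  finally show ?thesis by simp
qed

lemma blk_near:
  assumes j: "j\<^sub>0 \<le> j" and nz: "blk j n \<noteq> 0"
  shows "norm (lat n - 2 ^ j *\<^sub>R diagonal) \<le> \<epsilon> * 2 ^ j"
proof -
  interpret bump \<eta> "side j" by (rule bump)
  obtain k where k: "k \<in> cube (2 ^ depth j)" "norm (lat (n - centre (side j) (base j) k)) \<le> real (side j) / 8"
    using nz unfolding blk_def by (rule block_support)
  then have "norm (lat (n - centre (side j) (base j) k)) \<le> real (side j) / 4" by linarith
  then show ?thesis by (rule centre_near[OF j k(1)])
qed

lemma near_annulus:
  "norm (lat n - 2 ^ j *\<^sub>R (diagonal :: real ^ 'd)) \<le> \<epsilon> * 2 ^ j \<Longrightarrow> n \<in> annulus j"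
  using \<epsilon>(2) by (intro near_diagonal(2)) (auto elim!: order_trans)

text \<open>At every lattice point at most one summand is present.\<close>

definition osc :: "real \<Rightarrow> int ^ 'd \<Rightarrow> complex" where
  "osc m n = (\<Sum>j | j\<^sub>0 \<le> j \<and> blk j n \<noteq> 0. of_real (2 powr (real j * m)) * blk j n)"

lemma osc_annulus:
  assumes j: "j\<^sub>0 \<le> j" and n: "n \<in> annulus j"
  shows "osc m n = of_real (2 powr (real j * m)) * blk j n"
proof -
  have uniq: "j' = j" if "j\<^sub>0 \<le> j'" "blk j' n \<noteq> 0" for j'
    by (rule annulus_disjoint[OF near_annulus[OF blk_near[OF that]] n])
  show ?thesis
  proof (cases "blk j n = 0")
    case True
    then have "{j'. j\<^sub>0 \<le> j' \<and> blk j' n \<noteq> 0} = {}" using uniq by blast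
    then show ?thesis using True by (simp add: osc_def)
  next
    case False
    then have "{j'. j\<^sub>0 \<le> j' \<and> blk j' n \<noteq> 0} = {j}" using uniq j by blast
    then show ?thesis by (simp add: osc_def)
  qed
qed

lemma osc_nz:
  assumes "osc m n \<noteq> 0"
  shows "\<exists>j. j\<^sub>0 \<le> j \<and> blk j n \<noteq> 0"
proof (rule ccontr)
  assume "\<not> ?thesis"
  then have "{j. j\<^sub>0 \<le> j \<and> blk j n \<noteq> 0} = {}" by blast
  then show False using assms by (simp add: osc_def)
qed

lemma jbr_annulus:
  assumes "n \<in> annulus j"
  shows "2 ^ j / 2 \<le> jbr n" "jbr n \<le> 2 * 2 ^ j"
proof -
  have x: "7 / 8 * 2 ^ j \<le> norm (lat n)" "norm (lat n) \<le> 9 / 8 * 2 ^ j"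
    using assms by (auto simp: annulus_def)
  have "norm (lat n) \<le> jbr n" unfolding jbr_def by (rule real_le_rsqrt) simp
  then show "2 ^ j / 2 \<le> jbr n" using x by simp
  have "jbr n \<le> sqrt ((2 * 2 ^ j)\<^sup>2)"
    unfolding jbr_def
  proof (rule real_sqrt_le_mono)
    have "(norm (lat n))\<^sup>2 \<le> (9 / 8 * 2 ^ j)\<^sup>2" using x by (intro power_mono) auto
    also have "(9 / 8 * 2 ^ j)\<^sup>2 = 81 / 64 * ((2::real) ^ j)\<^sup>2" by (simp add: power_mult_distrib power_divide)
    finally have "(norm (lat n))\<^sup>2 \<le> 81 / 64 * ((2::real) ^ j)\<^sup>2" .
    moreover have "(1::real) \<le> (2 ^ j)\<^sup>2" by (intro one_le_power) simp
    moreover have "(2 * 2 ^ j)\<^sup>2 = 4 * ((2::real) ^ j)\<^sup>2" by (simp add: power_mult_distrib)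
    ultimately show "1 + (norm (lat n))\<^sup>2 \<le> (2 * 2 ^ j)\<^sup>2" by linarith
  qed
  then show "jbr n \<le> 2 * 2 ^ j" by (simp only: real_sqrt_abs) simp
qed

lemma jbr_ge_1: "1 \<le> jbr n"
  unfolding jbr_def by simp

lemma two_powr_le_jbr:
  assumes "n \<in> annulus j"
  shows "2 powr (real j * e) \<le> 2 powr \<bar>e\<bar> * jbr n powr e"
proof -
  have b: "2 ^ j / 2 \<le> jbr n" "jbr n \<le> 2 * 2 ^ j" and J: "0 < jbr n"
    using jbr_annulus[OF assms] jbr_ge_1[of n] by auto
  have p: "2 powr (real j * e) = (2 ^ j) powr e" by (simp add: powr_realpow[symmetric] powr_powr)
  show ?thesis
  proof (cases "0 \<le> e")
    case True
    have "(2 ^ j) powr e \<le> (2 * jbr n) powr e" using b True by (intro powr_mono2) auto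
    then show ?thesis using J True p by (simp add: powr_mult)
  next
    case False
    have "(2 ^ j) powr e \<le> (jbr n / 2) powr e" using b J False by (intro powr_mono2') auto
    also have "\<dots> = 2 powr (- e) * jbr n powr e" using J by (simp add: powr_divide powr_minus_divide)
    finally show ?thesis using False p by simp
  qed
qed

text \<open>Within distance \<open>M\<close> of a lattice point, the symbol either vanishes or is a single bump on
  a cell of side about \<open>2 powr (j * \<rho>)\<close>, whose differences of order \<open>M\<close> are as small as
  required. The exceptional lattice points, from which a difference of order \<open>M\<close> reaches across
  the gap between cells, belong to cells of side below \<open>16 * M\<close>; these are finitely many
  points.\<close>

lemma osc_differences:
  "\<exists>C. \<forall>js n. length js = M \<longrightarrow> norm (foldr diff_op js (osc m) n) \<le> C * jbr n powr (m - \<rho> * real M)"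
proof -
  let ?e = "m - \<rho> * real M"
  have van: "\<eta> x = 0" if "1 / 8 < norm x" for x
  proof (rule ccontr)
    assume "\<eta> x \<noteq> 0"
    then have "norm x \<le> 1 / 8" by (rule \<eta>_support)
    with that show False by simp
  qed
  obtain C1 where C1': "C1 > 0" "\<forall>js. length js = M \<longrightarrow> (\<forall>x. norm (foldr partial js \<eta> x) \<le> C1)"
  proof -
    have "\<exists>C>0. \<forall>js. length js = M \<longrightarrow> (\<forall>x. norm (foldr partial js \<eta> x) \<le> C)"
      by (rule smooth_compact_bounded[OF smooth_\<eta>]) (rule van)
    then show thesis using that by (elim exE conjE)
  qed
  then have C1: "0 < C1" "\<And>js x. length js = M \<Longrightarrow> norm (foldr partial js \<eta> x) \<le> C1" by simp_all
  \<comment> \<open>All exceptional lattice points lie in the ball of radius \<open>R\<close>; \<open>C2\<close> takes care of them.\<close>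
  define R where "R = 9 / 8 * (32 * real M) powr (1 / \<rho>) + real M"
  let ?N = "{n :: int ^ 'd. norm (lat n) \<le> R}" and ?JS = "{js :: 'd list. length js = M}"
  have finN: "finite ?N" by (rule lattice_ball) (simp add: R_def)
  have finJ: "finite ?JS" using finite_lists_length_eq[of "UNIV :: 'd set" M] by simp
  define C2 where "C2 = (\<Sum>(js, n)\<in>?JS \<times> ?N. norm (foldr diff_op js (osc m) n) / jbr n powr ?e)"
  define C where "C = max C2 (2 ^ M * C1 * 2 powr \<bar>?e\<bar>)"
  have J: "0 < jbr n powr ?e" for n :: "int ^ 'd" using jbr_ge_1[of n] by simp
  have "C1 > 0" by (rule C1)
  then have C0: "0 \<le> C" by (simp add: C_def le_max_iff_disj)
  have "norm (foldr diff_op js (osc m) n) \<le> C * jbr n powr ?e" if len: "length js = M" for js n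
  proof (cases "\<exists>n'. norm (lat (n' - n)) \<le> real M \<and> osc m n' \<noteq> 0")
    case False
    then have "foldr diff_op js (osc m) n = foldr diff_op js (\<lambda>n. 0) n"
      using len by (intro foldr_diff_op_local) auto
    then show ?thesis using C0 J[of n] by (simp add: foldr_diff_op_zero)
  next
    case True
    then obtain n' where n': "norm (lat (n' - n)) \<le> real M" "osc m n' \<noteq> 0" by blast
    obtain j where j: "j\<^sub>0 \<le> j" "blk j n' \<noteq> 0" using osc_nz[OF n'(2)] by blast
    interpret bump \<eta> "side j" by (rule bump)
    obtain k where k: "k \<in> cube (2 ^ depth j)" "norm (lat (n' - centre (side j) (base j) k)) \<le> real (side j) / 8"
      using j(2) unfolding blk_def by (rule block_support)
    let ?c = "centre (side j) (base j) k"
    show ?thesis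
    proof (cases "16 * real M \<le> real (side j)")
      case True
      have close: "norm (lat (n'' - ?c)) \<le> real (side j) / 4" if "norm (lat (n'' - n)) \<le> real M" for n''
      proof -
        have "lat (n'' - ?c) = lat (n'' - n) - lat (n' - n) + lat (n' - ?c)" by simp
        also have "norm \<dots> \<le> norm (lat (n'' - n)) + norm (lat (n' - n)) + norm (lat (n' - ?c))"
          by (intro norm_triangle_le add_mono norm_triangle_ineq4 order_refl)
        finally show ?thesis using that n'(1) k(2) True by linarith
      qed
      let ?h = "1 / real (side j)"
      let ?b = "- (?h *\<^sub>R lat ?c)"
      let ?s = "of_real (2 powr (real j * m)) * of_real (signs (depth j) k) :: complex"
      have eq: "osc m n'' = ?s * \<eta> (?h *\<^sub>R lat n'' + ?b)" if "norm (lat (n'' - n)) \<le> real M" for n''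
      proof -
        have "n'' \<in> annulus j" using centre_near[OF j(1) k(1) close[OF that]] by (rule near_annulus)
        then have "osc m n'' = of_real (2 powr (real j * m)) * blk j n''" by (rule osc_annulus[OF j(1)])
        also have "blk j n'' = of_real (signs (depth j) k) * \<eta> (?h *\<^sub>R lat (n'' - ?c))"
          unfolding blk_def by (rule block_eq_piece[OF k(1) close[OF that]])
        also have "?h *\<^sub>R lat (n'' - ?c) = ?h *\<^sub>R lat n'' + ?b" by (simp add: scaleR_diff_right)
        finally show ?thesis by simp
      qed
      have "foldr diff_op js (osc m) n = foldr diff_op js (\<lambda>n. ?s * \<eta> (?h *\<^sub>R lat n + ?b)) n"
        using len by (intro foldr_diff_op_local eq) simp
      also have "\<dots> = ?s * foldr diff_op js (\<lambda>n. \<eta> (?h *\<^sub>R lat n + ?b)) n"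
        by (rule foldr_diff_op_cmult)
      finally have "norm (foldr diff_op js (osc m) n) = 2 powr (real j * m) * norm (foldr diff_op js (\<lambda>n. \<eta> (?h *\<^sub>R lat n + ?b)) n)"
        by (simp add: norm_mult)
      also have "\<dots> \<le> 2 powr (real j * m) * (?h ^ M * C1)"
        by (intro mult_left_mono diff_sample_bound smooth_\<eta> C1 len) auto
      also have "?h ^ M \<le> (2 * 2 powr (- (real j * \<rho>))) ^ M"
      proof (rule power_mono)
        have "1 / real (side j) \<le> 1 / (2 powr (real j * \<rho>) / 2)"
          using side_bounds(3)[of j] by (rule divide_left_mono) (use L_pos in simp_all)
        also have "\<dots> = 2 * 2 powr (- (real j * \<rho>))" by (simp add: powr_minus_divide)
        finally show "1 / real (side j) \<le> 2 * 2 powr (- (real j * \<rho>))" .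
      qed simp
      also have "2 powr (real j * m) * ((2 * 2 powr (- (real j * \<rho>))) ^ M * C1) = 2 ^ M * C1 * 2 powr (real j * ?e)"
      proof -
        have "(2 powr (- (real j * \<rho>))) ^ M = 2 powr (- (real j * \<rho>) * real M)"
          by (simp add: powr_powr flip: powr_realpow)
        then show ?thesis by (simp add: power_mult_distrib algebra_simps flip: powr_add)
      qed
      also have "\<dots> \<le> 2 ^ M * C1 * (2 powr \<bar>?e\<bar> * jbr n powr ?e)"
      proof (intro mult_left_mono two_powr_le_jbr)
        have "norm (lat (n - n)) \<le> real M" by simp
        from centre_near[OF j(1) k(1) close[OF this]] show "n \<in> annulus j" by (rule near_annulus)
      qed (use \<open>C1 > 0\<close> in auto)
      also have "\<dots> \<le> C * jbr n powr ?e"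
        unfolding mult.assoc[symmetric] by (intro mult_right_mono) (auto simp: C_def)
      finally show ?thesis using \<open>C1 > 0\<close> by (simp add: mult_left_mono)
    next
      case False
      have "2 powr (real j * \<rho>) \<le> 32 * real M" using False side_bounds(3)[of j] by linarith
      then have "(2 powr (real j * \<rho>)) powr (1 / \<rho>) \<le> (32 * real M) powr (1 / \<rho>)"
        using \<rho> by (intro powr_mono2) auto
      then have "2 ^ j \<le> (32 * real M) powr (1 / \<rho>)" using \<rho> by (simp add: powr_powr powr_realpow)
      moreover have "norm (lat n') \<le> 9 / 8 * 2 ^ j"
        using near_annulus[OF blk_near[OF j]] by (simp add: annulus_def)
      moreover have "norm (lat n) \<le> norm (lat n') + norm (lat (n' - n))"
        using norm_triangle_ineq4[of "lat n'" "lat (n' - n)"] by simp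
      ultimately have "n \<in> ?N" using n'(1) unfolding R_def by simp
      then have "norm (foldr diff_op js (osc m) n) / jbr n powr ?e \<le> C2"
        unfolding C2_def
        using member_le_sum[of "(js, n)" "?JS \<times> ?N" "\<lambda>(js, n). norm (foldr diff_op js (osc m) n) / jbr n powr ?e"] len finN finJ J
        by (auto simp: less_imp_le)
      also have "C2 \<le> C" by (simp add: C_def)
      finally show ?thesis using J[of n] by (simp add: pos_divide_le_eq)
    qed
  qed
  then show ?thesis by blast
qed

lemma osc_symbol: "(\<lambda>x. osc m) \<in> tri_symbols m \<rho> \<delta>"
  by (rule multiplier_in_tri_symbols) (rule osc_differences)

end

section \<open>Estimates for the extremal functions\<close>

lemma Lnorm_le:
  assumes "0 < p" "p \<noteq> \<infinity>" and nn: "\<And>x. 0 \<le> G x" and "0 \<le> Y"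
    and int: "(\<integral>\<^sup>+x. ennreal (G x powr enn2real p) \<partial>torus) \<le> ennreal Y"
  shows "Lnorm p G \<le> ennreal (Y powr recip p)"
proof -
  note p = finite_exponent[OF assms(1,2)]
  have "Lnorm p G = epow (\<integral>\<^sup>+x. ennreal (G x powr enn2real p) \<partial>torus) (1 / enn2real p)"
    using assms(2) nn by (simp add: Lnorm_def Lp_qnorm_def epow_ennreal)
  also have "\<dots> \<le> epow (ennreal Y) (1 / enn2real p)" using p by (intro epow_mono int) simp
  finally show ?thesis using p \<open>0 \<le> Y\<close> by (simp add: epow_ennreal)
qed

lemma Lnorm_ge:
  assumes "0 < p" "p \<noteq> \<infinity>" and nn: "\<And>x. 0 \<le> G x" and "0 \<le> Y"
    and int: "ennreal Y \<le> (\<integral>\<^sup>+x. ennreal (G x powr enn2real p) \<partial>torus)"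
  shows "ennreal (Y powr recip p) \<le> Lnorm p G"
proof -
  note p = finite_exponent[OF assms(1,2)]
  have "ennreal (Y powr recip p) = epow (ennreal Y) (1 / enn2real p)"
    using p \<open>0 \<le> Y\<close> by (simp add: epow_ennreal)
  also have "\<dots> \<le> epow (\<integral>\<^sup>+x. ennreal (G x powr enn2real p) \<partial>torus) (1 / enn2real p)"
    using p by (intro epow_mono int) simp
  also have "\<dots> = Lnorm p G"
    using assms(2) nn by (simp add: Lnorm_def Lp_qnorm_def epow_ennreal)
  finally show ?thesis .
qed

lemma powr_split_le:
  fixes g S :: real
  assumes "0 \<le> g" "g \<le> S" "0 \<le> b" "a = b + c" "0 \<le> c"
  shows "g powr a \<le> S powr c * g powr b"
proof -
  have "g powr a = g powr c * g powr b" by (simp add: assms(4) powr_add)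
  also have "\<dots> \<le> S powr c * g powr b" using assms by (intro mult_right_mono powr_mono2) auto
  finally show ?thesis .
qed

text \<open>A function bounded by \<open>S\<close> interpolates between \<open>L\<^sup>b\<close> and the uniform norm.\<close>

lemma nn_integral_powr_split:
  fixes G :: "real ^ 'd::finite \<Rightarrow> real"
  assumes cont: "continuous_on UNIV G" and G: "\<And>x. 0 \<le> G x" "\<And>x. G x \<le> S" and "0 < b" "b \<le> a" "0 \<le> S"
  shows "(\<integral>\<^sup>+x. ennreal (G x powr a) \<partial>torus) \<le> ennreal (S powr (a - b)) * (\<integral>\<^sup>+x. ennreal (G x powr b) \<partial>torus)"
proof -
  have "(\<integral>\<^sup>+x. ennreal (G x powr a) \<partial>torus) \<le> (\<integral>\<^sup>+x. ennreal (S powr (a - b)) * ennreal (G x powr b) \<partial>torus)"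
    using powr_split_le[OF G, of b a "a - b"] assms
    by (intro nn_integral_mono) (simp flip: ennreal_mult)
  also have "\<dots> = ennreal (S powr (a - b)) * (\<integral>\<^sup>+x. ennreal (G x powr b) \<partial>torus)"
    by (intro nn_integral_cmult measurable_ennreal_torus continuous_on_powr' cont continuous_intros)
       (use assms in auto)
  finally show ?thesis .
qed

definition corner :: "real \<Rightarrow> (real ^ 'd) set" where
  "corner r = cbox 0 (\<chi> k. r)"

lemma corner_measure:
  assumes "0 \<le> r" "r \<le> 2 * pi"
  shows "(\<integral>\<^sup>+x. indicator (corner r) x \<partial>(torus :: (real ^ 'd::finite) measure)) = ennreal (r ^ CARD('d))"
proof -
  have "indicator (corner r) x = (\<Prod>k\<in>UNIV. indicator {0..r} (x $ k) :: ennreal)" for x :: "real ^ 'd"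
  proof (cases "x \<in> corner r")
    case False
    then obtain k where "x $ k \<notin> {0..r}" by (auto simp: corner_def mem_box_cart)
    then have "\<exists>k\<in>UNIV. (indicator {0..r} (x $ k) :: ennreal) = 0" by (auto intro!: exI[of _ k])
    then show ?thesis using False by (simp add: prod_zero)
  qed (auto simp: corner_def mem_box_cart)
  then have "(\<integral>\<^sup>+x. indicator (corner r) x \<partial>(torus :: (real ^ 'd) measure))
      = (\<integral>\<^sup>+t. indicator {0..r} t * indicator {0..2*pi} t \<partial>lborel) ^ CARD('d)"
    by (simp only:) (rule torus_nn_integral_prod, simp)
  also have "(\<lambda>t. indicator {0..r} t * indicator {0..2*pi} t :: ennreal) = indicator {0..r}"
    using assms by (auto simp: fun_eq_iff indicator_def)
  finally show ?thesis using assms by (simp add: ennreal_power)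
qed

lemma Lnorm_corner:
  fixes G :: "real ^ 'd::finite \<Rightarrow> real"
  assumes "0 < p" and nn: "\<And>x. 0 \<le> G x" and cont: "continuous_on UNIV G" and r: "0 < r" "r \<le> 2 * pi" and "0 \<le> Y"
    and low: "\<And>x. x \<in> corner r \<Longrightarrow> Y \<le> G x"
  shows "ennreal (Y * (r ^ CARD('d)) powr recip p) \<le> Lnorm p G"
proof (cases "p = \<infinity>")
  case True
  have "ennreal Y \<le> esssup torus (\<lambda>x. ennreal (G x))"
  proof (rule ccontr)
    assume *: "\<not> ?thesis"
    have "AE x in torus. ennreal (G x) \<le> esssup torus (\<lambda>x. ennreal (G x))" by (rule esssup_AE)
    then have "AE x in (torus :: (real ^ 'd) measure). indicator (corner r) x = (0 :: ennreal)"
    proof eventually_elim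
      case (elim x)
      then have "\<not> ennreal Y \<le> ennreal (G x)" using * by (meson order_trans)
      then have "\<not> Y \<le> G x" by (auto intro: ennreal_leI)
      then show ?case using low by (auto simp: indicator_def)
    qed
    then have "(\<integral>\<^sup>+x. indicator (corner r) x \<partial>(torus :: (real ^ 'd) measure)) = (\<integral>\<^sup>+x. 0 \<partial>(torus :: (real ^ 'd) measure))"
      by (rule nn_integral_cong_AE)
    then show False using r by (subst (asm) corner_measure) auto
  qed
  then show ?thesis using True r by (simp add: Lnorm_def Lp_qnorm_def)
next
  case False
  note p = finite_exponent[OF assms(1) False]
  have "ennreal (Y powr enn2real p * r ^ CARD('d)) = ennreal (Y powr enn2real p) * (\<integral>\<^sup>+x. indicator (corner r) x \<partial>(torus :: (real ^ 'd) measure))"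
    using r by (simp add: corner_measure ennreal_mult')
  also have "\<dots> = (\<integral>\<^sup>+x. ennreal (Y powr enn2real p) * indicator (corner r) x \<partial>(torus :: (real ^ 'd) measure))"
  proof (rule nn_integral_cmult[symmetric])
    have "corner r \<in> sets (borel :: (real ^ 'd) measure)" by (simp add: corner_def)
    then have "(indicator (corner r) :: real ^ 'd \<Rightarrow> ennreal) \<in> borel_measurable borel" by simp
    then show "(indicator (corner r) :: real ^ 'd \<Rightarrow> ennreal) \<in> borel_measurable torus"
      unfolding torus_def by (intro measurable_restrict_space1) simp
  qed
  also have "\<dots> \<le> (\<integral>\<^sup>+x. ennreal (G x powr enn2real p) \<partial>torus)"
    using low p \<open>0 \<le> Y\<close> by (intro nn_integral_mono) (auto simp: indicator_def intro!: ennreal_leI powr_mono2)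
  finally have "ennreal ((Y powr enn2real p * r ^ CARD('d)) powr recip p) \<le> Lnorm p G"
    by (intro Lnorm_ge assms(1) False nn) (use r in auto)
  then show ?thesis using p \<open>0 \<le> Y\<close> r by (simp add: powr_mult powr_powr)
qed

lemma Re_near_one:
  fixes a b c :: complex
  assumes "norm (a - 1) \<le> 1 / 8" "norm (b - 1) \<le> 1 / 8" "norm (c - 1) \<le> 1 / 8"
  shows "1 / 2 \<le> Re (a * b * c)"
proof -
  have b: "norm b \<le> 9 / 8" using assms(2) norm_triangle_ineq[of "b - 1" 1] by simp
  have c: "norm c \<le> 9 / 8" using assms(3) norm_triangle_ineq[of "c - 1" 1] by simp
  have "a * b * c - 1 = (a - 1) * (b * c) + ((b - 1) * c + (c - 1))" by (simp add: algebra_simps)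
  also have "norm \<dots> \<le> norm ((a - 1) * (b * c)) + (norm ((b - 1) * c) + norm (c - 1))"
    by (intro norm_triangle_mono norm_triangle_ineq order_refl)
  also have "\<dots> \<le> 1 / 8 * (9 / 8 * (9 / 8)) + (1 / 8 * (9 / 8) + 1 / 8)"
    unfolding norm_mult using assms b c by (intro add_mono mult_mono) auto
  finally have "norm (a * b * c - 1) \<le> 1 / 2" by simp
  moreover have "\<bar>Re (a * b * c - 1)\<bar> \<le> norm (a * b * c - 1)" by (rule abs_Re_le_cmod)
  ultimately show ?thesis by simp
qed

context oscillation
begin

definition profile :: "real ^ 'd \<Rightarrow> complex" where
  "profile \<xi> = \<phi>\<^sub>0 ((2 / window_radius TYPE('d)) *\<^sub>R \<xi> + - ((2 / window_radius TYPE('d)) *\<^sub>R diagonal))"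

text \<open>The smooth window that is used as test function at scale \<open>2 ^ j\<close>; it is close to one where
  the multiplier lives.\<close>

definition win :: "nat \<Rightarrow> int ^ 'd \<Rightarrow> complex" where
  "win j n = profile ((1 / 2 ^ j) *\<^sub>R lat n)"

lemma wr_pos: "0 < window_radius TYPE('d)" by (rule window_radius_pos)

lemma rescale: "(2 / window_radius TYPE('d)) *\<^sub>R \<xi> + - ((2 / window_radius TYPE('d)) *\<^sub>R diagonal) = (2 / window_radius TYPE('d)) *\<^sub>R (\<xi> - (diagonal :: real ^ 'd))"
  by (simp add: scaleR_diff_right)

lemma unscale: "norm ((1 / 2 ^ j) *\<^sub>R lat n - (diagonal :: real ^ 'd)) = norm (lat n - 2 ^ j *\<^sub>R diagonal) / 2 ^ j"
proof -
  have "(1 / 2 ^ j) *\<^sub>R lat n - (diagonal :: real ^ 'd) = (1 / 2 ^ j) *\<^sub>R (lat n - 2 ^ j *\<^sub>R diagonal)"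
    by (simp add: scaleR_diff_right)
  then show ?thesis by simp
qed

lemma profile_support:
  assumes "profile \<xi> \<noteq> 0"
  shows "norm (\<xi> - diagonal) \<le> window_radius TYPE('d)"
proof -
  have "norm ((2 / window_radius TYPE('d)) *\<^sub>R (\<xi> - diagonal)) \<le> 2"
    using assms unfolding profile_def rescale by (rule lp_resolution_support(1)[OF res])
  then show ?thesis using wr_pos by (simp only: norm_scaleR) (simp add: field_simps)
qed

lemma smooth_profile: "smooth profile"
  unfolding profile_def[abs_def] by (rule smooth_affine) (use res in \<open>simp add: lp_resolution_def\<close>)

lemma win_support:
  assumes "win j n \<noteq> 0"
  shows "n \<in> nonneg_lat" "n \<in> annulus j"
proof -
  have "norm ((1 / 2 ^ j) *\<^sub>R lat n - diagonal) \<le> window_radius TYPE('d)"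
    using assms unfolding win_def by (rule profile_support)
  then have "norm (lat n - 2 ^ j *\<^sub>R diagonal) \<le> window_radius TYPE('d) * 2 ^ j" by (simp add: unscale pos_divide_le_eq)
  then show "n \<in> nonneg_lat" "n \<in> annulus j" by (rule near_diagonal)+
qed

lemma win_ball: "win j n \<noteq> 0 \<Longrightarrow> norm (lat n) \<le> 2 * 2 ^ j"
  using win_support(2)[of j n] by (auto simp: annulus_def intro: order_trans)

lemma finite_win: "finite {n. win j n \<noteq> 0}"
  by (rule finite_subset[OF _ lattice_ball(1)[of "2 * 2 ^ j"]]) (use win_ball in auto)

lemma near_one:
  assumes j: "j\<^sub>0 \<le> j" and b: "blk j n \<noteq> 0"
  shows "norm (lp_cutoff \<phi>\<^sub>0 \<phi> j (lat n) - 1) \<le> 1 / 8" "norm (win j n - 1) \<le> 1 / 8"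
proof -
  have near: "norm ((1 / 2 ^ j) *\<^sub>R lat n - diagonal) \<le> \<epsilon>"
    using blk_near[OF j b] by (simp add: unscale pos_divide_le_eq)
  have "j \<noteq> 0" using j j0(1) by simp
  then show "norm (lp_cutoff \<phi>\<^sub>0 \<phi> j (lat n) - 1) \<le> 1 / 8"
    using \<epsilon>(4)[OF near] by (simp add: lp_cutoff_def)
  have "norm ((2 / window_radius TYPE('d)) *\<^sub>R ((1 / 2 ^ j) *\<^sub>R lat n - (diagonal :: real ^ 'd))) = (2 / window_radius TYPE('d)) * norm ((1 / 2 ^ j) *\<^sub>R lat n - (diagonal :: real ^ 'd))"
    using wr_pos by simp
  also have "\<dots> \<le> (2 / window_radius TYPE('d)) * \<epsilon>"
    using near wr_pos by (intro mult_left_mono) auto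
  also have "\<dots> \<le> r\<^sub>0" using \<epsilon>(3) by (simp add: mult.commute)
  finally show "norm (win j n - 1) \<le> 1 / 8"
    using r0(2) unfolding win_def profile_def rescale by blast
qed

lemma half_le_norm: "norm (z - 1) \<le> 1 / 8 \<Longrightarrow> 7 / 8 \<le> norm z" for z :: complex
  using norm_triangle_ineq2[of 1 "1 - z"] by (simp add: norm_minus_commute)

text \<open>The dilations \<open>2\<close>, \<open>1\<close> and \<open>1 / 2\<close> of \<open>\<phi>\<close> are the cutoffs number \<open>j - 1\<close>, \<open>j\<close> and
  \<open>j + 1\<close> in units of \<open>2 ^ j\<close>. Products of these with the window are therefore samples of three
  fixed functions.\<close>

definition \<Theta> :: "real \<Rightarrow> real ^ 'd \<Rightarrow> complex" where
  "\<Theta> \<tau> \<xi> = \<phi> (\<tau> *\<^sub>R \<xi> + 0) * profile \<xi>"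

lemma smooth_\<Theta>: "smooth (\<Theta> \<tau>)"
  unfolding \<Theta>_def[abs_def] using res smooth_affine[of \<phi> \<tau> 0]
  by (intro smooth_mult smooth_profile) (simp_all add: lp_resolution_def)

lemma \<Theta>_vanish: "norm \<xi> > 2 \<Longrightarrow> \<Theta> \<tau> \<xi> = 0"
proof (rule ccontr)
  assume "norm \<xi> > 2" "\<Theta> \<tau> \<xi> \<noteq> 0"
  then have "norm (\<xi> - diagonal) \<le> window_radius TYPE('d)" using profile_support by (auto simp: \<Theta>_def)
  moreover have "norm \<xi> \<le> norm (\<xi> - diagonal) + norm (diagonal :: real ^ 'd)"
    using norm_triangle_ineq[of "\<xi> - diagonal" diagonal] by simp
  moreover have "window_radius TYPE('d) \<le> 1" by (simp add: window_radius_def min_le_iff_disj)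
  ultimately show False using \<open>norm \<xi> > 2\<close> by (simp add: norm_diagonal)
qed

lemma cutoff_win:
  assumes "j\<^sub>0 \<le> j" "i \<in> {j - 1, j, j + 1}"
  shows "\<exists>\<tau>\<in>{2, 1, 1 / 2}. \<forall>n. lp_cutoff \<phi>\<^sub>0 \<phi> i (lat n) * win j n = \<Theta> \<tau> ((1 / 2 ^ j) *\<^sub>R lat n)"
proof -
  obtain l where l: "j = Suc l" "l \<noteq> 0" using assms(1) j0(1) by (cases j) auto
  consider "i = l" | "i = j" | "i = Suc j" using assms(2) l by auto
  then show ?thesis
  proof cases
    case 1
    then show ?thesis using l by (intro bexI[of _ 2]) (auto simp: lp_cutoff_def win_def \<Theta>_def)
  next
    case 2
    then show ?thesis using l by (intro bexI[of _ 1]) (auto simp: lp_cutoff_def win_def \<Theta>_def)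
  next
    case 3
    then show ?thesis by (intro bexI[of _ "1 / 2"]) (auto simp: lp_cutoff_def win_def \<Theta>_def mult.commute)
  qed
qed

lemma window_kernel:
  "\<exists>E>0. \<forall>j i x. j\<^sub>0 \<le> j \<longrightarrow> i \<in> {j - 1, j, j + 1} \<longrightarrow> decay (2 ^ j) x ^ M * lp_size \<phi>\<^sub>0 \<phi> i (win j) x \<le> E * (2 ^ j) ^ CARD('d)"
proof -
  have "\<exists>E>0. \<forall>R\<ge>1. \<forall>x. decay R x ^ M * norm (tpoly (\<lambda>n. \<Theta> \<tau> ((1 / R) *\<^sub>R lat n)) x) \<le> E * R ^ CARD('d)" for \<tau>
    by (rule kernel_pointwise[OF smooth_\<Theta>, of 2]) (use \<Theta>_vanish in auto)
  then obtain E where E: "\<And>\<tau>. 0 < E \<tau>" "\<And>\<tau> R x. R \<ge> 1 \<Longrightarrow> decay R x ^ M * norm (tpoly (\<lambda>n. \<Theta> \<tau> ((1 / R) *\<^sub>R lat n)) x) \<le> E \<tau> * R ^ CARD('d)"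
    by metis
  have "decay (2 ^ j) x ^ M * lp_size \<phi>\<^sub>0 \<phi> i (win j) x \<le> (E 2 + E 1 + E (1 / 2)) * (2 ^ j) ^ CARD('d)"
    if j: "j\<^sub>0 \<le> j" and i: "i \<in> {j - 1, j, j + 1}" for j i x
  proof -
    obtain \<tau> where \<tau>: "\<tau> \<in> {2, 1, 1 / 2}" "\<And>n. lp_cutoff \<phi>\<^sub>0 \<phi> i (lat n) * win j n = \<Theta> \<tau> ((1 / 2 ^ j) *\<^sub>R lat n)"
      using cutoff_win[OF j i] by blast
    have "decay (2 ^ j) x ^ M * lp_size \<phi>\<^sub>0 \<phi> i (win j) x \<le> E \<tau> * (2 ^ j) ^ CARD('d)"
      unfolding lp_size_def \<tau>(2) by (rule E(2)) simp
    also have "E \<tau> \<le> E 2 + E 1 + E (1 / 2)"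
      using \<tau>(1) E(1)[of 2] E(1)[of 1] E(1)[of "1 / 2"] by (elim insertE emptyE) (simp_all only:; linarith)+
    finally show ?thesis by (simp add: mult_right_mono)
  qed
  moreover have "0 < E 2 + E 1 + E (1 / 2)" using E(1) by (simp add: add_pos_pos)
  ultimately show ?thesis by blast
qed

lemma window_L1:
  "\<exists>E>0. \<forall>j i. j\<^sub>0 \<le> j \<longrightarrow> i \<in> {j - 1, j, j + 1} \<longrightarrow> (\<integral>\<^sup>+x. ennreal (lp_size \<phi>\<^sub>0 \<phi> i (win j) x) \<partial>torus) \<le> ennreal E"
proof -
  obtain E where E: "0 < E" "\<And>j i x. j\<^sub>0 \<le> j \<Longrightarrow> i \<in> {j - 1, j, j + 1} \<Longrightarrow> decay (2 ^ j) x ^ 2 * lp_size \<phi>\<^sub>0 \<phi> i (win j) x \<le> E * (2 ^ j) ^ CARD('d)"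
    using window_kernel[of 2] by metis
  have "(\<integral>\<^sup>+x. ennreal (lp_size \<phi>\<^sub>0 \<phi> i (win j) x) \<partial>torus) \<le> ennreal (E * (4 * pi) ^ CARD('d))"
    if "j\<^sub>0 \<le> j" "i \<in> {j - 1, j, j + 1}" for j i
  proof -
    have "(\<integral>\<^sup>+x. ennreal (lp_size \<phi>\<^sub>0 \<phi> i (win j) x powr 1) \<partial>torus)
        \<le> ennreal ((E * (2 ^ j) ^ CARD('d)) powr 1 * (4 * pi / 2 ^ j) ^ CARD('d))"
      by (rule decay_Lr[where M = 2]) (use E that in auto)
    then show ?thesis using E(1) by (simp add: power_divide)
  qed
  then show ?thesis using E(1) by (intro exI[of _ "E * (4 * pi) ^ CARD('d)"]) auto
qed

lemma \<eta>_bounded: "\<exists>C>0. \<forall>\<xi>. norm (\<eta> \<xi>) \<le> C"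
proof -
  have "\<exists>C>0. \<forall>js. length js = 0 \<longrightarrow> (\<forall>x. norm (foldr partial js \<eta> x) \<le> C)"
  proof (rule smooth_compact_bounded[OF smooth_\<eta>, where r = "1 / 8"])
    show "\<eta> x = 0" if "1 / 8 < norm x" for x using \<eta>_support[of x] that by (cases "\<eta> x = 0") auto
  qed
  then show ?thesis by auto
qed

text \<open>With \<open>R = 2 ^ j\<close> and cells of side \<open>L\<close>, the square root of the number \<open>(R / L) ^ d\<close> of
  cells times the size \<open>L ^ d\<close> of one cell is \<open>(R * L) powr (d / 2)\<close>, and \<open>L\<close> is about
  \<open>R powr \<rho>\<close>.\<close>

lemma blk_kernel:
  "\<exists>C>0. \<forall>j x. j\<^sub>0 \<le> j \<longrightarrow>
     norm (tpoly (blk j) x) \<le> C * 2 powr (real j * ((1 + \<rho>) * real CARD('d) / 2)) \<and>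
     norm (tpoly (\<lambda>n. cnj (blk j n)) x) \<le> C * 2 powr (real j * ((1 + \<rho>) * real CARD('d) / 2))"
proof -
  let ?d = "CARD('d)"
  obtain C where C: "0 < C" "\<And>\<xi>. norm (\<eta> \<xi>) \<le> C" using \<eta>_bounded by blast
  have size: "sqrt (2 * 2 ^ depth j) ^ ?d * ((2 * real (side j)) ^ ?d * C) \<le> 4 ^ ?d * C * 2 powr (real j * ((1 + \<rho>) * real ?d / 2))"
    if j: "j\<^sub>0 \<le> j" for j
  proof -
    have "(sqrt (2 * 2 ^ depth j) * (2 * real (side j)))\<^sup>2 = 8 * (2 ^ depth j * real (side j)) * real (side j)"
      by (simp add: power_mult_distrib power2_eq_square)
    also have "\<dots> \<le> 8 * 2 ^ j * 2 powr (real j * \<rho>)"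
    proof (rule mult_mono)
      have "(2::real) ^ j / 2 ^ c\<^sub>0 \<le> 2 ^ j / 1" by (intro divide_left_mono) auto
      then show "8 * (2 ^ depth j * real (side j)) \<le> 8 * 2 ^ j" using width_bounds(1)[OF j] by simp
    qed (use side_bounds in auto)
    also have "\<dots> \<le> 16 * 2 powr (real j * (1 + \<rho>))"
      by (simp add: distrib_left powr_add powr_realpow)
    also have "\<dots> = (4 * 2 powr (real j * (1 + \<rho>) / 2))\<^sup>2"
      by (simp add: power_mult_distrib power2_eq_square flip: powr_add)
    finally have "sqrt (2 * 2 ^ depth j) * (2 * real (side j)) \<le> 4 * 2 powr (real j * (1 + \<rho>) / 2)"
      by (rule power2_le_imp_le) simp
    then have "(sqrt (2 * 2 ^ depth j) * (2 * real (side j))) ^ ?d \<le> (4 * 2 powr (real j * (1 + \<rho>) / 2)) ^ ?d"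
      by (intro power_mono) auto
    also have "\<dots> = 4 ^ ?d * 2 powr (real j * ((1 + \<rho>) * real ?d / 2))"
    proof -
      have "(2 powr (real j * (1 + \<rho>) / 2)) ^ ?d = 2 powr (real j * (1 + \<rho>) / 2 * real ?d)"
        by (simp add: powr_powr flip: powr_realpow)
      then show ?thesis by (simp add: power_mult_distrib mult_ac)
    qed
    finally have "(sqrt (2 * 2 ^ depth j) * (2 * real (side j))) ^ ?d * C \<le> 4 ^ ?d * 2 powr (real j * ((1 + \<rho>) * real ?d / 2)) * C"
      using C(1) by (intro mult_right_mono) auto
    then show ?thesis by (simp add: power_mult_distrib mult_ac)
  qed
  have "norm (tpoly (blk j) x) \<le> 4 ^ ?d * C * 2 powr (real j * ((1 + \<rho>) * real ?d / 2)) \<and>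
     norm (tpoly (\<lambda>n. cnj (blk j n)) x) \<le> 4 ^ ?d * C * 2 powr (real j * ((1 + \<rho>) * real ?d / 2))" if j: "j\<^sub>0 \<le> j" for j x
  proof
    interpret b: bump \<eta> "side j" by (rule bump)
    interpret c: bump "\<lambda>\<xi>. cnj (\<eta> \<xi>)" "side j" using b.supp b.L_pos by unfold_locales auto
    show "norm (tpoly (blk j) x) \<le> 4 ^ ?d * C * 2 powr (real j * ((1 + \<rho>) * real ?d / 2))"
      unfolding blk_def by (rule order_trans[OF b.block_kernel_bound[OF C(2)] size[OF j]])
    have "(\<lambda>n. cnj (blk j n)) = block (\<lambda>\<xi>. cnj (\<eta> \<xi>)) (depth j) (side j) (base j)"
      by (auto simp: blk_def cnj_block)
    moreover have "norm (cnj (\<eta> \<xi>)) \<le> C" for \<xi> using C(2) by simp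
    ultimately show "norm (tpoly (\<lambda>n. cnj (blk j n)) x) \<le> 4 ^ ?d * C * 2 powr (real j * ((1 + \<rho>) * real ?d / 2))"
      using order_trans[OF c.block_kernel_bound size[OF j]] by simp
  qed
  then show ?thesis using C(1) by (intro exI[of _ "4 ^ ?d * C"]) auto
qed

lemma finite_blk: "finite {n. blk j n \<noteq> 0}"
proof -
  interpret bump \<eta> "side j" by (rule bump)
  show ?thesis unfolding blk_def by (rule finite_block_support)
qed

lemma blk_mass: "\<exists>c>0. \<forall>j. j\<^sub>0 \<le> j \<longrightarrow> c * 2 powr (real j * real CARD('d)) \<le> (\<Sum>n | blk j n \<noteq> 0. (norm (blk j n))\<^sup>2)"
proof -
  let ?d = "CARD('d)"
  let ?r = "r\<^sub>0 / 16"
  define c where "c = (1 / 4) * (?r / (real ?d * (4 * 2 ^ c\<^sub>0))) ^ ?d"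
  have "c > 0" using r0(1) by (simp add: c_def)
  moreover have "c * 2 powr (real j * real ?d) \<le> (\<Sum>n | blk j n \<noteq> 0. (norm (blk j n))\<^sup>2)" if j: "j\<^sub>0 \<le> j" for j
  proof -
    interpret bump \<eta> "side j" by (rule bump)
    have half: "1 / 2 \<le> norm (\<eta> \<xi>)" if "norm \<xi> \<le> ?r" for \<xi>
      using half_le_norm[OF r0(2)[of "16 *\<^sub>R \<xi>"]] that by (simp add: \<eta>_def)
    have "c * 2 powr (real j * real ?d) = (1 / 4) * (?r / real ?d * (2 ^ j / (4 * 2 ^ c\<^sub>0))) ^ ?d"
      by (simp add: c_def power_mult_distrib power_divide powr_realpow[symmetric] powr_powr)
    also have "\<dots> \<le> (1 / 4) * (?r / real ?d * (2 ^ depth j * real (side j))) ^ ?d"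
      using r0(1) width_bounds(2)[OF j] by (intro mult_left_mono power_mono) auto
    also have "?r / real ?d * (2 ^ depth j * real (side j)) = 2 ^ depth j * (?r * real (side j) / real ?d)"
      by simp
    also have "(1 / 4) * \<dots> ^ ?d \<le> (\<Sum>n | blk j n \<noteq> 0. (norm (blk j n))\<^sup>2)"
      unfolding blk_def using r0(1) by (intro block_mass half) auto
    finally show ?thesis .
  qed
  ultimately show ?thesis by blast
qed

lemma osc_mult:
  assumes "j\<^sub>0 \<le> j" "\<And>n. f n \<noteq> 0 \<Longrightarrow> n \<in> annulus j"
  shows "lp_size \<phi>\<^sub>0 \<phi> j (\<lambda>n. osc m n * f n) x = 2 powr (real j * m) * lp_size \<phi>\<^sub>0 \<phi> j (\<lambda>n. blk j n * f n) x"
proof -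
  have "lp_cutoff \<phi>\<^sub>0 \<phi> j (lat n) * (osc m n * f n) = of_real (2 powr (real j * m)) * (lp_cutoff \<phi>\<^sub>0 \<phi> j (lat n) * (blk j n * f n))" for n
    using osc_annulus[OF assms(1) assms(2)] by (cases "f n = 0") (auto simp: mult_ac)
  from lp_size_cong[OF this] show ?thesis by simp
qed

lemma Lnorm_osc:
  assumes "j\<^sub>0 \<le> j" "\<And>n. f n \<noteq> 0 \<Longrightarrow> n \<in> annulus j" "0 < p"
  shows "Lnorm p (lp_size \<phi>\<^sub>0 \<phi> j (\<lambda>n. osc m n * f n)) = ennreal (2 powr (real j * m)) * Lnorm p (lp_size \<phi>\<^sub>0 \<phi> j (\<lambda>n. blk j n * f n))"
proof -
  have "lp_size \<phi>\<^sub>0 \<phi> j (\<lambda>n. osc m n * f n) = (\<lambda>x. 2 powr (real j * m) * lp_size \<phi>\<^sub>0 \<phi> j (\<lambda>n. blk j n * f n) x)"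
    using osc_mult[OF assms(1,2)] by blast
  then show ?thesis using assms(3) by (simp add: Lnorm_scale continuous_on_lp_size)
qed

text \<open>It suffices to know all quantities up to constants as powers of \<open>2 ^ j\<close>; the order \<open>m\<close> of
  the symbol is a mere factor at each scale.\<close>

lemma extremalI:
  assumes p: "0 < p" and bg: "0 < b" "0 < g"
    and v: "\<And>j n. j\<^sub>0 \<le> j \<Longrightarrow> v j n \<noteq> 0 \<Longrightarrow> win j n \<noteq> 0"
    and upper: "\<And>j. j\<^sub>0 \<le> j \<Longrightarrow> Lnorm p (\<lambda>x. \<Sum>i\<in>{j - 1, j, j + 1}. lp_size \<phi>\<^sub>0 \<phi> i (v j) x) \<le> ennreal (b * 2 powr (real j * e))"
    and lower: "\<And>j. j\<^sub>0 \<le> j \<Longrightarrow> ennreal (g * 2 powr (real j * (\<sigma> + e))) \<le> Lnorm p (lp_size \<phi>\<^sub>0 \<phi> j (\<lambda>n. blk j n * v j n))"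
  shows "extremal \<phi>\<^sub>0 \<phi> (osc m) v (\<lambda>j. b * 2 powr (real j * e)) (g / b) (m + \<sigma>) p j\<^sub>0"
proof
  show "lp_resolution \<phi>\<^sub>0 \<phi>" by (rule res)
  show "0 < p" "0 < g / b" "3 \<le> j\<^sub>0" using p bg j0 by auto
  fix j assume j: "j\<^sub>0 \<le> j"
  show "finite {n. v j n \<noteq> 0}" by (rule finite_subset[OF _ finite_win[of j]]) (use v[OF j] in auto)
  show "n \<in> nonneg_lat \<and> n \<in> annulus j" if "v j n \<noteq> 0" for n
    using win_support v[OF j that] by blast
  show "0 < b * 2 powr (real j * e)" using bg by simp
  show "Lnorm p (\<lambda>x. \<Sum>i\<in>{j - 1, j, j + 1}. lp_size \<phi>\<^sub>0 \<phi> i (v j) x) \<le> ennreal (b * 2 powr (real j * e))"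
    by (rule upper[OF j])
  have "ennreal (g / b * 2 powr (real j * (m + \<sigma>)) * (b * 2 powr (real j * e)))
      = ennreal (2 powr (real j * m)) * ennreal (g * 2 powr (real j * (\<sigma> + e)))"
    using bg by (simp add: distrib_left powr_add mult_ac flip: ennreal_mult)
  also have "\<dots> \<le> ennreal (2 powr (real j * m)) * Lnorm p (lp_size \<phi>\<^sub>0 \<phi> j (\<lambda>n. blk j n * v j n))"
    by (intro mult_left_mono lower[OF j]) simp
  also have "\<dots> = Lnorm p (lp_size \<phi>\<^sub>0 \<phi> j (\<lambda>n. osc m n * v j n))"
    using win_support(2) v[OF j] by (intro Lnorm_osc[symmetric] j p) blast
  finally show "ennreal (g / b * 2 powr (real j * (m + \<sigma>)) * (b * 2 powr (real j * e)))
      \<le> Lnorm p (lp_size \<phi>\<^sub>0 \<phi> j (\<lambda>n. osc m n * v j n))" .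
qed

text \<open>The Littlewood--Paley blocks of the windowed multiplier are convolutions of its flat kernel
  with kernels that are bounded in \<open>L\<^sup>1\<close> uniformly in the scale.\<close>

lemma flat_size:
  "\<exists>S>0. \<forall>j i x. j\<^sub>0 \<le> j \<longrightarrow> i \<in> {j - 1, j, j + 1} \<longrightarrow>
     lp_size \<phi>\<^sub>0 \<phi> i (\<lambda>n. blk j n * win j n) x \<le> S * 2 powr (real j * ((1 + \<rho>) * real CARD('d) / 2)) \<and>
     lp_size \<phi>\<^sub>0 \<phi> i (\<lambda>n. win j n * cnj (blk j n)) x \<le> S * 2 powr (real j * ((1 + \<rho>) * real CARD('d) / 2))"
proof -
  obtain C where C: "0 < C" "\<And>j x. j\<^sub>0 \<le> j \<Longrightarrow> norm (tpoly (blk j) x) \<le> C * 2 powr (real j * ((1 + \<rho>) * real CARD('d) / 2))"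
     "\<And>j x. j\<^sub>0 \<le> j \<Longrightarrow> norm (tpoly (\<lambda>n. cnj (blk j n)) x) \<le> C * 2 powr (real j * ((1 + \<rho>) * real CARD('d) / 2))"
    using blk_kernel by blast
  obtain E where E: "0 < E" "\<And>j i. j\<^sub>0 \<le> j \<Longrightarrow> i \<in> {j - 1, j, j + 1} \<Longrightarrow> (\<integral>\<^sup>+x. ennreal (lp_size \<phi>\<^sub>0 \<phi> i (win j) x) \<partial>torus) \<le> ennreal E"
    using window_L1 by metis
  have "norm (tpoly (\<lambda>n. lp_cutoff \<phi>\<^sub>0 \<phi> i (lat n) * win j n * f n) x) \<le> (C * 2 powr (real j * ((1 + \<rho>) * real CARD('d) / 2))) * E"
    if j: "j\<^sub>0 \<le> j" and i: "i \<in> {j - 1, j, j + 1}" and f: "finite {n. f n \<noteq> 0}"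
      "\<And>x. norm (tpoly f x) \<le> C * 2 powr (real j * ((1 + \<rho>) * real CARD('d) / 2))" for j i f x
  proof (rule tpoly_mult_bound[OF f(1) _ f(2)])
    show "finite {n. lp_cutoff \<phi>\<^sub>0 \<phi> i (lat n) * win j n \<noteq> 0}" by (rule finite_subset[OF _ finite_win[of j]]) auto
    show "(\<integral>\<^sup>+x. ennreal (norm (tpoly (\<lambda>n. lp_cutoff \<phi>\<^sub>0 \<phi> i (lat n) * win j n) x)) \<partial>torus) \<le> ennreal E"
      using E(2)[OF j i] by (simp add: lp_size_def)
  qed (use E in auto)
  from this[OF _ _ finite_blk C(2)] this[of _ _ "\<lambda>n. cnj (blk _ n)", OF _ _ _ C(3)]
  show ?thesis using C(1) E(1) finite_blk
    by (intro exI[of _ "C * E"]) (simp add: lp_size_def mult_ac)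
qed

text \<open>For \<open>p < 2\<close> the input is the window itself, a kernel concentrated near the origin. The output
  is flat: its uniform norm is at most some small \<open>S\<close> although its \<open>L\<^sup>2\<close> norm is that of the
  input, up to constants. The square of the \<open>L\<^sup>2\<close> norm is at most \<open>S powr (2 - p)\<close> times the
  integral of the power \<open>p\<close>, and so the latter has to be large.\<close>

lemma extremal_small:
  assumes p: "0 < p" "p < 2"
  shows "\<exists>v B \<gamma>. extremal \<phi>\<^sub>0 \<phi> (osc m) v B \<gamma> (m + sigma_loss CARD('d) p \<rho>) p j\<^sub>0"
proof -
  let ?d = "real CARD('d)"
  have pinf: "p \<noteq> \<infinity>" using p by auto
  note P = finite_exponent[OF p(1) pinf]
  let ?P = "enn2real p"
  have P2: "?P < 2" using p(2) P(3) by (metis ennreal_less_iff ennreal_numeral enn2real_nonneg)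
  have \<sigma>: "sigma_loss CARD('d) p \<rho> = ?d * (1 - \<rho>) * (1 / ?P - 1 / 2)"
  proof -
    have "1 / 2 \<le> 1 / ?P" using P(1) P2 by (simp add: field_simps)
    then show ?thesis using P(2) by (simp add: sigma_loss_def recip_def)
  qed
  obtain M :: nat where M: "2 / ?P \<le> real M" using real_arch_simple by blast
  then have M2: "2 \<le> real M * ?P" using P(1) by (simp add: field_simps)
  obtain E where E: "0 < E" "\<And>j i x. j\<^sub>0 \<le> j \<Longrightarrow> i \<in> {j - 1, j, j + 1} \<Longrightarrow> decay (2 ^ j) x ^ M * lp_size \<phi>\<^sub>0 \<phi> i (win j) x \<le> E * (2 ^ j) ^ CARD('d)"
    using window_kernel[of M] by metis
  obtain S where S: "0 < S" "\<And>j i x. j\<^sub>0 \<le> j \<Longrightarrow> i \<in> {j - 1, j, j + 1} \<Longrightarrow>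
     lp_size \<phi>\<^sub>0 \<phi> i (\<lambda>n. blk j n * win j n) x \<le> S * 2 powr (real j * ((1 + \<rho>) * ?d / 2))"
    using flat_size by blast
  obtain c where c: "0 < c" "\<And>j. j\<^sub>0 \<le> j \<Longrightarrow> c * 2 powr (real j * ?d) \<le> (\<Sum>n | blk j n \<noteq> 0. (norm (blk j n))\<^sup>2)"
    using blk_mass by blast
  define b where "b = 3 * E * ((4 * pi) powr ?d) powr (1 / ?P)"
  define g where "g = (S powr (?P - 2) * (c / 4)) powr (1 / ?P)"
  let ?e = "?d - ?d / ?P"
  have "extremal \<phi>\<^sub>0 \<phi> (osc m) win (\<lambda>j. b * 2 powr (real j * ?e)) (g / b) (m + sigma_loss CARD('d) p \<rho>) p j\<^sub>0"
  proof (rule extremalI[OF p(1)])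
    show "0 < b" "0 < g" using E S c by (auto simp: b_def g_def)
    fix j assume j: "j\<^sub>0 \<le> j"
    let ?G = "\<lambda>x. \<Sum>i\<in>{j - 1, j, j + 1}. lp_size \<phi>\<^sub>0 \<phi> i (win j) x"
    let ?A = "3 * E * (2 ^ j) ^ CARD('d)"
    have dist: "card {j - 1, j, j + 1} = 3"
    proof -
      have "3 \<le> j" using j j0(1) by simp
      then show ?thesis by (auto simp: card_insert_if)
    qed
    have dec: "decay (2 ^ j) x ^ M * ?G x \<le> ?A" for x
    proof -
      have "decay (2 ^ j) x ^ M * ?G x = (\<Sum>i\<in>{j - 1, j, j + 1}. decay (2 ^ j) x ^ M * lp_size \<phi>\<^sub>0 \<phi> i (win j) x)"
        by (rule sum_distrib_left)
      also have "\<dots> \<le> (\<Sum>i\<in>{j - 1, j, j + 1}. E * (2 ^ j) ^ CARD('d))"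
        by (intro sum_mono E j)
      finally show ?thesis using dist by simp
    qed
    have "(\<integral>\<^sup>+x. ennreal (?G x powr ?P) \<partial>torus) \<le> ennreal (?A powr ?P * (4 * pi / 2 ^ j) ^ CARD('d))"
      by (rule decay_Lr[OF P(1) M2 _ _ _ dec]) (use E(1) in \<open>auto intro!: sum_nonneg\<close>)
    then have "Lnorm p ?G \<le> ennreal ((?A powr ?P * (4 * pi / 2 ^ j) ^ CARD('d)) powr recip p)"
      using E(1) by (intro Lnorm_le p pinf) (auto intro!: sum_nonneg)
    also have "(?A powr ?P * (4 * pi / 2 ^ j) ^ CARD('d)) powr recip p = b * 2 powr (real j * ?e)"
    proof -
      have 1: "(2 ^ j) ^ CARD('d) = 2 powr (real j * ?d)"
        by (simp add: powr_realpow[symmetric] powr_powr)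
      have 2: "(4 * pi / 2 ^ j) ^ CARD('d) = (4 * pi) powr ?d * 2 powr (- (real j * ?d))"
        unfolding power_divide 1 by (simp add: powr_realpow powr_minus_divide)
      have "(?A powr ?P * (4 * pi / 2 ^ j) ^ CARD('d)) powr recip p
          = ?A * (((4 * pi) powr ?d) powr (1 / ?P) * 2 powr (- (real j * ?d) / ?P))"
        unfolding 2 P(2) using E(1) P(1) by (simp add: powr_mult powr_powr)
      also have "\<dots> = b * (2 powr (real j * ?d) * 2 powr (- (real j * ?d) / ?P))"
        unfolding 1 b_def by (simp add: mult_ac)
      also have "2 powr (real j * ?d) * 2 powr (- (real j * ?d) / ?P) = 2 powr (real j * ?e)"
        by (simp add: algebra_simps flip: powr_add)
      finally show ?thesis .
    qed
    finally show "Lnorm p ?G \<le> ennreal (b * 2 powr (real j * ?e))" .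
  next
    fix j assume j: "j\<^sub>0 \<le> j"
    let ?K = "lp_size \<phi>\<^sub>0 \<phi> j (\<lambda>n. blk j n * win j n)"
    let ?c = "\<lambda>n. lp_cutoff \<phi>\<^sub>0 \<phi> j (lat n) * (blk j n * win j n)"
    let ?T = "S * 2 powr (real j * ((1 + \<rho>) * ?d / 2))"
    have KT: "?K x \<le> ?T" for x by (rule S(2)[OF j]) simp
    have fin: "finite {n. ?c n \<noteq> 0}" by (rule finite_subset[OF _ finite_win[of j]]) auto
    have "c / 4 * 2 powr (real j * ?d) \<le> (\<Sum>n | blk j n \<noteq> 0. 1 / 4 * (norm (blk j n))\<^sup>2)"
      using c(2)[OF j] unfolding sum_distrib_left[symmetric] by simp
    also have "\<dots> \<le> (\<Sum>n | blk j n \<noteq> 0. (norm (?c n))\<^sup>2)"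
    proof (rule sum_mono)
      fix n assume "n \<in> {n. blk j n \<noteq> 0}"
      then have nz: "blk j n \<noteq> 0" by simp
      have "7 / 8 * (7 / 8) \<le> norm (lp_cutoff \<phi>\<^sub>0 \<phi> j (lat n)) * norm (win j n)"
        using near_one[OF j nz] by (intro mult_mono half_le_norm) auto
      then have "1 / 2 * norm (blk j n) \<le> norm (lp_cutoff \<phi>\<^sub>0 \<phi> j (lat n)) * norm (win j n) * norm (blk j n)"
        by (intro mult_right_mono) auto
      then have "(1 / 2 * norm (blk j n))\<^sup>2 \<le> (norm (?c n))\<^sup>2"
        by (intro power_mono) (auto simp: norm_mult mult_ac)
      then show "1 / 4 * (norm (blk j n))\<^sup>2 \<le> (norm (?c n))\<^sup>2" by (simp add: power_mult_distrib power_divide)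
    qed
    also have "\<dots> = (\<Sum>n | ?c n \<noteq> 0. (norm (?c n))\<^sup>2)"
      by (rule sum.mono_neutral_right) (use finite_blk in auto)
    also have "\<dots> \<le> (2 * pi) ^ CARD('d) * (\<Sum>n | ?c n \<noteq> 0. (norm (?c n))\<^sup>2)"
    proof -
      have "(1::real) \<le> (2 * pi) ^ CARD('d)" using pi_ge_two by (intro one_le_power) auto
      from mult_right_mono[OF this, of "\<Sum>n | ?c n \<noteq> 0. (norm (?c n))\<^sup>2"] show ?thesis by (simp add: sum_nonneg)
    qed
    finally have "ennreal (c / 4 * 2 powr (real j * ?d)) \<le> (\<integral>\<^sup>+x. ennreal ((norm (tpoly ?c x))\<^sup>2) \<partial>torus)"
      unfolding parseval[OF fin] by (rule ennreal_leI)
    also have "\<dots> = (\<integral>\<^sup>+x. ennreal (?K x powr 2) \<partial>torus)"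
      by (simp add: lp_size_def powr_numeral)
    also have "\<dots> \<le> ennreal (?T powr (2 - ?P)) * (\<integral>\<^sup>+x. ennreal (?K x powr ?P) \<partial>torus)"
      using KT P(1) P2 S(1) by (intro nn_integral_powr_split continuous_on_lp_size) auto
    finally have "ennreal (?T powr (?P - 2)) * ennreal (c / 4 * 2 powr (real j * ?d))
        \<le> ennreal (?T powr (?P - 2)) * (ennreal (?T powr (2 - ?P)) * (\<integral>\<^sup>+x. ennreal (?K x powr ?P) \<partial>torus))"
      by (rule mult_left_mono) simp
    also have "\<dots> = (\<integral>\<^sup>+x. ennreal (?K x powr ?P) \<partial>torus)"
      using S(1) by (simp add: mult.assoc[symmetric] ennreal_mult[symmetric] powr_add[symmetric])
    finally have le: "ennreal (?T powr (?P - 2)) * ennreal (c / 4 * 2 powr (real j * ?d)) \<le> (\<integral>\<^sup>+x. ennreal (?K x powr ?P) \<partial>torus)" .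
    have "ennreal (?T powr (?P - 2) * (c / 4 * 2 powr (real j * ?d))) = ennreal (?T powr (?P - 2)) * ennreal (c / 4 * 2 powr (real j * ?d))"
      using c(1) by (intro ennreal_mult) auto
    then have "ennreal (?T powr (?P - 2) * (c / 4 * 2 powr (real j * ?d))) \<le> (\<integral>\<^sup>+x. ennreal (?K x powr ?P) \<partial>torus)"
      using le by (simp only:)
    then have "ennreal ((?T powr (?P - 2) * (c / 4 * 2 powr (real j * ?d))) powr recip p) \<le> Lnorm p ?K"
      using c(1) by (intro Lnorm_ge p pinf) auto
    also have "(?T powr (?P - 2) * (c / 4 * 2 powr (real j * ?d))) powr recip p = g * 2 powr (real j * (sigma_loss CARD('d) p \<rho> + ?e))"
    proof -
      have "?T powr (?P - 2) * (c / 4 * 2 powr (real j * ?d))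
          = (S powr (?P - 2) * (c / 4)) * 2 powr (real j * ((1 + \<rho>) * ?d / 2) * (?P - 2) + real j * ?d)"
        using S(1) by (simp add: powr_mult powr_powr powr_add)
      also have "\<dots> powr recip p = g * 2 powr ((real j * ((1 + \<rho>) * ?d / 2) * (?P - 2) + real j * ?d) / ?P)"
      proof -
        have "(A * 2 powr z) powr (1 / ?P) = A powr (1 / ?P) * 2 powr (z / ?P)" if "0 \<le> A" for A z
          using that by (simp add: powr_mult powr_powr)
        moreover have "0 \<le> S powr (?P - 2) * (c / 4)" using c(1) by simp
        ultimately show ?thesis unfolding P(2) g_def by blast
      qed
      also have "(real j * ((1 + \<rho>) * ?d / 2) * (?P - 2) + real j * ?d) / ?P = real j * (sigma_loss CARD('d) p \<rho> + ?e)"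
        unfolding \<sigma> using P(1) by (simp add: field_simps)
      finally show ?thesis .
    qed
    finally show "ennreal (g * 2 powr (real j * (sigma_loss CARD('d) p \<rho> + ?e))) \<le> Lnorm p ?K" .
  qed
  then show ?thesis by blast
qed

text \<open>If the input carries the conjugate of the multiplier, then the output has coefficients that are
  close to the nonnegative numbers \<open>(norm (blk j n))\<^sup>2\<close>, and they add up without cancellation as
  long as \<open>x\<close> is within a small multiple of \<open>1 / 2 ^ j\<close> of the origin.\<close>

lemma concentrated_output:
  "\<exists>c>0. \<forall>j x. j\<^sub>0 \<le> j \<longrightarrow> x \<in> corner (1 / (16 * real CARD('d) * 2 ^ j)) \<longrightarrow>
     c * 2 powr (real j * real CARD('d)) \<le> lp_size \<phi>\<^sub>0 \<phi> j (\<lambda>n. blk j n * (win j n * cnj (blk j n))) x"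
proof -
  obtain c where c: "0 < c" "\<And>j. j\<^sub>0 \<le> j \<Longrightarrow> c * 2 powr (real j * real CARD('d)) \<le> (\<Sum>n | blk j n \<noteq> 0. (norm (blk j n))\<^sup>2)"
    using blk_mass by blast
  have "c / 2 * 2 powr (real j * real CARD('d)) \<le> lp_size \<phi>\<^sub>0 \<phi> j (\<lambda>n. blk j n * (win j n * cnj (blk j n))) x"
    if j: "j\<^sub>0 \<le> j" and x: "x \<in> corner (1 / (16 * real CARD('d) * 2 ^ j))" for j and x :: "real ^ 'd"
  proof -
    let ?r = "1 / (16 * real CARD('d) * 2 ^ j)"
    have "norm x \<le> (\<Sum>k\<in>UNIV. \<bar>x $ k\<bar>)" by (rule norm_le_l1_cart)
    also have "\<dots> \<le> (\<Sum>k\<in>(UNIV :: 'd set). ?r)"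
      using x by (intro sum_mono) (auto simp: corner_def mem_box_cart)
    finally have nx: "norm x \<le> 1 / (16 * 2 ^ j)" by simp
    have chr1: "norm (chr n x - 1) \<le> 1 / 8" if "blk j n \<noteq> 0" for n
    proof -
      have "norm (chr n x - 1) \<le> \<bar>lat n \<bullet> x\<bar>"
        using norm_one_minus_exp[of "lat n \<bullet> x"] abs_sin_x_le_abs_x[of "(lat n \<bullet> x) / 2"]
        by (simp add: chr_def norm_minus_commute)
      also have "\<dots> \<le> norm (lat n) * norm x" by (rule Cauchy_Schwarz_ineq2)
      also have "\<dots> \<le> (2 * 2 ^ j) * (1 / (16 * 2 ^ j))"
        using nx near_annulus[OF blk_near[OF j that]] by (intro mult_mono) (auto simp: annulus_def intro: order_trans)
      finally show ?thesis by simp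
    qed
    let ?c = "\<lambda>n. lp_cutoff \<phi>\<^sub>0 \<phi> j (lat n) * (blk j n * (win j n * cnj (blk j n)))"
    \<comment> \<open>All three factors other than \<open>(norm (blk j n))\<^sup>2\<close> are within \<open>1 / 8\<close> of one.\<close>
    have trm: "1 / 2 * (norm (blk j n))\<^sup>2 \<le> Re (?c n * chr n x)" if nz: "blk j n \<noteq> 0" for n
    proof -
      have "?c n * chr n x = of_real ((norm (blk j n))\<^sup>2) * (lp_cutoff \<phi>\<^sub>0 \<phi> j (lat n) * win j n * chr n x)"
        unfolding complex_norm_square by (simp add: mult_ac)
      then have "Re (?c n * chr n x) = (norm (blk j n))\<^sup>2 * Re (lp_cutoff \<phi>\<^sub>0 \<phi> j (lat n) * win j n * chr n x)"
        by (simp only: Re_complex_of_real Im_complex_of_real times_complex.sel mult_zero_left diff_zero)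
      moreover have "1 / 2 \<le> Re (lp_cutoff \<phi>\<^sub>0 \<phi> j (lat n) * win j n * chr n x)"
        using near_one[OF j nz] chr1[OF nz] by (rule Re_near_one)
      ultimately show ?thesis
        using mult_left_mono[of "1 / 2" "Re (lp_cutoff \<phi>\<^sub>0 \<phi> j (lat n) * win j n * chr n x)" "(norm (blk j n))\<^sup>2"] by simp
    qed
    have "c / 2 * 2 powr (real j * real CARD('d)) \<le> (\<Sum>n | blk j n \<noteq> 0. 1 / 2 * (norm (blk j n))\<^sup>2)"
      using c(2)[OF j] unfolding sum_distrib_left[symmetric] by simp
    also have "\<dots> \<le> (\<Sum>n | blk j n \<noteq> 0. Re (?c n * chr n x))"
      by (intro sum_mono trm) simp
    also have "\<dots> = Re (tpoly ?c x)"
      by (subst tpoly_eq_sum[OF finite_blk[of j]]) auto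
    also have "\<dots> \<le> lp_size \<phi>\<^sub>0 \<phi> j (\<lambda>n. blk j n * (win j n * cnj (blk j n))) x"
      unfolding lp_size_def by (rule complex_Re_le_cmod)
    finally show ?thesis .
  qed
  then show ?thesis using c(1) by (intro exI[of _ "c / 2"]) auto
qed

lemma flat_L2:
  "\<exists>C>0. \<forall>j i. j\<^sub>0 \<le> j \<longrightarrow> i \<in> {j - 1, j, j + 1} \<longrightarrow>
     (\<integral>\<^sup>+x. ennreal ((lp_size \<phi>\<^sub>0 \<phi> i (\<lambda>n. win j n * cnj (blk j n)) x)\<^sup>2) \<partial>torus) \<le> ennreal (C * 2 powr (real j * real CARD('d)))"
proof -
  let ?d = "CARD('d)"
  obtain Ce where Ce: "0 < Ce" "\<And>\<xi>. norm (\<eta> \<xi>) \<le> Ce" using \<eta>_bounded by blast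
  have "\<exists>C>0. \<forall>\<xi>. norm (\<Theta> \<tau> \<xi>) \<le> C" for \<tau>
  proof -
    have "\<exists>C>0. \<forall>js. length js = 0 \<longrightarrow> (\<forall>x. norm (foldr partial js (\<Theta> \<tau>) x) \<le> C)"
      by (rule smooth_compact_bounded[OF smooth_\<Theta>]) (rule \<Theta>_vanish)
    then show ?thesis by auto
  qed
  then obtain Ct where Ct: "\<And>\<tau>. 0 < Ct \<tau>" "\<And>\<tau> \<xi>. norm (\<Theta> \<tau> \<xi>) \<le> Ct \<tau>" by metis
  define D where "D = ((Ct 2 + Ct 1 + Ct (1 / 2)) * Ce)\<^sup>2"
  have D0: "0 < D" unfolding D_def using Ct(1) Ce(1) by (intro zero_less_power mult_pos_pos add_pos_pos)
  have "(\<integral>\<^sup>+x. ennreal ((lp_size \<phi>\<^sub>0 \<phi> i (\<lambda>n. win j n * cnj (blk j n)) x)\<^sup>2) \<partial>torus)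
      \<le> ennreal ((2 * pi) ^ ?d * (5 ^ ?d * D) * 2 powr (real j * real ?d))"
    if j: "j\<^sub>0 \<le> j" and i: "i \<in> {j - 1, j, j + 1}" for j i
  proof -
    let ?c = "\<lambda>n. lp_cutoff \<phi>\<^sub>0 \<phi> i (lat n) * (win j n * cnj (blk j n))"
    let ?N = "{n :: int ^ 'd. norm (lat n) \<le> 2 * 2 ^ j}"
    have finN: "finite ?N" by (rule lattice_ball) simp
    have sub: "{n. ?c n \<noteq> 0} \<subseteq> ?N" using win_ball by auto
    obtain \<tau> where \<tau>: "\<tau> \<in> {2, 1, 1 / 2}" "\<And>n. lp_cutoff \<phi>\<^sub>0 \<phi> i (lat n) * win j n = \<Theta> \<tau> ((1 / 2 ^ j) *\<^sub>R lat n)"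
      using cutoff_win[OF j i] by blast
    interpret bump \<eta> "side j" by (rule bump)
    have coef: "(norm (?c n))\<^sup>2 \<le> D" for n
    proof -
      have "norm (?c n) = norm (\<Theta> \<tau> ((1 / 2 ^ j) *\<^sub>R lat n)) * norm (blk j n)"
        by (simp add: mult.assoc[symmetric] \<tau>(2) norm_mult)
      also have "\<dots> \<le> (Ct 2 + Ct 1 + Ct (1 / 2)) * Ce"
      proof (intro mult_mono)
        have "Ct \<tau> \<le> Ct 2 + Ct 1 + Ct (1 / 2)"
          using \<tau>(1) Ct(1)[of 2] Ct(1)[of 1] Ct(1)[of "1 / 2"] by (elim insertE emptyE) (simp_all only:; linarith)+
        then show "norm (\<Theta> \<tau> ((1 / 2 ^ j) *\<^sub>R lat n)) \<le> Ct 2 + Ct 1 + Ct (1 / 2)"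
          using Ct(2) order_trans by blast
        show "norm (blk j n) \<le> Ce" unfolding blk_def by (rule block_bound[OF Ce(2)])
        show "0 \<le> Ct 2 + Ct 1 + Ct (1 / 2)" using Ct(1) by (simp add: add_nonneg_nonneg less_imp_le)
      qed simp
      finally show ?thesis unfolding D_def by (rule power_mono) simp
    qed
    have "(\<Sum>n | ?c n \<noteq> 0. (norm (?c n))\<^sup>2) \<le> (\<Sum>n\<in>?N. (norm (?c n))\<^sup>2)"
      by (rule sum_mono2[OF finN sub]) simp
    also have "\<dots> \<le> real (card ?N) * D"
      by (rule sum_bounded_above) (rule coef)
    also have "\<dots> \<le> (5 * 2 ^ j) ^ ?d * D"
    proof (rule mult_right_mono)
      have "real (card ?N) \<le> (2 * (2 * 2 ^ j) + 1) ^ ?d" by (rule lattice_ball) simp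
      also have "\<dots> \<le> (5 * 2 ^ j) ^ ?d"
      proof (rule power_mono)
        have "(1::real) \<le> 2 ^ j" by simp
        then show "2 * (2 * 2 ^ j) + 1 \<le> 5 * (2::real) ^ j" by linarith
      qed simp
      finally show "real (card ?N) \<le> (5 * 2 ^ j) ^ ?d" .
    qed (use D0 in simp)
    finally have le: "(\<Sum>n | ?c n \<noteq> 0. (norm (?c n))\<^sup>2) \<le> (5 * 2 ^ j) ^ ?d * D" .
    have "(\<integral>\<^sup>+x. ennreal ((lp_size \<phi>\<^sub>0 \<phi> i (\<lambda>n. win j n * cnj (blk j n)) x)\<^sup>2) \<partial>torus)
        = ennreal ((2 * pi) ^ ?d * (\<Sum>n | ?c n \<noteq> 0. (norm (?c n))\<^sup>2))"
      unfolding lp_size_def by (rule parseval) (rule finite_subset[OF sub finN])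
    also have "\<dots> \<le> ennreal ((2 * pi) ^ ?d * ((5 * 2 ^ j) ^ ?d * D))"
      by (intro ennreal_leI mult_left_mono le) simp
    also have "(2 * pi) ^ ?d * ((5 * 2 ^ j) ^ ?d * D) = (2 * pi) ^ ?d * (5 ^ ?d * D) * 2 powr (real j * real ?d)"
      by (simp add: power_mult_distrib powr_realpow[symmetric] powr_powr)
    finally show ?thesis .
  qed
  then show ?thesis using D0 by (intro exI[of _ "(2 * pi) ^ ?d * (5 ^ ?d * D)"]) auto
qed

text \<open>For \<open>p \<ge> 2\<close> the roles are exchanged: the input is the flat function, whose \<open>L\<^sup>p\<close> size
  follows from its uniform and its \<open>L\<^sup>2\<close> norm, and the multiplier focuses it at the origin.\<close>

lemma extremal_large:
  assumes p: "2 \<le> p"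
  shows "\<exists>v B \<gamma>. extremal \<phi>\<^sub>0 \<phi> (osc m) v B \<gamma> (m + sigma_loss CARD('d) p \<rho>) p j\<^sub>0"
proof -
  let ?d = "real CARD('d)"
  have p0: "0 < p" using p by (rule less_le_trans[rotated]) simp
  have half: "recip p \<le> 1 / 2"
  proof (cases "p = \<infinity>")
    case False
    note P = finite_exponent[OF p0 False]
    have "ennreal 2 \<le> ennreal (enn2real p)" using p P(3) by simp
    then have "2 \<le> enn2real p" by (simp add: ennreal_le_iff2)
    then show ?thesis using P(1) unfolding P(2) by (simp add: field_simps)
  qed simp
  have \<sigma>: "sigma_loss CARD('d) p \<rho> = ?d * (1 - \<rho>) * (1 / 2 - recip p)"
    using half by (simp add: sigma_loss_def recip_def)
  obtain S where S: "0 < S" "\<And>j i x. j\<^sub>0 \<le> j \<Longrightarrow> i \<in> {j - 1, j, j + 1} \<Longrightarrow>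
     lp_size \<phi>\<^sub>0 \<phi> i (\<lambda>n. win j n * cnj (blk j n)) x \<le> S * 2 powr (real j * ((1 + \<rho>) * ?d / 2))"
    using flat_size by blast
  obtain C where C0: "0 < C" "\<forall>j i. j\<^sub>0 \<le> j \<longrightarrow> i \<in> {j - 1, j, j + 1} \<longrightarrow>
     (\<integral>\<^sup>+x. ennreal ((lp_size \<phi>\<^sub>0 \<phi> i (\<lambda>n. win j n * cnj (blk j n)) x)\<^sup>2) \<partial>torus) \<le> ennreal (C * 2 powr (real j * ?d))"
    using flat_L2 by (elim exE conjE)
  note C = C0(1) C0(2)[rule_format]
  obtain c where c: "0 < c" "\<And>j x. j\<^sub>0 \<le> j \<Longrightarrow> x \<in> corner (1 / (16 * ?d * 2 ^ j)) \<Longrightarrow>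
     c * 2 powr (real j * ?d) \<le> lp_size \<phi>\<^sub>0 \<phi> j (\<lambda>n. blk j n * (win j n * cnj (blk j n))) x"
    using concentrated_output by blast
  define b where "b = (3 * S) powr (1 - 2 * recip p) * (9 * C) powr recip p"
  define g where "g = c * ((1 / (16 * ?d)) ^ CARD('d)) powr recip p"
  let ?e = "(1 + \<rho>) * ?d / 2 * (1 - 2 * recip p) + ?d * recip p"
  have "extremal \<phi>\<^sub>0 \<phi> (osc m) (\<lambda>j n. win j n * cnj (blk j n)) (\<lambda>j. b * 2 powr (real j * ?e)) (g / b) (m + sigma_loss CARD('d) p \<rho>) p j\<^sub>0"
  proof (rule extremalI[OF p0])
    show "0 < b" "0 < g" using S C c by (auto simp: b_def g_def)
    show "win j n \<noteq> 0" if "win j n * cnj (blk j n) \<noteq> 0" for j n using that by auto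
    fix j assume j: "j\<^sub>0 \<le> j"
    let ?f = "\<lambda>i. lp_size \<phi>\<^sub>0 \<phi> i (\<lambda>n. win j n * cnj (blk j n))"
    let ?I = "{j - 1, j, j + 1}"
    let ?G = "\<lambda>x. \<Sum>i\<in>?I. ?f i x"
    let ?T = "3 * S * 2 powr (real j * ((1 + \<rho>) * ?d / 2))"
    have dist: "card ?I = 3"
    proof -
      have "3 \<le> j" using j j0(1) by simp
      then show ?thesis by (auto simp: card_insert_if)
    qed
    have GT: "?G x \<le> ?T" for x
    proof -
      have "?G x \<le> (\<Sum>i\<in>?I. S * 2 powr (real j * ((1 + \<rho>) * ?d / 2)))" by (intro sum_mono S j)
      then show ?thesis using dist by simp
    qed
    have G0: "0 \<le> ?G x" for x by (intro sum_nonneg) simp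
    have contG: "continuous_on UNIV ?G" by (intro continuous_intros continuous_on_lp_size)
    have T0: "0 \<le> ?T" using S(1) by simp
    have "Lnorm p ?G \<le> ennreal (?T powr (1 - 2 * recip p) * (9 * C * 2 powr (real j * ?d)) powr recip p)"
    proof (cases "p = \<infinity>")
      case True
      have "esssup torus (\<lambda>x. ennreal (?G x)) \<le> ennreal ?T"
        using GT by (intro esssup_I measurable_ennreal_torus contG) (auto intro!: ennreal_leI)
      then show ?thesis using True S(1) C(1) by (simp add: Lnorm_def Lp_qnorm_def)
    next
      case False
      note P = finite_exponent[OF p0 False]
      let ?P = "enn2real p"
      have "ennreal 2 \<le> ennreal ?P" using p P(3) by simp
      then have P2: "2 \<le> ?P" by (simp add: ennreal_le_iff2)
      have "(\<integral>\<^sup>+x. ennreal (?G x powr 2) \<partial>torus) \<le> (\<integral>\<^sup>+x. (\<Sum>i\<in>?I. ennreal 3 * ennreal ((?f i x)\<^sup>2)) \<partial>torus)"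
      proof (rule nn_integral_mono)
        fix x
        have "(?G x)\<^sup>2 \<le> real (card ?I) * (\<Sum>i\<in>?I. (?f i x)\<^sup>2)"
          using sum_squared_le_sum_of_squares[of "\<lambda>i. ?f i x" ?I] by (simp only: mult.commute)
        then have "(?G x)\<^sup>2 \<le> (\<Sum>i\<in>?I. 3 * (?f i x)\<^sup>2)" unfolding dist by (simp add: sum_distrib_left)
        then have "ennreal (?G x powr 2) \<le> ennreal (\<Sum>i\<in>?I. 3 * (?f i x)\<^sup>2)"
          using G0[of x] by (intro ennreal_leI) (simp add: powr_numeral)
        also have "\<dots> = (\<Sum>i\<in>?I. ennreal 3 * ennreal ((?f i x)\<^sup>2))"
          by (subst sum_ennreal[symmetric]) (auto simp: ennreal_mult)
        finally show "ennreal (?G x powr 2) \<le> (\<Sum>i\<in>?I. ennreal 3 * ennreal ((?f i x)\<^sup>2))" .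
      qed
      also have "\<dots> = (\<Sum>i\<in>?I. ennreal 3 * (\<integral>\<^sup>+x. ennreal ((?f i x)\<^sup>2) \<partial>torus))"
      proof -
        have meas: "(\<lambda>x. ennreal ((?f i x)\<^sup>2)) \<in> borel_measurable torus" for i
          by (intro measurable_ennreal_torus continuous_intros continuous_on_lp_size)
        show ?thesis using meas by (subst nn_integral_sum) (auto simp: nn_integral_cmult)
      qed
      also have "\<dots> \<le> (\<Sum>i\<in>?I. ennreal 3 * ennreal (C * 2 powr (real j * ?d)))"
        by (intro sum_mono mult_left_mono C j) auto
      also have "\<dots> = ennreal (9 * C * 2 powr (real j * ?d))"
      proof -
        let ?Y = "C * 2 powr (real j * ?d)"
        have "(\<Sum>i\<in>?I. ennreal 3 * ennreal ?Y) = ennreal (\<Sum>i\<in>?I. 3 * ?Y)"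
          using C(1) by (subst sum_ennreal[symmetric]) (auto simp: ennreal_mult)
        also have "(\<Sum>i\<in>?I. 3 * ?Y) = 9 * C * 2 powr (real j * ?d)" using dist by simp
        finally show ?thesis .
      qed
      finally have L2: "(\<integral>\<^sup>+x. ennreal (?G x powr 2) \<partial>torus) \<le> ennreal (9 * C * 2 powr (real j * ?d))" .
      have "(\<integral>\<^sup>+x. ennreal (?G x powr ?P) \<partial>torus) \<le> ennreal (?T powr (?P - 2)) * (\<integral>\<^sup>+x. ennreal (?G x powr 2) \<partial>torus)"
        by (rule nn_integral_powr_split[OF contG G0 GT]) (use P2 T0 in auto)
      also have "\<dots> \<le> ennreal (?T powr (?P - 2)) * ennreal (9 * C * 2 powr (real j * ?d))"
        by (intro mult_left_mono L2) simp
      also have "\<dots> = ennreal (?T powr (?P - 2) * (9 * C * 2 powr (real j * ?d)))"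
        by (simp add: ennreal_mult')
      finally have "Lnorm p ?G \<le> ennreal ((?T powr (?P - 2) * (9 * C * 2 powr (real j * ?d))) powr recip p)"
        using C(1) by (intro Lnorm_le p0 False G0) auto
      also have "(?T powr (?P - 2) * (9 * C * 2 powr (real j * ?d))) powr recip p
          = ?T powr ((?P - 2) * recip p) * (9 * C * 2 powr (real j * ?d)) powr recip p"
      proof -
        have "(A powr z * Y) powr r = A powr (z * r) * Y powr r" if "0 \<le> Y" for A Y z r :: real
          using that by (simp add: powr_mult powr_powr)
        moreover have "0 \<le> 9 * C * 2 powr (real j * ?d)" using C(1) by simp
        ultimately show ?thesis by blast
      qed
      also have "(?P - 2) * recip p = 1 - 2 * recip p" using P(1) unfolding P(2) by (simp add: field_simps)
      finally show ?thesis .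
    qed
    also have "?T powr (1 - 2 * recip p) * (9 * C * 2 powr (real j * ?d)) powr recip p = b * 2 powr (real j * ?e)"
    proof -
      have "?T powr (1 - 2 * recip p) * (9 * C * 2 powr (real j * ?d)) powr recip p
          = b * (2 powr (real j * ((1 + \<rho>) * ?d / 2) * (1 - 2 * recip p)) * 2 powr (real j * ?d * recip p))"
        using S(1) C(1) by (simp add: b_def powr_mult powr_powr)
      also have "2 powr (real j * ((1 + \<rho>) * ?d / 2) * (1 - 2 * recip p)) * 2 powr (real j * ?d * recip p) = 2 powr (real j * ?e)"
        unfolding powr_add[symmetric] by (simp add: algebra_simps)
      finally show ?thesis .
    qed
    finally show "Lnorm p ?G \<le> ennreal (b * 2 powr (real j * ?e))" .
  next
    fix j assume j: "j\<^sub>0 \<le> j"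
    let ?K = "lp_size \<phi>\<^sub>0 \<phi> j (\<lambda>n. blk j n * (win j n * cnj (blk j n)))"
    let ?r = "1 / (16 * ?d * 2 ^ j)"
    have r: "0 < ?r" "?r \<le> 2 * pi"
    proof -
      have "0 < CARD('d)" by simp
      then have one: "1 \<le> 16 * ?d" by linarith
      have "1 * 1 \<le> 16 * ?d * (2::real) ^ j" by (rule mult_mono[OF one]) auto
      then have "?r \<le> 1" by (simp only: mult_1 divide_le_eq_1) simp
      then show "?r \<le> 2 * pi" using pi_ge_two by linarith
    qed simp
    have "ennreal (c * 2 powr (real j * ?d) * (?r ^ CARD('d)) powr recip p) \<le> Lnorm p ?K"
      by (rule Lnorm_corner[OF p0 _ continuous_on_lp_size r _ c(2)[OF j]]) (use c(1) in auto)
    also have "c * 2 powr (real j * ?d) * (?r ^ CARD('d)) powr recip p = g * 2 powr (real j * (sigma_loss CARD('d) p \<rho> + ?e))"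
    proof -
      have "?r ^ CARD('d) = (1 / (16 * ?d)) ^ CARD('d) * 2 powr (- (real j * ?d))"
      proof -
        have "(2 ^ j) ^ CARD('d) = 2 powr (real j * ?d)"
          by (simp add: powr_realpow[symmetric] powr_powr)
        then show ?thesis by (simp add: power_divide power_mult_distrib powr_minus_divide)
      qed
      then have "c * 2 powr (real j * ?d) * (?r ^ CARD('d)) powr recip p
          = g * (2 powr (real j * ?d) * 2 powr (- (real j * ?d) * recip p))"
        by (simp add: g_def powr_mult powr_powr)
      also have "2 powr (real j * ?d) * 2 powr (- (real j * ?d) * recip p) = 2 powr (real j * (sigma_loss CARD('d) p \<rho> + ?e))"
      proof -
        have "real j * ?d + - (real j * ?d) * recip p = real j * (sigma_loss CARD('d) p \<rho> + ?e)"
          unfolding \<sigma> by (simp add: field_simps)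
        then show ?thesis unfolding powr_add[symmetric] by (simp only:)
      qed
      finally show ?thesis .
    qed
    finally show "ennreal (g * 2 powr (real j * (sigma_loss CARD('d) p \<rho> + ?e))) \<le> Lnorm p ?K" .
  qed
  then show ?thesis by blast
qed

end

text \<open>The parameters are fixed one after the other by continuity of the two cutoffs, by the size of
  the cube, and by the decay of \<open>2 powr (- (j * (1 - \<rho>)))\<close>.\<close>

lemma oscillation_exists:
  fixes \<phi>\<^sub>0 \<phi> :: "real ^ 'd::finite \<Rightarrow> complex"
  assumes res: "lp_resolution \<phi>\<^sub>0 \<phi>" and \<rho>: "0 < \<rho>" "\<rho> < 1"
  shows "\<exists>r\<^sub>0 \<epsilon> c\<^sub>0 j\<^sub>0. oscillation \<phi>\<^sub>0 \<phi> \<rho> r\<^sub>0 \<epsilon> c\<^sub>0 j\<^sub>0"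
proof -
  let ?wr = "window_radius TYPE('d)" and ?d = "real CARD('d)"
  have near: "\<exists>r>0. \<forall>\<xi>. norm (\<xi> - a) \<le> r \<longrightarrow> norm (f \<xi> - 1) \<le> 1 / 8"
    if "smooth f" "f a = 1" for f :: "real ^ 'd \<Rightarrow> complex" and a
  proof -
    have "isCont f a" using smooth_imp_continuous[OF that(1), of UNIV] by (simp add: continuous_on_eq_continuous_at)
    then obtain \<delta> where "0 < \<delta>" "\<forall>\<xi>. norm (\<xi> - a) < \<delta> \<longrightarrow> norm (f \<xi> - f a) < 1 / 8"
      unfolding continuous_at_eps_delta dist_norm by (metis divide_pos_pos zero_less_numeral zero_less_one)
    then show ?thesis using that(2) by (intro exI[of _ "\<delta> / 2"]) (auto intro!: less_imp_le)
  qed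
  have sm: "smooth \<phi>\<^sub>0" "smooth \<phi>" using res by (auto simp: lp_resolution_def)
  obtain r0 where r0: "0 < r0" "\<And>\<xi>. norm \<xi> \<le> r0 \<Longrightarrow> norm (\<phi>\<^sub>0 \<xi> - 1) \<le> 1 / 8"
    using near[OF sm(1) lp_resolution_values(1)[OF res]] by auto
  obtain r1 where r1: "0 < r1" "\<And>\<xi>. norm (\<xi> - diagonal) \<le> r1 \<Longrightarrow> norm (\<phi> \<xi> - 1) \<le> 1 / 8"
    using near[OF sm(2) lp_resolution_values(2)[OF res norm_diagonal]] by auto
  note wr = window_radius_pos[where 'd = 'd]
  define \<epsilon> where "\<epsilon> = min r1 (min ?wr (r0 * ?wr / 2))"
  have \<epsilon>: "0 < \<epsilon>" "\<epsilon> \<le> r1" "\<epsilon> \<le> ?wr" "\<epsilon> \<le> r0 * ?wr / 2"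
    using r0 r1 wr by (auto simp: \<epsilon>_def)
  obtain c0 :: nat where c0: "2 * ?d / \<epsilon> < 2 ^ c0" using real_arch_pow[of 2 "2 * ?d / \<epsilon>"] by auto
  \<comment> \<open>Once \<open>j * (1 - \<rho>)\<close> exceeds \<open>c0 + N\<close>, both requirements on \<open>j\<^sub>0\<close> hold.\<close>
  obtain N :: nat where N: "(1 / 4 + ?d) * 2 / \<epsilon> < 2 ^ N" using real_arch_pow[of 2 "(1 / 4 + ?d) * 2 / \<epsilon>"] by auto
  obtain k :: nat where k: "(real c0 + real N) / (1 - \<rho>) \<le> real k" using real_arch_simple by blast
  have big: "real c0 + real N \<le> real j * (1 - \<rho>)" if "max 3 k \<le> j" for j
  proof -
    have "(real c0 + real N) / (1 - \<rho>) \<le> real j" using k that by linarith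
    then show ?thesis using \<rho> by (simp add: pos_divide_le_eq)
  qed
  have "oscillation \<phi>\<^sub>0 \<phi> \<rho> r0 \<epsilon> c0 (max 3 k)"
  proof
    show "\<epsilon> * (2 / ?wr) \<le> r0" using \<epsilon>(4) wr by (simp add: field_simps)
    show "?d / 2 ^ c0 \<le> \<epsilon> / 2" using c0 \<epsilon>(1) by (simp add: field_simps)
    show "real c0 \<le> real j * (1 - \<rho>)" if "max 3 k \<le> j" for j using big[OF that] by simp
    show "1 / 4 + ?d \<le> \<epsilon> / 2 * 2 powr (real j * (1 - \<rho>))" if "max 3 k \<le> j" for j
    proof -
      have "1 / 4 + ?d \<le> \<epsilon> / 2 * 2 ^ N" using N \<epsilon>(1) by (simp add: field_simps)
      also have "\<dots> = \<epsilon> / 2 * 2 powr real N" by (simp add: powr_realpow)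
      also have "\<dots> \<le> \<epsilon> / 2 * 2 powr (real j * (1 - \<rho>))"
        using big[OF that] \<epsilon>(1) by (intro mult_left_mono powr_mono) auto
      finally show ?thesis .
    qed
    show "norm (\<phi> \<xi> - 1) \<le> 1 / 8" if "norm (\<xi> - diagonal) \<le> \<epsilon>" for \<xi> using r1(2) that \<epsilon>(2) by simp
  qed (use res \<rho> r0 \<epsilon> in auto)
  then show ?thesis by blast
qed

lemma extremal_exists:
  fixes \<phi>\<^sub>0 \<phi> :: "real ^ 'd::finite \<Rightarrow> complex"
  assumes "lp_resolution \<phi>\<^sub>0 \<phi>" "0 < \<rho>" "\<rho> < 1" "0 < p"
  shows "\<exists>a v B \<gamma> j\<^sub>0. (\<lambda>x. a) \<in> tri_symbols m \<rho> \<delta> \<and> extremal \<phi>\<^sub>0 \<phi> a v B \<gamma> (m + sigma_loss CARD('d) p \<rho>) p j\<^sub>0"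
proof -
  obtain r\<^sub>0 \<epsilon> c\<^sub>0 j\<^sub>0 where "oscillation \<phi>\<^sub>0 \<phi> \<rho> r\<^sub>0 \<epsilon> c\<^sub>0 j\<^sub>0"
    using oscillation_exists[OF assms(1-3)] by blast
  then interpret oscillation \<phi>\<^sub>0 \<phi> \<rho> r\<^sub>0 \<epsilon> c\<^sub>0 j\<^sub>0 .
  have "\<exists>v B \<gamma>. extremal \<phi>\<^sub>0 \<phi> (osc m) v B \<gamma> (m + sigma_loss CARD('d) p \<rho>) p j\<^sub>0"
    using extremal_small[OF assms(4)] extremal_large by (cases "p < 2") auto
  then show ?thesis using osc_symbol[of m \<delta>] by blast
qed

theorem theorem5p11:
  fixes \<phi>\<^sub>0 \<phi> :: "real ^ 'd::finite \<Rightarrow> complex"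
    and \<rho> \<delta> m s \<kappa> \<sigma> :: real and p q t :: ennreal
  assumes "lp_resolution \<phi>\<^sub>0 \<phi>"
    and "0 < \<rho>" "\<rho> < 1" and "0 \<le> \<delta>" "\<delta> < \<rho>"
    and "0 < p" "0 < q" "0 < t"
    and sigma: "\<sigma> = sigma_loss CARD('d) p \<rho>"
  shows
    "((\<forall>a\<in>tri_symbols m \<rho> \<delta>.
          bounded_besov \<phi>\<^sub>0 \<phi> a (s + m + \<kappa>) s p q t \<or>
          (p < \<infinity> \<and> bounded_tl \<phi>\<^sub>0 \<phi> a (s + m + \<kappa>) s p q t))
        \<longrightarrow> \<kappa> \<ge> \<sigma>) \<and>
     ((\<forall>a\<in>tri_symbols m \<rho> \<delta>. bounded_besov \<phi>\<^sub>0 \<phi> a (s + m + \<sigma>) s p q t)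
        \<longrightarrow> q \<le> t) \<and>
     ((\<forall>a\<in>tri_symbols m \<rho> \<delta>.
          bounded_hol_besov \<phi>\<^sub>0 \<phi> a (s + m + \<kappa>) s p q t \<or>
          (p < \<infinity> \<and> bounded_hol_tl \<phi>\<^sub>0 \<phi> a (s + m + \<kappa>) s p q t))
        \<longrightarrow> \<kappa> \<ge> \<sigma>) \<and>
     ((\<forall>a\<in>tri_symbols m \<rho> \<delta>. bounded_hol_besov \<phi>\<^sub>0 \<phi> a (s + m + \<sigma>) s p q t)
        \<longrightarrow> q \<le> t)"
proof -
  obtain a v B \<gamma> j\<^sub>0 where a: "(\<lambda>x. a) \<in> tri_symbols m \<rho> \<delta>" and "extremal \<phi>\<^sub>0 \<phi> a v B \<gamma> (m + \<sigma>) p j\<^sub>0"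
    using extremal_exists[OF assms(1-3,6)] unfolding sigma by blast
  then interpret extremal \<phi>\<^sub>0 \<phi> a v B \<gamma> "m + \<sigma>" p j\<^sub>0 by simp
  have besov: "tpoly_bounded a (besov_qnorm \<phi>\<^sub>0 \<phi> u p q) (besov_qnorm \<phi>\<^sub>0 \<phi> s p t)"
    if "bounded_besov \<phi>\<^sub>0 \<phi> (\<lambda>x. a) u s p q t \<or> bounded_hol_besov \<phi>\<^sub>0 \<phi> (\<lambda>x. a) u s p q t" for u
    using that
    unfolding bounded_besov_def besov_plus_def bounded_hol_besov_def hol_besov_def hol_besov_qnorm_def[abs_def]
    by (elim disjE bounded_imp_tpoly_bounded hol_bounded_imp_tpoly_bounded)
  have tl: "tpoly_bounded a (tl_qnorm \<phi>\<^sub>0 \<phi> u p q) (tl_qnorm \<phi>\<^sub>0 \<phi> s p t)"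
    if "bounded_tl \<phi>\<^sub>0 \<phi> (\<lambda>x. a) u s p q t \<or> bounded_hol_tl \<phi>\<^sub>0 \<phi> (\<lambda>x. a) u s p q t" for u
    using that
    unfolding bounded_tl_def tl_plus_def bounded_hol_tl_def hol_tl_def hol_tl_qnorm_def[abs_def]
    by (elim disjE bounded_imp_tpoly_bounded hol_bounded_imp_tpoly_bounded)
  have loss: "\<sigma> \<le> \<kappa>"
    if "tpoly_bounded a (besov_qnorm \<phi>\<^sub>0 \<phi> (s + m + \<kappa>) p q) (besov_qnorm \<phi>\<^sub>0 \<phi> s p t) \<or>
        p < \<infinity> \<and> tpoly_bounded a (tl_qnorm \<phi>\<^sub>0 \<phi> (s + m + \<kappa>) p q) (tl_qnorm \<phi>\<^sub>0 \<phi> s p t)"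
    using that besov_loss[OF _ \<open>0 < q\<close> \<open>0 < t\<close>, of "s + m + \<kappa>" s] tl_loss[OF _ \<open>0 < q\<close> \<open>0 < t\<close>, of "s + m + \<kappa>" s] by auto
  have fine: "q \<le> t"
    if "tpoly_bounded a (besov_qnorm \<phi>\<^sub>0 \<phi> (s + m + \<sigma>) p q) (besov_qnorm \<phi>\<^sub>0 \<phi> s p t)"
  proof -
    have "s + m + \<sigma> = m + \<sigma> + s" by simp
    with that show ?thesis using besov_fine_index[OF _ \<open>0 < q\<close> \<open>0 < t\<close>, of s] by simp
  qed
  show ?thesis
    using a besov[of "s + m + \<kappa>"] besov[of "s + m + \<sigma>"] tl[of "s + m + \<kappa>"] loss fine by blast
qed

end
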